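(* Let $u\in H(T_{\max})$ be the unique solution of the Kirchhoff problem (K) of the context with initial data $u_0\in H^2(\Omega)\cap H_0^1(\Omega)$, $u_1\in H_0^1(\Omega)$, where $T_{\max}$ is the maximal existence time of $u$. **Case A.** Let $p=3$, $0<a<1/\Lambda$, $\lambda<b\lambda_1$ and $E(0)<d_3$. Then: (A1) $u(t)\in W_3^+$ for all $t\in[0,T_{\max})$, provided that $u_0\in W_3^+$; (A2) $u(t)\in W_3^-$ for all $t\in[0,T_{\max})$, provided that $u_0\in W_3^-$. **Case B.** Let $p=3$, $0<a<1/\Lambda$, $\|\psi_1\|_4^4-a\|\nabla\psi_1\|_2^4<0$ and $b\lambda_1<\lambda<b\lambda_1+\delta$ (with $\delta$ as in the context). Then $u(t)\in N_3^-\cap J^{d_3^-}$ for all $t\in[0,T_{\max})$, provided that $u_0\in N_3^-\cap J^{d_3^-}$ and $E(0)<d_3^-$. **Case C.** Let $3<p<5$, $\lambda\le b\lambda_1$ and $E(0)<d_p$. Then: (C1) $u(t)\in W_p^+$ for all $t\in[0,T_{\max})$, provided that $u_0\in W_p^+$; (C2) $u(t)\in W_p^-$ for all $t\in[0,T_{\max})$, provided that $u_0\in W_p^-$.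
   Context: $\Omega\subset\mathbb{R}^3$ is a bounded open set with smooth boundary; $a,b>0$, $\lambda\in\mathbb{R}$, $p>1$. $\|\cdot\|_q$ is the $L^q(\Omega)$ norm. Problem (K): $$u_{tt}-\Big(a\int_\Omega|\nabla u|^2dx+b\Big)\Delta u=\lambda u+|u|^{p-1}u\ (t>0,\ x\in\Omega),\quad u(0,x)=u_0(x),\ u_t(0,x)=u_1(x)\ (x\in\Omega),\quad u=0\ (t\ge0,\ x\in\partial\Omega).$$ $H(T)=C([0,T);H_0^1(\Omega)\cap H^2(\Omega))\cap C^1([0,T);H_0^1(\Omega))\cap C^2([0,T);L^2(\Omega))$. For $u_0\in H^2(\Omega)\cap H_0^1(\Omega)$, $u_1\in H_0^1(\Omega)$, problem (K) has a unique solution in $H(T)$ for some $T>0$ (known local existence result); $T_{\max}\in(0,\infty]$ is its maximal existence time. $u(t)$ denotes $u(t,\cdot)$. $\lambda_1>0$ is the principal Dirichlet eigenvalue of $-\Delta$ on $\Omega$, with positive eigenfunction $\psi_1$. $\Lambda=\inf\{\|\nabla u\|_2^4:\ u\in H_0^1(\Omega),\ \|u\|_4=1\}>0$. $$J(u)=\frac a4\|\nabla u\|_2^4+\frac b2\|\nabla u\|_2^2-\frac\lambda2\|u\|_2^2-\frac1{p+1}\|u\|_{p+1}^{p+1},\qquad I(u)=a\|\nabla u\|_2^4+b\|\nabla u\|_2^2-\lambda\|u\|_2^2-\|u\|_{p+1}^{p+1},$$ $E(0)=\frac12\|u_1\|_2^2+J(u_0)$. For $3\le p<5$: $N_p=\{u\in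 H_0^1(\Omega)\setminus\{0\}: I(u)=0\}$, $N_p^+=\{u\in H_0^1(\Omega): I(u)>0\}\cup\{0\}$, $N_p^-=\{u\in H_0^1(\Omega): I(u)<0\}$, $d_p=\inf_{N_p}J$, $J^{d}=\{u\in H_0^1(\Omega):J(u)<d\}$, $W_p^{\pm}=J^{d_p}\cap N_p^{\pm}$. $L^-=\{u\in H_0^1(\Omega): b\|\nabla u\|_2^2-\lambda\|u\|_2^2<0\}$, $S=\{u\in H_0^1(\Omega):\|u\|_4^4-a\|\nabla u\|_2^4>0\}$, and (for $p=3$) $d_3^-=\inf_{u\in N_3\cap L^-}J(u)$. In Case B, $\delta>0$ is a number such that $\overline{L^-}\cap\overline{S}=\{0\}$ (closures in $H_0^1(\Omega)$) for every $\lambda\in(b\lambda_1,b\lambda_1+\delta)$; such $\delta$ exists when $0<a<1/\Lambda$ and $\|\psi_1\|_4^4-a\|\nabla\psi_1\|_2^4<0$. *)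

theory Defs
  imports "HOL-Analysis.Analysis"
begin

text \<open>Elements of Lebesgue and Sobolev spaces on \<open>\<Omega>\<close> are represented by functions on the whole of
  \<open>real ^ 3\<close>, of which only the restriction to \<open>\<Omega>\<close>, up to null sets, matters. All norms and
  functionals below are invariant under modification on a null set, and equality of elements is
  equality almost everywhere on \<open>\<Omega>\<close>.\<close>

section \<open>Smooth functions, test functions, smooth boundary\<close>

definition pd :: "3 \<Rightarrow> (real ^ 3 \<Rightarrow> real) \<Rightarrow> real ^ 3 \<Rightarrow> real" where
  "pd i f x = frechet_derivative f (at x) (axis i 1)"

primrec Ck_on :: "nat \<Rightarrow> (real ^ 3) set \<Rightarrow> (real ^ 3 \<Rightarrow> real) \<Rightarrow> bool" where
  "Ck_on 0 U f \<longleftrightarrow> continuous_on U f"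
| "Ck_on (Suc k) U f \<longleftrightarrow> (\<forall>x\<in>U. f differentiable (at x)) \<and> (\<forall>i. Ck_on k U (pd i f))"

definition Cinf_on :: "(real ^ 3) set \<Rightarrow> (real ^ 3 \<Rightarrow> real) \<Rightarrow> bool" where
  "Cinf_on U f \<longleftrightarrow> (\<forall>k. Ck_on k U f)"

definition test_functions :: "(real ^ 3) set \<Rightarrow> (real ^ 3 \<Rightarrow> real) set" where
  "test_functions \<Omega> =
     {\<phi>. Cinf_on UNIV \<phi> \<and> (\<exists>K. compact K \<and> K \<subseteq> \<Omega> \<and> (\<forall>x. x \<notin> K \<longrightarrow> \<phi> x = 0))}"

text \<open>Near each boundary point \<open>\<Omega>\<close> is the strict sublevel set of a smooth local defining function
  with nonvanishing gradient. For open \<open>\<Omega>\<close> this forces \<open>\<rho> z = 0\<close>, and by the implicit function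
  theorem \<open>\<Omega>\<close> then lies locally on one side of a smooth graph.\<close>

definition smooth_boundary :: "(real ^ 3) set \<Rightarrow> bool" where
  "smooth_boundary \<Omega> \<longleftrightarrow>
     (\<forall>z\<in>frontier \<Omega>. \<exists>U \<rho>. open U \<and> z \<in> U \<and> Cinf_on U \<rho> \<and> (\<exists>i. pd i \<rho> z \<noteq> 0) \<and>
        \<Omega> \<inter> U = {x\<in>U. \<rho> x < 0})"


section \<open>Lebesgue and Sobolev spaces\<close>

definition Lnorm :: "(real ^ 3) set \<Rightarrow> real \<Rightarrow> (real ^ 3 \<Rightarrow> 'b::real_normed_vector) \<Rightarrow> real" where
  "Lnorm \<Omega> q f = (LINT x|lebesgue_on \<Omega>. norm (f x) powr q) powr (1 / q)"

definition L2 :: "(real ^ 3) set \<Rightarrow> (real ^ 3 \<Rightarrow> real) set" where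
  "L2 \<Omega> = {f. f \<in> borel_measurable (lebesgue_on \<Omega>) \<and>
               integrable (lebesgue_on \<Omega>) (\<lambda>x. (f x)\<^sup>2)}"

definition loc_integrable :: "(real ^ 3) set \<Rightarrow> (real ^ 3 \<Rightarrow> real) \<Rightarrow> bool" where
  "loc_integrable \<Omega> f \<longleftrightarrow> (\<forall>K. compact K \<and> K \<subseteq> \<Omega> \<longrightarrow> integrable (lebesgue_on K) f)"

definition is_weak_pd ::
  "(real ^ 3) set \<Rightarrow> 3 \<Rightarrow> (real ^ 3 \<Rightarrow> real) \<Rightarrow> (real ^ 3 \<Rightarrow> real) \<Rightarrow> bool" where
  "is_weak_pd \<Omega> i f g \<longleftrightarrow> loc_integrable \<Omega> f \<and> loc_integrable \<Omega> g \<and>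
     (\<forall>\<phi>\<in>test_functions \<Omega>.
        (LINT x|lebesgue_on \<Omega>. f x * pd i \<phi> x) = - (LINT x|lebesgue_on \<Omega>. g x * \<phi> x))"

text \<open>Weak derivatives are unique up to null sets; \<open>wpd\<close> picks a representative, and is only
  meaningful for functions possessing a weak derivative.\<close>

definition wpd :: "(real ^ 3) set \<Rightarrow> 3 \<Rightarrow> (real ^ 3 \<Rightarrow> real) \<Rightarrow> real ^ 3 \<Rightarrow> real" where
  "wpd \<Omega> i f = (SOME g. is_weak_pd \<Omega> i f g)"

definition wgrad :: "(real ^ 3) set \<Rightarrow> (real ^ 3 \<Rightarrow> real) \<Rightarrow> real ^ 3 \<Rightarrow> real ^ 3" where
  "wgrad \<Omega> f x = (\<chi> i. wpd \<Omega> i f x)"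

definition wlaplacian :: "(real ^ 3) set \<Rightarrow> (real ^ 3 \<Rightarrow> real) \<Rightarrow> real ^ 3 \<Rightarrow> real" where
  "wlaplacian \<Omega> f x = (\<Sum>i\<in>UNIV. wpd \<Omega> i (wpd \<Omega> i f) x)"

definition H1 :: "(real ^ 3) set \<Rightarrow> (real ^ 3 \<Rightarrow> real) set" where
  "H1 \<Omega> = {f\<in>L2 \<Omega>. \<forall>i. \<exists>g\<in>L2 \<Omega>. is_weak_pd \<Omega> i f g}"

definition H2 :: "(real ^ 3) set \<Rightarrow> (real ^ 3 \<Rightarrow> real) set" where
  "H2 \<Omega> = {f\<in>H1 \<Omega>. \<forall>i. wpd \<Omega> i f \<in> H1 \<Omega>}"

definition H1norm :: "(real ^ 3) set \<Rightarrow> (real ^ 3 \<Rightarrow> real) \<Rightarrow> real" where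
  "H1norm \<Omega> f = sqrt ((Lnorm \<Omega> 2 f)\<^sup>2 + (Lnorm \<Omega> 2 (wgrad \<Omega> f))\<^sup>2)"

definition H2norm :: "(real ^ 3) set \<Rightarrow> (real ^ 3 \<Rightarrow> real) \<Rightarrow> real" where
  "H2norm \<Omega> f = sqrt ((H1norm \<Omega> f)\<^sup>2 +
     (\<Sum>i\<in>UNIV. \<Sum>j\<in>UNIV. (Lnorm \<Omega> 2 (wpd \<Omega> i (wpd \<Omega> j f)))\<^sup>2))"

definition H1_closure :: "(real ^ 3) set \<Rightarrow> (real ^ 3 \<Rightarrow> real) set \<Rightarrow> (real ^ 3 \<Rightarrow> real) set" where
  "H1_closure \<Omega> A = {f\<in>H1 \<Omega>. \<forall>e>0. \<exists>g\<in>A. H1norm \<Omega> (\<lambda>x. f x - g x) < e}"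

definition H01 :: "(real ^ 3) set \<Rightarrow> (real ^ 3 \<Rightarrow> real) set" where
  "H01 \<Omega> = H1_closure \<Omega> (test_functions \<Omega>)"

definition H01_closure :: "(real ^ 3) set \<Rightarrow> (real ^ 3 \<Rightarrow> real) set \<Rightarrow> (real ^ 3 \<Rightarrow> real) set" where
  "H01_closure \<Omega> A = H01 \<Omega> \<inter> H1_closure \<Omega> A"

text \<open>The representatives of the zero element of \<open>H01 \<Omega>\<close>.\<close>

definition H01_zero :: "(real ^ 3) set \<Rightarrow> (real ^ 3 \<Rightarrow> real) set" where
  "H01_zero \<Omega> = {f\<in>H01 \<Omega>. AE x in lebesgue_on \<Omega>. f x = 0}"


section \<open>Principal eigenvalue and Sobolev constant\<close>

text \<open>Weak formulation of \<open>-\<Delta>\<psi> = \<mu> \<psi>\<close> with \<open>\<psi> = 0\<close> on the boundary. The principal eigenvalue is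
  the least eigenvalue; it is paired with an eigenfunction that is positive almost everywhere.\<close>

definition dirichlet_eigenpair :: "(real ^ 3) set \<Rightarrow> real \<Rightarrow> (real ^ 3 \<Rightarrow> real) \<Rightarrow> bool" where
  "dirichlet_eigenpair \<Omega> \<mu> \<psi> \<longleftrightarrow> \<psi> \<in> H01 \<Omega> - H01_zero \<Omega> \<and>
     (\<forall>\<phi>\<in>H01 \<Omega>. (LINT x|lebesgue_on \<Omega>. wgrad \<Omega> \<psi> x \<bullet> wgrad \<Omega> \<phi> x) =
                 \<mu> * (LINT x|lebesgue_on \<Omega>. \<psi> x * \<phi> x))"

definition principal_eigenpair :: "(real ^ 3) set \<Rightarrow> real \<Rightarrow> (real ^ 3 \<Rightarrow> real) \<Rightarrow> bool" where
  "principal_eigenpair \<Omega> \<mu> \<psi> \<longleftrightarrow> dirichlet_eigenpair \<Omega> \<mu> \<psi> \<and>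
     (\<forall>\<mu>' \<psi>'. dirichlet_eigenpair \<Omega> \<mu>' \<psi>' \<longrightarrow> \<mu> \<le> \<mu>') \<and>
     (AE x in lebesgue_on \<Omega>. \<psi> x > 0)"

definition Lam :: "(real ^ 3) set \<Rightarrow> real" where
  "Lam \<Omega> = Inf {(Lnorm \<Omega> 2 (wgrad \<Omega> u)) ^ 4 | u. u \<in> H01 \<Omega> \<and> Lnorm \<Omega> 4 u = 1}"


section \<open>Functionals and sets\<close>

definition Jfun ::
  "(real ^ 3) set \<Rightarrow> real \<Rightarrow> real \<Rightarrow> real \<Rightarrow> real \<Rightarrow> (real ^ 3 \<Rightarrow> real) \<Rightarrow> real" where
  "Jfun \<Omega> a b lam p u = a / 4 * (Lnorm \<Omega> 2 (wgrad \<Omega> u)) ^ 4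
     + b / 2 * (Lnorm \<Omega> 2 (wgrad \<Omega> u))\<^sup>2 - lam / 2 * (Lnorm \<Omega> 2 u)\<^sup>2
     - 1 / (p + 1) * Lnorm \<Omega> (p + 1) u powr (p + 1)"

definition Ifun ::
  "(real ^ 3) set \<Rightarrow> real \<Rightarrow> real \<Rightarrow> real \<Rightarrow> real \<Rightarrow> (real ^ 3 \<Rightarrow> real) \<Rightarrow> real" where
  "Ifun \<Omega> a b lam p u = a * (Lnorm \<Omega> 2 (wgrad \<Omega> u)) ^ 4
     + b * (Lnorm \<Omega> 2 (wgrad \<Omega> u))\<^sup>2 - lam * (Lnorm \<Omega> 2 u)\<^sup>2
     - Lnorm \<Omega> (p + 1) u powr (p + 1)"

definition E0 ::
  "(real ^ 3) set \<Rightarrow> real \<Rightarrow> real \<Rightarrow> real \<Rightarrow> real \<Rightarrow>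
    (real ^ 3 \<Rightarrow> real) \<Rightarrow> (real ^ 3 \<Rightarrow> real) \<Rightarrow> real" where
  "E0 \<Omega> a b lam p u0 u1 = 1 / 2 * (Lnorm \<Omega> 2 u1)\<^sup>2 + Jfun \<Omega> a b lam p u0"

definition Nset ::
  "(real ^ 3) set \<Rightarrow> real \<Rightarrow> real \<Rightarrow> real \<Rightarrow> real \<Rightarrow> (real ^ 3 \<Rightarrow> real) set" where
  "Nset \<Omega> a b lam p = {u\<in>H01 \<Omega> - H01_zero \<Omega>. Ifun \<Omega> a b lam p u = 0}"

definition Nplus ::
  "(real ^ 3) set \<Rightarrow> real \<Rightarrow> real \<Rightarrow> real \<Rightarrow> real \<Rightarrow> (real ^ 3 \<Rightarrow> real) set" where
  "Nplus \<Omega> a b lam p = {u\<in>H01 \<Omega>. Ifun \<Omega> a b lam p u > 0} \<union> H01_zero \<Omega>"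

definition Nminus ::
  "(real ^ 3) set \<Rightarrow> real \<Rightarrow> real \<Rightarrow> real \<Rightarrow> real \<Rightarrow> (real ^ 3 \<Rightarrow> real) set" where
  "Nminus \<Omega> a b lam p = {u\<in>H01 \<Omega>. Ifun \<Omega> a b lam p u < 0}"

definition Lminus :: "(real ^ 3) set \<Rightarrow> real \<Rightarrow> real \<Rightarrow> (real ^ 3 \<Rightarrow> real) set" where
  "Lminus \<Omega> b lam = {u\<in>H01 \<Omega>. b * (Lnorm \<Omega> 2 (wgrad \<Omega> u))\<^sup>2 - lam * (Lnorm \<Omega> 2 u)\<^sup>2 < 0}"

definition Sset :: "(real ^ 3) set \<Rightarrow> real \<Rightarrow> (real ^ 3 \<Rightarrow> real) set" where
  "Sset \<Omega> a = {u\<in>H01 \<Omega>. (Lnorm \<Omega> 4 u) ^ 4 - a * (Lnorm \<Omega> 2 (wgrad \<Omega> u)) ^ 4 > 0}"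

text \<open>The infima are taken in the extended reals, so that they are meaningful (\<open>\<infinity>\<close> or
  \<open>- \<infinity>\<close>) without knowing that the set is nonempty or the functional bounded below.\<close>

definition depth :: "(real ^ 3) set \<Rightarrow> real \<Rightarrow> real \<Rightarrow> real \<Rightarrow> real \<Rightarrow> ereal" where
  "depth \<Omega> a b lam p = (INF u\<in>Nset \<Omega> a b lam p. ereal (Jfun \<Omega> a b lam p u))"

definition depth_minus :: "(real ^ 3) set \<Rightarrow> real \<Rightarrow> real \<Rightarrow> real \<Rightarrow> ereal" where
  "depth_minus \<Omega> a b lam =
     (INF u\<in>Nset \<Omega> a b lam 3 \<inter> Lminus \<Omega> b lam. ereal (Jfun \<Omega> a b lam 3 u))"

definition Jsub ::
  "(real ^ 3) set \<Rightarrow> real \<Rightarrow> real \<Rightarrow> real \<Rightarrow> real \<Rightarrow> ereal \<Rightarrow> (real ^ 3 \<Rightarrow> real) set" where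
  "Jsub \<Omega> a b lam p d = {u\<in>H01 \<Omega>. ereal (Jfun \<Omega> a b lam p u) < d}"

definition Wplus ::
  "(real ^ 3) set \<Rightarrow> real \<Rightarrow> real \<Rightarrow> real \<Rightarrow> real \<Rightarrow> (real ^ 3 \<Rightarrow> real) set" where
  "Wplus \<Omega> a b lam p = Jsub \<Omega> a b lam p (depth \<Omega> a b lam p) \<inter> Nplus \<Omega> a b lam p"

definition Wminus ::
  "(real ^ 3) set \<Rightarrow> real \<Rightarrow> real \<Rightarrow> real \<Rightarrow> real \<Rightarrow> (real ^ 3 \<Rightarrow> real) set" where
  "Wminus \<Omega> a b lam p = Jsub \<Omega> a b lam p (depth \<Omega> a b lam p) \<inter> Nminus \<Omega> a b lam p"


section \<open>Evolution spaces and solutions\<close>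

definition time_dom :: "ereal \<Rightarrow> real set" where
  "time_dom T = {t. 0 \<le> t \<and> ereal t < T}"

text \<open>Below, \<open>X\<close> is a linear space of functions with (semi)norm \<open>N\<close>; the limits are those of
  \<open>X\<close>-valued functions on \<open>[0,T)\<close>, one-sided at \<open>0\<close>. Membership of the values in \<open>X\<close> is required
  explicitly, because \<open>N\<close> carries no information outside \<open>X\<close> (a nonintegrable function has
  integral \<open>0\<close> in the library).\<close>

definition has_time_deriv ::
  "(real ^ 3 \<Rightarrow> real) set \<Rightarrow> ((real ^ 3 \<Rightarrow> real) \<Rightarrow> real) \<Rightarrow> ereal \<Rightarrow>
    (real \<Rightarrow> real ^ 3 \<Rightarrow> real) \<Rightarrow> (real \<Rightarrow> real ^ 3 \<Rightarrow> real) \<Rightarrow> bool" where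
  "has_time_deriv X N T u v \<longleftrightarrow> (\<forall>t\<in>time_dom T. u t \<in> X \<and> v t \<in> X \<and>
     ((\<lambda>s. N (\<lambda>x. (u s x - u t x) / (s - t) - v t x)) \<longlongrightarrow> 0) (at t within time_dom T))"

primrec Ck_time ::
  "nat \<Rightarrow> (real ^ 3 \<Rightarrow> real) set \<Rightarrow> ((real ^ 3 \<Rightarrow> real) \<Rightarrow> real) \<Rightarrow> ereal \<Rightarrow>
    (real \<Rightarrow> real ^ 3 \<Rightarrow> real) \<Rightarrow> bool" where
  "Ck_time 0 X N T u \<longleftrightarrow> (\<forall>t\<in>time_dom T. u t \<in> X \<and>
     ((\<lambda>s. N (\<lambda>x. u s x - u t x)) \<longlongrightarrow> 0) (at t within time_dom T))"
| "Ck_time (Suc k) X N T u \<longleftrightarrow> (\<exists>v. has_time_deriv X N T u v \<and> Ck_time k X N T v)"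

definition Hspace :: "(real ^ 3) set \<Rightarrow> ereal \<Rightarrow> (real \<Rightarrow> real ^ 3 \<Rightarrow> real) set" where
  "Hspace \<Omega> T = {u. Ck_time 0 (H01 \<Omega> \<inter> H2 \<Omega>) (H2norm \<Omega>) T u \<and>
                     Ck_time 1 (H01 \<Omega>) (H1norm \<Omega>) T u \<and>
                     Ck_time 2 (L2 \<Omega>) (Lnorm \<Omega> 2) T u}"

definition kirchhoff_solution ::
  "(real ^ 3) set \<Rightarrow> real \<Rightarrow> real \<Rightarrow> real \<Rightarrow> real \<Rightarrow>
    (real ^ 3 \<Rightarrow> real) \<Rightarrow> (real ^ 3 \<Rightarrow> real) \<Rightarrow> ereal \<Rightarrow> (real \<Rightarrow> real ^ 3 \<Rightarrow> real) \<Rightarrow> bool" where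
  "kirchhoff_solution \<Omega> a b lam p u0 u1 T u \<longleftrightarrow> 0 < T \<and> u \<in> Hspace \<Omega> T \<and>
     (\<exists>ut utt. has_time_deriv (L2 \<Omega>) (Lnorm \<Omega> 2) T u ut \<and>
        has_time_deriv (L2 \<Omega>) (Lnorm \<Omega> 2) T ut utt \<and>
        (\<forall>t\<in>time_dom T. t > 0 \<longrightarrow> (AE x in lebesgue_on \<Omega>.
           utt t x - (a * (LINT y|lebesgue_on \<Omega>. (norm (wgrad \<Omega> (u t) y))\<^sup>2) + b) * wlaplacian \<Omega> (u t) x
             = lam * u t x + \<bar>u t x\<bar> powr (p - 1) * u t x)) \<and>
        (AE x in lebesgue_on \<Omega>. u 0 x = u0 x) \<and>
        (AE x in lebesgue_on \<Omega>. ut 0 x = u1 x))"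

definition max_time ::
  "(real ^ 3) set \<Rightarrow> real \<Rightarrow> real \<Rightarrow> real \<Rightarrow> real \<Rightarrow>
    (real ^ 3 \<Rightarrow> real) \<Rightarrow> (real ^ 3 \<Rightarrow> real) \<Rightarrow> ereal" where
  "max_time \<Omega> a b lam p u0 u1 = Sup {T. \<exists>u. kirchhoff_solution \<Omega> a b lam p u0 u1 T u}"

end

(* The energy E(t) = (1/2) |u_t|^2 + J(u(t)) is conserved, so J(u(t)) <= E(0) < d for all t. Hence u(t)
   never meets the Nehari set, on which J >= d, and it remains to see that {t. I(u(t)) < 0} is open and
   closed in [0, Tmax). It is open since t |-> I(u(t)) is continuous. In Cases A and C the Sobolev and
   Rayleigh inequalities keep {I < 0} away from 0, so a limit of points with I < 0 is nonzero and
   cannot satisfy I = 0. In Case B a multiple of the eigenfunction shows that d_3^- < 0; if I(v) = 0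
   and J(v) < d_3^- < 0, then 4 J(v) = b |grad v|^2 - lambda |v|^2 < 0 places v in L^-, where
   J(v) >= d_3^-.

   The Sobolev inequality comes from the Loomis-Whitney argument. The Rayleigh inequality is obtained
   without compactness, from the positive eigenfunction psi alone, by testing its equation with
   phi^2 / psi (Jacobi's method). *)

theory Submission
  imports Defs
begin

section \<open>Smooth functions\<close>

text \<open>That \<open>lam < b * lam1\<close> is strict for p = 3, against
  \<open>lam \<le> b * lam1\<close> for p > 3, is a matter of homogeneity. Let k be the integral of
  |grad f|^2. The Sobolev inequality bounds the nonlinear term of I by a multiple of k^((p+1)/2).
  For p = 3 this is k^2, the order of the Kirchhoff term a k^2, and a linear reserve (b - \<kappa>)
  k, which the Rayleigh inequality supplies in the strict case, has to beat it near 0. For p > 3 it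
  is of higher order than a k^2, which then suffices. In Case B the barrier holds at 0 itself,
  because I(0) = J(0) = 0 \<ge> d_3^-, so {I < 0} may come close to 0.

  Conservation of energy is delicate because u_t comes in two guises: as a limit in L2, used by the
  equation and the kinetic term, and as a limit in H1, used by the gradient and power terms, which
  can be paired with the Laplacian without boundary terms. The two agree almost everywhere. The
  power term is controlled by integrals of sixth powers as long as p \<le> 5.\<close>

primrec Dk :: "nat \<Rightarrow> (real \<Rightarrow> real) \<Rightarrow> bool" where
  "Dk 0 h \<longleftrightarrow> continuous_on UNIV h"
| "Dk (Suc k) h \<longleftrightarrow> (\<exists>h'. (\<forall>x. (h has_real_derivative h' x) (at x)) \<and> Dk k h')"

lemma Dk_SucI:
  assumes "\<And>x. (h has_real_derivative h' x) (at x)" "Dk k h'"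
  shows "Dk (Suc k) h"
  using assms by auto

lemma Dk_SucD: "Dk (Suc k) h \<Longrightarrow> Dk k h"
proof (induction k arbitrary: h)
  case 0
  then show ?case by (auto intro!: continuous_at_imp_continuous_on intro: DERIV_isCont)
next
  case (Suc k)
  from Suc.prems obtain h' where h': "\<And>x. (h has_real_derivative h' x) (at x)" "Dk (Suc k) h'"
    by (subst (asm) Dk.simps(2)) blast
  from Suc.IH[OF h'(2)] h'(1) show ?case
    by (intro Dk_SucI) auto
qed

lemma Dk_const [simp]: "Dk k (\<lambda>x. c)"
proof (induction k arbitrary: c)
  case (Suc k)
  show ?case by (rule Dk_SucI[where h' = "\<lambda>_. 0"]) (auto intro: Suc)
qed auto

lemma Dk_add: "Dk k f \<Longrightarrow> Dk k g \<Longrightarrow> Dk k (\<lambda>x. f x + g x)"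
proof (induction k arbitrary: f g)
  case 0
  then show ?case by (auto intro: continuous_intros)
next
  case (Suc k)
  then obtain f' g' where "\<And>x. (f has_real_derivative f' x) (at x)" "Dk k f'"
    "\<And>x. (g has_real_derivative g' x) (at x)" "Dk k g'" by auto
  then show ?case
    by (intro Dk_SucI[where h' = "\<lambda>x. f' x + g' x"]) (auto intro!: derivative_intros Suc.IH)
qed

lemma Dk_mult: "Dk k f \<Longrightarrow> Dk k g \<Longrightarrow> Dk k (\<lambda>x. f x * g x)"
proof (induction k arbitrary: f g)
  case 0
  then show ?case by (auto intro: continuous_intros)
next
  case (Suc k)
  then obtain f' g' where *: "\<And>x. (f has_real_derivative f' x) (at x)" "Dk k f'"
    "\<And>x. (g has_real_derivative g' x) (at x)" "Dk k g'" by auto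
  have "Dk k f" "Dk k g" using Suc.prems by (blast intro: Dk_SucD)+
  with * show ?case
    by (intro Dk_SucI[where h' = "\<lambda>x. f' x * g x + g' x * f x"])
      (auto intro!: derivative_intros Suc.IH Dk_add)
qed

text \<open>The extra power m makes the family closed under differentiation, up to linear
  combinations. Smoothness of the classical flat function exp(-1/x), the case m = 0, then follows by
  induction on k for all m at once.\<close>

definition flat_exp :: "nat \<Rightarrow> real \<Rightarrow> real" where
  "flat_exp m x = (if x \<le> 0 then 0 else (1 / x) ^ m * exp (- (1 / x)))"

lemma flat_exp_tendsto_0: "(flat_exp m \<longlongrightarrow> 0) (at_right 0)"
proof -
  have "((\<lambda>x::real. (1 / x) ^ m / exp (1 / x)) \<longlongrightarrow> 0) (at_right 0)"
    by (rule filterlim_compose[OF tendsto_power_div_exp_0])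
      (simp add: filterlim_inverse_at_top_right flip: inverse_eq_divide)
  then show ?thesis
    by (rule Lim_transform_eventually)
      (auto simp: flat_exp_def exp_minus field_simps eventually_at intro!: exI[of _ 1])
qed

lemma flat_exp_deriv:
  "(flat_exp m has_real_derivative (flat_exp (m + 2) x - real m * flat_exp (m + 1) x)) (at x)"
proof -
  consider "x < 0" | "x = 0" | "x > 0" by linarith
  then show ?thesis
  proof cases
    case 1
    have "((\<lambda>x. 0) has_real_derivative 0) (at x)" by simp
    then have "(flat_exp m has_real_derivative 0) (at x)"
      by (rule has_field_derivative_transform_within_open[of _ _ _ "{..<0}"])
        (use 1 in \<open>auto simp: flat_exp_def\<close>)
    with 1 show ?thesis by (simp add: flat_exp_def)
  next
    case 2
    have "((\<lambda>h. (flat_exp m (0 + h) - flat_exp m 0) / h) \<longlongrightarrow> 0) (at 0)"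
      unfolding filterlim_split_at_real[of _ _ 0]
    proof (rule filterlim_split_at)
      show "((\<lambda>h. (flat_exp m (0 + h) - flat_exp m 0) / h) \<longlongrightarrow> 0) (at_left 0)"
        by (rule tendsto_eventually)
          (auto simp: flat_exp_def eventually_at intro!: exI[of _ 1])
      show "((\<lambda>h. (flat_exp m (0 + h) - flat_exp m 0) / h) \<longlongrightarrow> 0) (at_right 0)"
        \<comment> \<open>For h > 0 the difference quotient at 0 is
          \<open>flat_exp (Suc m) h\<close>, the next member of the family.\<close>
        by (rule Lim_transform_eventually[OF flat_exp_tendsto_0[of "Suc m"]])
          (auto simp: flat_exp_def eventually_at divide_simps intro!: exI[of _ 1])
    qed
    then have "(flat_exp m has_real_derivative 0) (at 0)"
      by (simp add: DERIV_def)
    with 2 show ?thesis by (simp add: flat_exp_def)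
  next
    case 3
    have "((\<lambda>x. (1 / x) ^ m * exp (- (1 / x))) has_real_derivative
        (flat_exp (m + 2) x - real m * flat_exp (m + 1) x)) (at x)"
      using 3
      by (auto intro!: derivative_eq_intros simp: flat_exp_def)
        (cases m; simp add: field_simps power2_eq_square)
    then show ?thesis
      by (rule has_field_derivative_transform_within_open[of _ _ _ "{0<..}"])
        (use 3 in \<open>auto simp: flat_exp_def\<close>)
  qed
qed

lemma Dk_flat_exp: "Dk k (flat_exp m)"
proof (induction k arbitrary: m)
  case 0
  then show ?case
    by (auto intro!: DERIV_continuous[OF flat_exp_deriv] continuous_at_imp_continuous_on)
next
  case (Suc k)
  show ?case
    using Dk_add[OF Suc[of "m + 2"] Dk_mult[OF Dk_const[of k "- real m"] Suc[of "m + 1"]]]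
    by (intro Dk_SucI[OF flat_exp_deriv]) simp
qed

section \<open>Partial derivatives and C^k functions of three variables\<close>

lemma pd_eqI: "(f has_derivative f') (at x) \<Longrightarrow> pd i f x = f' (axis i 1)"
  by (simp add: pd_def frechet_derivative_at[symmetric])

lemma pd_const [simp]: "pd i (\<lambda>x. c) = (\<lambda>x. 0)"
  by (rule ext, rule pd_eqI[THEN trans], rule has_derivative_const, simp)

lemma pd_add:
  assumes "f differentiable (at x)" "g differentiable (at x)"
  shows "pd i (\<lambda>x. f x + g x) x = pd i f x + pd i g x"
proof -
  from assms obtain f' g' where *: "(f has_derivative f') (at x)" "(g has_derivative g') (at x)"
    by (auto simp: differentiable_def)
  from pd_eqI[OF has_derivative_add[OF *]] * show ?thesis by (simp add: pd_eqI)
qed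

lemma pd_mult:
  assumes "f differentiable (at x)" "g differentiable (at x)"
  shows "pd i (\<lambda>x. f x * g x) x = pd i f x * g x + f x * pd i g x"
proof -
  from assms obtain f' g' where *: "(f has_derivative f') (at x)" "(g has_derivative g') (at x)"
    by (auto simp: differentiable_def)
  from pd_eqI[OF has_derivative_mult[OF *]] * show ?thesis by (simp add: pd_eqI)
qed

lemma pd_compose:
  assumes "f differentiable (at x)" "(h has_real_derivative h') (at (f x))"
  shows "pd i (\<lambda>x. h (f x)) x = h' * pd i f x" "(\<lambda>x. h (f x)) differentiable (at x)"
proof -
  from assms(1) obtain f' where *: "(f has_derivative f') (at x)"
    by (auto simp: differentiable_def)
  have **: "((\<lambda>x. h (f x)) has_derivative (\<lambda>y. h' * f' y)) (at x)"
    using has_derivative_compose[OF * assms(2)[unfolded has_field_derivative_def]]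
    by simp
  from pd_eqI[OF **] * show "pd i (\<lambda>x. h (f x)) x = h' * pd i f x" by (simp add: pd_eqI)
  from ** show "(\<lambda>x. h (f x)) differentiable (at x)" by (auto simp: differentiable_def)
qed

lemma pd_coord: "pd i (\<lambda>x. x $ j) = (\<lambda>x. if i = j then 1 else 0)"
proof
  fix x :: "real ^ 3"
  have "((\<lambda>x::real^3. x $ j) has_derivative (\<lambda>y. y $ j)) (at x)"
    by (rule bounded_linear_imp_has_derivative) (rule bounded_linear_vec_nth)
  from pd_eqI[OF this, of i] show "pd i (\<lambda>x. x $ j) x = (if i = j then 1 else 0)"
    by (simp add: axis_def)
qed

lemma Ck_on_SucD: "Ck_on (Suc k) U f \<Longrightarrow> Ck_on k U f"
proof (induction k arbitrary: f)
  case 0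
  then show ?case
    by (auto intro!: continuous_at_imp_continuous_on differentiable_imp_continuous_within)
next
  case (Suc k)
  from Suc.prems have "\<forall>x\<in>U. f differentiable (at x)" "\<And>i. Ck_on (Suc k) U (pd i f)"
    by (auto simp del: Ck_on.simps(2) simp: Ck_on.simps(2)[of "Suc k"])
  with Suc.IH show ?case by auto
qed

lemma Ck_on_const [simp]: "Ck_on k U (\<lambda>x. c)"
  by (induction k arbitrary: c) auto

lemma Ck_on_coord: "Ck_on k U (\<lambda>x. x $ j)"
proof (cases k)
  case 0
  then show ?thesis by (auto intro: continuous_intros)
next
  case (Suc l)
  have "(\<lambda>x::real^3. x $ j) differentiable (at x)" for x
    by (rule bounded_linear_imp_differentiable) (rule bounded_linear_vec_nth)
  then show ?thesis
    by (auto simp: Suc pd_coord)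
qed

lemma Ck_on_add: "Ck_on k UNIV f \<Longrightarrow> Ck_on k UNIV g \<Longrightarrow> Ck_on k UNIV (\<lambda>x. f x + g x)"
proof (induction k arbitrary: f g)
  case 0
  then show ?case by (auto intro: continuous_intros)
next
  case (Suc k)
  then have d: "\<And>x. f differentiable (at x)" "\<And>x. g differentiable (at x)"
    and *: "\<And>i. Ck_on k UNIV (pd i f)" "\<And>i. Ck_on k UNIV (pd i g)" by auto
  have "pd i (\<lambda>x. f x + g x) = (\<lambda>x. pd i f x + pd i g x)" for i
    by (rule ext, rule pd_add[OF d])
  with d * show ?case by (auto intro!: Suc.IH)
qed

lemma Ck_on_mult: "Ck_on k UNIV f \<Longrightarrow> Ck_on k UNIV g \<Longrightarrow> Ck_on k UNIV (\<lambda>x. f x * g x)"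
proof (induction k arbitrary: f g)
  case 0
  then show ?case by (auto intro: continuous_intros)
next
  case (Suc k)
  then have d: "\<And>x. f differentiable (at x)" "\<And>x. g differentiable (at x)"
    and *: "\<And>i. Ck_on k UNIV (pd i f)" "\<And>i. Ck_on k UNIV (pd i g)" by auto
  have **: "Ck_on k UNIV f" "Ck_on k UNIV g"
    using Suc.prems by (blast intro: Ck_on_SucD)+
  have "pd i (\<lambda>x. f x * g x) = (\<lambda>x. pd i f x * g x + f x * pd i g x)" for i
    by (rule ext, rule pd_mult[OF d])
  with d * ** show ?case by (auto intro!: Suc.IH Ck_on_add)
qed

lemma Ck_on_compose: "Dk k h \<Longrightarrow> Ck_on k UNIV f \<Longrightarrow> Ck_on k UNIV (\<lambda>x. h (f x))"
proof (induction k arbitrary: h f)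
  case 0
  then show ?case by (auto intro: continuous_on_compose2)
next
  case (Suc k)
  then have d: "\<And>x. f differentiable (at x)" and *: "\<And>i. Ck_on k UNIV (pd i f)" by auto
  from Suc.prems obtain h' where h': "\<And>x. (h has_real_derivative h' x) (at x)" "Dk k h'" by auto
  have **: "Ck_on k UNIV f"
    using Suc.prems by (blast intro: Ck_on_SucD)+
  have "pd i (\<lambda>x. h (f x)) = (\<lambda>x. h' (f x) * pd i f x)" for i
    by (rule ext, rule pd_compose(1)[OF d h'(1)])
  moreover have "Ck_on k UNIV (\<lambda>x. h' (f x) * pd i f x)" for i
    by (rule Ck_on_mult[OF Suc.IH[OF h'(2) **] *])
  ultimately show ?case using pd_compose(2)[OF d h'(1)] by simp
qed

lemma Cinf_on_const: "Cinf_on U (\<lambda>x. c)"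
  by (simp add: Cinf_on_def)

lemma Cinf_on_add: "Cinf_on UNIV f \<Longrightarrow> Cinf_on UNIV g \<Longrightarrow> Cinf_on UNIV (\<lambda>x. f x + g x)"
  by (simp add: Cinf_on_def Ck_on_add)

lemma Cinf_on_mult: "Cinf_on UNIV f \<Longrightarrow> Cinf_on UNIV g \<Longrightarrow> Cinf_on UNIV (\<lambda>x. f x * g x)"
  by (simp add: Cinf_on_def Ck_on_mult)

lemma Cinf_on_compose: "(\<And>k. Dk k h) \<Longrightarrow> Cinf_on UNIV f \<Longrightarrow> Cinf_on UNIV (\<lambda>x. h (f x))"
  by (simp add: Cinf_on_def Ck_on_compose)

lemma Cinf_on_prod:
  "finite I \<Longrightarrow> (\<And>i. i \<in> I \<Longrightarrow> Cinf_on UNIV (f i)) \<Longrightarrow> Cinf_on UNIV (\<lambda>x. \<Prod>i\<in>I. f i x)"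
  by (induction I rule: finite_induct) (auto simp: Cinf_on_const intro: Cinf_on_mult)

lemma Cinf_on_pd: "Cinf_on U f \<Longrightarrow> Cinf_on U (pd i f)"
  unfolding Cinf_on_def by (metis Ck_on.simps(2))

lemma Cinf_on_continuous: "Cinf_on U f \<Longrightarrow> continuous_on U f"
  unfolding Cinf_on_def by (metis Ck_on.simps(1))

lemma Cinf_on_differentiable: "Cinf_on U f \<Longrightarrow> x \<in> U \<Longrightarrow> f differentiable (at x)"
  unfolding Cinf_on_def by (metis Ck_on.simps(2))

section \<open>Smooth approximations of indicators of boxes\<close>

text \<open>Each coordinate contributes one flat factor per face of the box. For n > 0 the product
  vanishes off the open box, and as n grows every factor tends to 1 inside it, so the bumps converge
  boundedly to the indicator of \<open>box a b\<close>.\<close>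

definition box_bump :: "real \<Rightarrow> real ^ 3 \<Rightarrow> real ^ 3 \<Rightarrow> real ^ 3 \<Rightarrow> real" where
  "box_bump n a b x = (\<Prod>i\<in>UNIV. flat_exp 0 (n * (x $ i - a $ i)) * flat_exp 0 (n * (b $ i - x $ i)))"

lemma flat_exp_0_bounds: "0 \<le> flat_exp 0 x" "flat_exp 0 x \<le> 1"
  by (auto simp: flat_exp_def)

lemma Cinf_box_bump: "Cinf_on UNIV (box_bump n a b)"
proof -
  have 1: "Cinf_on UNIV (\<lambda>x. x $ i)" for i
    by (simp add: Cinf_on_def Ck_on_coord)
  have "Cinf_on UNIV (\<lambda>x. n * x $ i + (- n * a $ i))" "Cinf_on UNIV (\<lambda>x. (- n) * x $ i + (n * b $ i))" for i
    by (intro Cinf_on_add Cinf_on_mult Cinf_on_const 1)+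
  then have 2: "Cinf_on UNIV (\<lambda>x. n * (x $ i - a $ i))" "Cinf_on UNIV (\<lambda>x. n * (b $ i - x $ i))" for i
    by (simp_all add: algebra_simps)
  show ?thesis
    unfolding box_bump_def
    by (intro Cinf_on_prod Cinf_on_mult Cinf_on_compose[OF Dk_flat_exp] 2) auto
qed

lemma box_bump_bounds: "0 \<le> box_bump n a b x" "box_bump n a b x \<le> 1"
  unfolding box_bump_def
  by (auto intro!: prod_nonneg prod_le_1 mult_le_one simp: flat_exp_0_bounds)

lemma box_bump_outside:
  assumes "n > 0" "x \<notin> box a b" shows "box_bump n a b x = 0"
proof -
  from assms(2) obtain i where "\<not> (a $ i < x $ i \<and> x $ i < b $ i)"
    by (auto simp: mem_box_cart)
  then have "n * (x $ i - a $ i) \<le> 0 \<or> n * (b $ i - x $ i) \<le> 0"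
    using assms(1) by (auto simp: mult_le_0_iff)
  then have "flat_exp 0 (n * (x $ i - a $ i)) * flat_exp 0 (n * (b $ i - x $ i)) = 0"
    by (auto simp: flat_exp_def)
  then show ?thesis
    unfolding box_bump_def by (intro prod_zero) auto
qed

lemma flat_exp_lim:
  assumes "y > 0" shows "(\<lambda>n. flat_exp 0 (real (Suc n) * y)) \<longlonglongrightarrow> 1"
proof -
  have "(\<lambda>n. exp (- (1 / y * inverse (real (Suc n))))) \<longlonglongrightarrow> exp (- (1 / y * 0))"
    by (intro tendsto_intros LIMSEQ_inverse_real_of_nat)
  then show ?thesis
    using assms by (simp add: flat_exp_def mult_le_0_iff inverse_eq_divide mult.commute)
qed

lemma box_bump_lim: "(\<lambda>n. box_bump (real (Suc n)) a b x) \<longlonglongrightarrow> indicator (box a b) x"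
proof (cases "x \<in> box a b")
  case True
  then have "(\<lambda>n. box_bump (real (Suc n)) a b x) \<longlonglongrightarrow> (\<Prod>i\<in>(UNIV::3 set). 1 * 1)"
    unfolding box_bump_def
    by (intro tendsto_prod tendsto_mult flat_exp_lim) (auto simp: mem_box_cart)
  with True show ?thesis by simp
next
  case False
  then show ?thesis by (simp add: box_bump_outside)
qed

lemma test_functions_box_bump:
  assumes "cbox a b \<subseteq> \<Omega>" "n > 0" shows "box_bump n a b \<in> test_functions \<Omega>"
proof -
  have "box_bump n a b x = 0" if "x \<notin> cbox a b" for x
    using box_bump_outside[OF assms(2)] that box_subset_cbox[of a b] by blast
  then show ?thesis
    unfolding test_functions_def using assms(1) compact_cbox[of a b] Cinf_box_bump[of n a b] by blast
qed

section \<open>Weak derivatives\<close>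

text \<open>The class C_c(\<Omega>). It contains the test functions and their derivatives and,
  unlike them, is preserved by continuous maps fixing 0, such as powers. Its members can be
  integrated against any locally integrable function.\<close>

definition cc_fun :: "(real ^ 3) set \<Rightarrow> (real ^ 3 \<Rightarrow> real) \<Rightarrow> bool" where
  "cc_fun \<Omega> \<phi> \<longleftrightarrow> continuous_on UNIV \<phi> \<and> (\<exists>K. compact K \<and> K \<subseteq> \<Omega> \<and> (\<forall>x. x \<notin> K \<longrightarrow> \<phi> x = 0))"

lemma pd_eq_0_outside:
  assumes "closed K" "\<And>x. x \<notin> K \<Longrightarrow> f x = 0" "x \<notin> K"
  shows "pd i f x = 0"
proof -
  have "((\<lambda>x. 0) has_derivative (\<lambda>x. 0)) (at x)" by simp
  then have "(f has_derivative (\<lambda>x. 0)) (at x)"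
    by (rule has_derivative_transform_within_open[of _ _ _ _ "- K"]) (use assms in \<open>auto simp: open_Compl\<close>)
  then show ?thesis by (rule pd_eqI)
qed

lemma test_functions_cc: "\<phi> \<in> test_functions \<Omega> \<Longrightarrow> cc_fun \<Omega> \<phi>"
  unfolding test_functions_def cc_fun_def using Cinf_on_continuous by auto

lemma test_functions_pd:
  assumes "\<phi> \<in> test_functions \<Omega>" shows "pd i \<phi> \<in> test_functions \<Omega>"
proof -
  from assms obtain K where K: "compact K" "K \<subseteq> \<Omega>" "\<And>x. x \<notin> K \<Longrightarrow> \<phi> x = 0" and c: "Cinf_on UNIV \<phi>"
    by (auto simp: test_functions_def)
  then have "pd i \<phi> x = 0" if "x \<notin> K" for x
    using pd_eq_0_outside[of K \<phi> x i] that compact_imp_closed by blast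
  with K c show ?thesis
    unfolding test_functions_def by (auto intro: Cinf_on_pd)
qed

lemma test_functions_add:
  assumes "\<phi> \<in> test_functions \<Omega>" "\<psi> \<in> test_functions \<Omega>"
  shows "(\<lambda>x. \<phi> x + \<psi> x) \<in> test_functions \<Omega>"
proof -
  from assms obtain K L where "compact K" "K \<subseteq> \<Omega>" "\<And>x. x \<notin> K \<Longrightarrow> \<phi> x = 0"
    "compact L" "L \<subseteq> \<Omega>" "\<And>x. x \<notin> L \<Longrightarrow> \<psi> x = 0"
    by (auto simp: test_functions_def)
  then have "compact (K \<union> L) \<and> K \<union> L \<subseteq> \<Omega> \<and> (\<forall>x. x \<notin> K \<union> L \<longrightarrow> \<phi> x + \<psi> x = 0)" by auto
  with assms show ?thesis
    unfolding test_functions_def by (auto intro: Cinf_on_add)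
qed

lemma test_functions_mult:
  assumes "\<phi> \<in> test_functions \<Omega>" "Cinf_on UNIV \<psi>"
  shows "(\<lambda>x. \<phi> x * \<psi> x) \<in> test_functions \<Omega>"
proof -
  from assms obtain K where "compact K" "K \<subseteq> \<Omega>" "\<And>x. x \<notin> K \<Longrightarrow> \<phi> x = 0"
    by (auto simp: test_functions_def)
  then have "compact K \<and> K \<subseteq> \<Omega> \<and> (\<forall>x. x \<notin> K \<longrightarrow> \<phi> x * \<psi> x = 0)" by auto
  with assms show ?thesis
    unfolding test_functions_def by (auto intro: Cinf_on_mult)
qed

lemma test_functions_Cinf: "\<phi> \<in> test_functions \<Omega> \<Longrightarrow> Cinf_on UNIV \<phi>"
  by (simp add: test_functions_def)

lemma cc_fun_bounded:
  assumes "cc_fun \<Omega> \<phi>" obtains C where "C > 0" "\<And>x. \<bar>\<phi> x\<bar> \<le> C"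
proof -
  from assms obtain K where K: "compact K" "\<And>x. x \<notin> K \<Longrightarrow> \<phi> x = 0" and "continuous_on UNIV \<phi>"
    by (auto simp: cc_fun_def)
  then have "compact (\<phi> ` K)" by (meson compact_continuous_image continuous_on_subset subset_UNIV)
  then obtain C where C: "\<And>x. x \<in> K \<Longrightarrow> norm (\<phi> x) \<le> C"
    by (metis bounded_iff compact_imp_bounded imageI)
  have "\<bar>\<phi> x\<bar> \<le> max 1 C" for x
    using C[of x] K(2)[of x] by (cases "x \<in> K") auto
  then show ?thesis by (intro that[of "max 1 C"]) auto
qed

lemma cc_fun_measurable [measurable]: "cc_fun \<Omega> \<phi> \<Longrightarrow> \<phi> \<in> borel_measurable borel"
  by (auto simp: cc_fun_def intro: borel_measurable_continuous_onI)

lemma measurable_lebesgue_on_borel: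
  "\<phi> \<in> borel_measurable borel \<Longrightarrow> \<phi> \<in> borel_measurable (lebesgue_on S)"
  by (simp add: measurable_completion measurable_restrict_space1)

lemma loc_integrable_mult_cc:
  assumes "open \<Omega>" "loc_integrable \<Omega> g" "cc_fun \<Omega> \<phi>"
  shows "integrable (lebesgue_on \<Omega>) (\<lambda>x. g x * \<phi> x)"
proof -
  from assms(3) obtain K where K: "compact K" "K \<subseteq> \<Omega>" "\<And>x. x \<notin> K \<Longrightarrow> \<phi> x = 0"
    by (auto simp: cc_fun_def)
  obtain C where C: "\<And>x. \<bar>\<phi> x\<bar> \<le> C" using cc_fun_bounded[OF assms(3)] by metis
  have g: "integrable (lebesgue_on K) g" using assms(2) K by (auto simp: loc_integrable_def)
  have "integrable (lebesgue_on K) (\<lambda>x. g x * \<phi> x)"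
  proof (rule Bochner_Integration.integrable_bound[of _ "\<lambda>x. C * g x"])
    show "integrable (lebesgue_on K) (\<lambda>x. C * g x)" using g by simp
    have "\<phi> \<in> borel_measurable (lebesgue_on K)"
      by (intro measurable_lebesgue_on_borel cc_fun_measurable[OF assms(3)])
    then show "(\<lambda>x. g x * \<phi> x) \<in> borel_measurable (lebesgue_on K)"
      using g by (intro borel_measurable_times) auto
    show "AE x in lebesgue_on K. norm (g x * \<phi> x) \<le> norm (C * g x)"
    proof (rule AE_I2)
      fix x
      have "\<bar>\<phi> x\<bar> * \<bar>g x\<bar> \<le> C * \<bar>g x\<bar>" by (intro mult_right_mono C) auto
      moreover have "C \<ge> 0" using C[of x] by linarith
      ultimately show "norm (g x * \<phi> x) \<le> norm (C * g x)" by (simp add: abs_mult mult.commute)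
    qed
  qed
  then have "integrable lebesgue (\<lambda>x. if x \<in> K then g x * \<phi> x else 0)"
    using K(1) by (subst Lebesgue_Measure.integrable_restrict_UNIV) (auto simp: lmeasurable_compact fmeasurableD)
  also have "(\<lambda>x. if x \<in> K then g x * \<phi> x else 0) = (\<lambda>x. if x \<in> \<Omega> then g x * \<phi> x else 0)"
    using K by (auto simp: fun_eq_iff)
  finally show ?thesis
    using assms(1) by (subst (asm) Lebesgue_Measure.integrable_restrict_UNIV) auto
qed

text \<open>The bridge from the domain to \<open>lborel\<close> on the whole space, where
  translation invariance and Fubini's theorem are applied.\<close>

lemma lebesgue_on_integral_support:
  assumes "open \<Omega>" "\<And>x. x \<notin> \<Omega> \<Longrightarrow> f x = 0" "f \<in> borel_measurable borel"
  shows "(LINT x|lebesgue_on \<Omega>. f x) = (LINT x|lborel. (f x :: real))"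
proof -
  have "(LINT x|lebesgue_on \<Omega>. f x) = (LINT x|lebesgue. (if x \<in> \<Omega> then f x else 0))"
    using assms(1) by (subst Lebesgue_Measure.integral_restrict_UNIV) auto
  also have "(\<lambda>x. if x \<in> \<Omega> then f x else 0) = f" using assms(2) by auto
  finally show ?thesis using assms(3) by (simp add: integral_completion)
qed

section \<open>The fundamental lemma of the calculus of variations\<close>

text \<open>Open boxes are an intersection-stable generator of the Borel sets, so the vanishing of
  the integral spreads from boxes to all Borel sets. The total integral enters in the passage to
  complements.\<close>

lemma AE_zero_if_boxes_zero:
  fixes h :: "real ^ 3 \<Rightarrow> real"
  assumes h: "integrable lborel h"
    and 0: "\<And>a b. (LINT x|lborel. indicator (box a b) x * h x) = 0"
    and 1: "(LINT x|lborel. h x) = 0"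
  shows "AE x in lborel. h x = 0"
proof (rule sigma_finite_measure.density_zero[OF sigma_finite_lborel h])
  fix A :: "(real ^ 3) set" assume "A \<in> sets lborel"
  then have A: "A \<in> sigma_sets UNIV (range (\<lambda>(a, b). box a b))"
    by (simp add: borel_eq_box)
  have int: "set_integrable lborel B h" if "B \<in> sets borel" for B
    using integrable_mult_indicator[of B lborel h] h that by (simp add: set_integrable_def)
  have bs: "B \<in> sets borel" if "B \<in> sigma_sets UNIV (range (\<lambda>(a, b). box a b))" for B :: "(real ^ 3) set"
    using that by (simp add: borel_eq_box)
  have stab: "Int_stable (range (\<lambda>(a, b). box a b :: (real ^ 3) set))"
  proof (rule Int_stableI)
    fix A B :: "(real ^ 3) set"
    assume "A \<in> range (\<lambda>(a, b). box a b)" "B \<in> range (\<lambda>(a, b). box a b)"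
    then obtain a b c d where "A = box a b" "B = box c d" by auto
    moreover obtain e f where "box a b \<inter> box c d = box e f"
      using box_Int_box[of a b c d] by blast
    ultimately show "A \<inter> B \<in> range (\<lambda>(a, b). box a b)"
      by (auto intro: range_eqI[of _ _ "(e, f)"])
  qed
  show "set_lebesgue_integral lborel A h = 0"
    using stab Pow_UNIV[THEN equalityD2, THEN subset_trans[OF subset_UNIV]] A
  proof (induction rule: sigma_sets_induct_disjoint)
    case (basic A)
    then show ?case using 0 by (auto simp: set_lebesgue_integral_def)
  next
    case empty
    then show ?case by (simp add: set_lebesgue_integral_def)
  next
    case (compl A)
    have "set_lebesgue_integral lborel (UNIV - A) h
      = (LINT x|lborel. h x - indicator A x * h x)"
      unfolding set_lebesgue_integral_def
      by (intro Bochner_Integration.integral_cong) (auto simp: indicator_def)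
    also have "\<dots> = 0"
      using compl(2) h 1 int[OF bs[OF compl(1)]]
      by (subst Bochner_Integration.integral_diff) (auto simp: set_lebesgue_integral_def set_integrable_def)
    finally show ?case .
  next
    case (union A)
    have A: "A i \<in> sets borel" for i using union(2) bs by blast
    have "set_lebesgue_integral lborel (\<Union>i. A i) h = (\<Sum>i. set_lebesgue_integral lborel (A i) h)"
      by (rule lebesgue_integral_countable_add)
        (use A union(1) int in \<open>auto simp: disjoint_family_on_def\<close>)
    then show ?case using union(3) by simp
  qed
qed

text \<open>Cut off outside a closed box in \<Omega>, h is integrable and has a Borel version
  \<open>k\<close>. The integral of \<open>k\<close> over a smaller open box is a limit of integrals
  against bumps, which vanish by assumption. An arbitrary box is first intersected with the given
  one.\<close>

lemma fundamental_lemma_box: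
  assumes "open \<Omega>" and h: "loc_integrable \<Omega> h"
    and 0: "\<And>\<phi>. \<phi> \<in> test_functions \<Omega> \<Longrightarrow> (LINT x|lebesgue_on \<Omega>. h x * \<phi> x) = 0"
    and cd: "cbox c d \<subseteq> \<Omega>"
  shows "AE x in lebesgue. x \<in> cbox c d \<longrightarrow> h x = 0"
proof -
  let ?h = "\<lambda>x. if x \<in> cbox c d then h x else 0"
  have I: "integrable lebesgue ?h"
    by (subst Lebesgue_Measure.integrable_restrict_UNIV) (use h cd in \<open>auto simp: loc_integrable_def\<close>)
  then obtain k where k: "k \<in> borel_measurable borel" "AE x in lborel. ?h x = k x"
    using completion_ex_borel_measurable_real[of ?h lborel] by auto
  have k': "AE x in lebesgue. ?h x = k x" using k(2) by (rule AE_completion)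
  have kI: "integrable lborel k"
    using I k(1) k' integrable_cong_AE[of ?h lebesgue k]
    by (simp add: integrable_completion measurable_completion borel_measurable_integrable)
  \<comment> \<open>The faces are null sets, so intersecting with the open box
    \<open>box c d\<close> instead of the closed one loses nothing.\<close>
  have bd: "AE x in lborel. x \<in> cbox c d \<longrightarrow> x \<in> box c d"
    using AE_not_in[OF null_sets_cbox_Diff_box[of c d]] by eventually_elim auto
  have main: "(LINT x|lborel. indicator (box a b) x * k x) = 0" if sub: "box a b \<subseteq> box c d" for a b
  proof (cases "box a b = {}")
    case False
    \<comment> \<open>For a degenerate box the inclusion of open boxes says nothing about
      \<open>cbox a b\<close>; this is why the empty case is split off.\<close>
    then have "cbox a b = closure (box a b)" by (simp add: closure_box)
    also have "\<dots> \<subseteq> closure (cbox c d)"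
      using sub box_subset_cbox[of c d] by (intro closure_mono) auto
    finally have sub': "cbox a b \<subseteq> cbox c d" by simp
    have z: "(LINT x|lborel. box_bump (real (Suc n)) a b x * k x) = 0" for n
    proof -
      let ?p = "box_bump (real (Suc n)) a b"
      have t: "?p \<in> test_functions \<Omega>" using sub' cd by (intro test_functions_box_bump) auto
      have pm: "?p \<in> borel_measurable borel" using t test_functions_cc cc_fun_measurable by blast
      have "0 = (LINT x|lebesgue_on \<Omega>. h x * ?p x)" using 0[OF t] by simp
      also have "\<dots> = (LINT x|lebesgue. (if x \<in> \<Omega> then h x * ?p x else 0))"
        using assms(1) by (subst Lebesgue_Measure.integral_restrict_UNIV) auto
      also have "\<dots> = (LINT x|lebesgue. ?p x * ?h x)"
        using box_bump_outside[of "real (Suc n)" _ a b] sub' cd box_subset_cbox[of a b]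
        by (intro Bochner_Integration.integral_cong) (auto simp: subset_iff)
      also have "\<dots> = (LINT x|lebesgue. ?p x * k x)"
        using I k pm k'
        by (intro integral_cong_AE borel_measurable_times)
          (auto simp: measurable_completion elim: eventually_mono)
      also have "\<dots> = (LINT x|lborel. ?p x * k x)"
        using k pm by (intro integral_completion) simp
      finally show ?thesis by simp
    qed
    have "(\<lambda>n. LINT x|lborel. box_bump (real (Suc n)) a b x * k x)
        \<longlonglongrightarrow> (LINT x|lborel. indicator (box a b) x * k x)"
    proof (rule integral_dominated_convergence[where w = "\<lambda>x. norm (k x)"])
      show "(\<lambda>x. indicator (box a b) x * k x) \<in> borel_measurable lborel" using k(1) by simp
      show "(\<lambda>x. box_bump (real (Suc n)) a b x * k x) \<in> borel_measurable lborel" for n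
        using k(1) Cinf_on_continuous[OF Cinf_box_bump]
        by (auto intro!: borel_measurable_times intro: borel_measurable_continuous_onI)
      show "integrable lborel (\<lambda>x. norm (k x))" using kI by simp
      show "AE x in lborel. (\<lambda>n. box_bump (real (Suc n)) a b x * k x) \<longlonglongrightarrow> indicator (box a b) x * k x"
        by (intro AE_I2 tendsto_mult box_bump_lim tendsto_const)
      show "AE x in lborel. norm (box_bump (real (Suc n)) a b x * k x) \<le> norm (k x)" for n
        using box_bump_bounds[of "real (Suc n)" a b]
        by (intro AE_I2) (simp add: abs_mult mult_left_le_one_le)
    qed
    with z show ?thesis by (simp add: LIMSEQ_const_iff)
  qed auto
  have main': "(LINT x|lborel. indicator (box a b) x * k x) = 0" for a b
  proof -
    obtain a' b' where ab: "box a b \<inter> box c d = box a' b'"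
      using box_Int_box[of a b c d] by blast
    have "(LINT x|lborel. indicator (box a b) x * k x) = (LINT x|lborel. indicator (box a' b') x * k x)"
      using k(1)
    proof (intro integral_cong_AE)
      show "AE x in lborel. indicator (box a b) x * k x = indicator (box a' b') x * k x"
        using k(2) bd by eventually_elim (auto simp: indicator_def simp flip: ab split: if_splits)
    qed auto
    with main[of a' b'] ab show ?thesis by auto
  qed
  have "(LINT x|lborel. k x) = (LINT x|lborel. indicator (box c d) x * k x)"
    using k(1)
  proof (intro integral_cong_AE)
    show "AE x in lborel. k x = indicator (box c d) x * k x"
      using k(2) bd by eventually_elim (auto simp: indicator_def split: if_splits)
  qed auto
  with main'[of c d] have "(LINT x|lborel. k x) = 0" by simp
  from AE_zero_if_boxes_zero[OF kI main' this] have "AE x in lborel. k x = 0" .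
  then have "AE x in lebesgue. k x = 0" by (rule AE_completion)
  with k' show ?thesis by eventually_elim auto
qed

text \<open>An open set is a countable union of closed boxes, and countably many null sets have a
  null union.\<close>

lemma AE_lebesgue_on_open_cboxI:
  assumes "open \<Omega>" "\<And>c d. cbox c d \<subseteq> \<Omega> \<Longrightarrow> AE x in lebesgue. x \<in> cbox c d \<longrightarrow> P x"
  shows "AE x in lebesgue_on \<Omega>. P x"
proof -
  obtain \<D> where D: "countable \<D>" "\<D> \<subseteq> Pow \<Omega>" "\<And>X. X \<in> \<D> \<Longrightarrow> \<exists>a b. X = cbox a b" "\<Union>\<D> = \<Omega>"
    using open_countable_Union_open_cbox[OF assms(1)] by metis
  have "AE x in lebesgue. \<forall>X\<in>\<D>. x \<in> X \<longrightarrow> P x"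
    unfolding AE_ball_countable[OF D(1)]
  proof
    fix X assume X: "X \<in> \<D>"
    then obtain c d where "X = cbox c d" using D(3) by blast
    with X D(2) show "AE x in lebesgue. x \<in> X \<longrightarrow> P x" using assms(2)[of c d] by blast
  qed
  then have "AE x in lebesgue. x \<in> \<Omega> \<longrightarrow> P x"
    by eventually_elim (use D(4) in auto)
  then show ?thesis
    using assms(1) by (subst AE_restrict_space_iff) auto
qed

theorem fundamental_lemma:
  assumes "open \<Omega>" "loc_integrable \<Omega> h"
    and "\<And>\<phi>. \<phi> \<in> test_functions \<Omega> \<Longrightarrow> (LINT x|lebesgue_on \<Omega>. h x * \<phi> x) = 0"
  shows "AE x in lebesgue_on \<Omega>. h x = 0"
  by (rule AE_lebesgue_on_open_cboxI[OF assms(1)]) (rule fundamental_lemma_box[OF assms])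

section \<open>Measurability, uniqueness and linearity of weak derivatives\<close>

text \<open>\<open>is_weak_pd\<close> speaks only of local integrability. Measurability on all of
  \<Omega>, needed to place the chosen derivative \<open>wpd\<close> in \<open>L2\<close>, is glued
  together from countably many closed boxes.\<close>

lemma loc_integrable_measurable:
  assumes "open \<Omega>" "loc_integrable \<Omega> f"
  shows "f \<in> borel_measurable (lebesgue_on \<Omega>)"
proof -
  obtain \<D> where D: "countable \<D>" "\<D> \<subseteq> Pow \<Omega>" "\<And>X. X \<in> \<D> \<Longrightarrow> \<exists>a b. X = cbox a b" "\<Union>\<D> = \<Omega>"
    using open_countable_Union_open_cbox[OF assms(1)] by metis
  show ?thesis
  proof (rule measurable_piecewise_restrict[OF D(1)])
    fix X assume X: "X \<in> \<D>"
    then obtain c d where cd: "X = cbox c d" using D(3) by blast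
    have sub: "X \<subseteq> \<Omega>" using D(2) X by auto
    have s: "X \<in> sets lebesgue" "\<Omega> \<in> sets lebesgue" using cd assms(1) by auto
    then show "X \<inter> space (lebesgue_on \<Omega>) \<in> sets (lebesgue_on \<Omega>)"
      using sub by (auto simp: sets_restrict_space_iff Int_absorb2)
    have "restrict_space (lebesgue_on \<Omega>) X = lebesgue_on X"
      using sub by (simp add: restrict_restrict_space s Int_absorb1)
    then show "f \<in> restrict_space (lebesgue_on \<Omega>) X \<rightarrow>\<^sub>M borel"
      using assms(2) sub cd compact_cbox[of c d] by (auto simp: loc_integrable_def intro!: borel_measurable_integrable)
  qed (use D(4) in auto)
qed

lemma is_weak_pd_unique:
  assumes "open \<Omega>" "is_weak_pd \<Omega> i f g" "is_weak_pd \<Omega> i f g'"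
  shows "AE x in lebesgue_on \<Omega>. g x = g' x"
proof -
  have g: "loc_integrable \<Omega> g" "loc_integrable \<Omega> g'" using assms by (auto simp: is_weak_pd_def)
  have "AE x in lebesgue_on \<Omega>. g x - g' x = 0"
  proof (rule fundamental_lemma[OF assms(1)])
    show "loc_integrable \<Omega> (\<lambda>x. g x - g' x)" using g by (auto simp: loc_integrable_def)
    fix \<phi> assume p: "\<phi> \<in> test_functions \<Omega>"
    then have "(LINT x|lebesgue_on \<Omega>. g x * \<phi> x) = (LINT x|lebesgue_on \<Omega>. g' x * \<phi> x)"
      using assms(2,3) by (simp add: is_weak_pd_def)
    moreover have "integrable (lebesgue_on \<Omega>) (\<lambda>x. g x * \<phi> x)" "integrable (lebesgue_on \<Omega>) (\<lambda>x. g' x * \<phi> x)"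
      using g p by (auto intro!: loc_integrable_mult_cc assms(1) test_functions_cc)
    ultimately show "(LINT x|lebesgue_on \<Omega>. (g x - g' x) * \<phi> x) = 0"
      by (simp add: left_diff_distrib)
  qed
  then show ?thesis by eventually_elim simp
qed

lemma is_weak_pd_wpd:
  assumes "is_weak_pd \<Omega> i f g" shows "is_weak_pd \<Omega> i f (wpd \<Omega> i f)"
  unfolding wpd_def using assms by (rule someI[of "is_weak_pd \<Omega> i f"])

text \<open>Frees later arguments from the arbitrary choice made in \<open>wpd\<close>.\<close>

lemma wpd_AE_eq:
  assumes "open \<Omega>" "is_weak_pd \<Omega> i f g"
  shows "AE x in lebesgue_on \<Omega>. wpd \<Omega> i f x = g x"
  using is_weak_pd_unique[OF assms(1) is_weak_pd_wpd[OF assms(2)] assms(2)] .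

lemma is_weak_pd_lincomb:
  assumes "open \<Omega>" "is_weak_pd \<Omega> i f g" "is_weak_pd \<Omega> i f' g'"
  shows "is_weak_pd \<Omega> i (\<lambda>x. c * f x + d * f' x) (\<lambda>x. c * g x + d * g' x)"
proof -
  have L: "loc_integrable \<Omega> g" "loc_integrable \<Omega> g'" "loc_integrable \<Omega> f" "loc_integrable \<Omega> f'"
    using assms by (auto simp: is_weak_pd_def)
  have "(LINT x|lebesgue_on \<Omega>. (c * f x + d * f' x) * pd i \<phi> x) =
      - (LINT x|lebesgue_on \<Omega>. (c * g x + d * g' x) * \<phi> x)" if p: "\<phi> \<in> test_functions \<Omega>" for \<phi>
  proof -
    note * = loc_integrable_mult_cc[OF assms(1) _ test_functions_cc[OF p]]
      loc_integrable_mult_cc[OF assms(1) _ test_functions_cc[OF test_functions_pd[OF p]]]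
    have "(LINT x|lebesgue_on \<Omega>. (c * f x + d * f' x) * pd i \<phi> x)
      = (LINT x|lebesgue_on \<Omega>. c * (f x * pd i \<phi> x) + d * (f' x * pd i \<phi> x))"
      by (simp add: algebra_simps)
    also have "\<dots> = c * (LINT x|lebesgue_on \<Omega>. f x * pd i \<phi> x) + d * (LINT x|lebesgue_on \<Omega>. f' x * pd i \<phi> x)"
      using *(2)[OF L(3)] *(2)[OF L(4)] by simp
    also have "\<dots> = - (c * (LINT x|lebesgue_on \<Omega>. g x * \<phi> x) + d * (LINT x|lebesgue_on \<Omega>. g' x * \<phi> x))"
      using assms(2,3) p by (simp add: is_weak_pd_def)
    also have "c * (LINT x|lebesgue_on \<Omega>. g x * \<phi> x) + d * (LINT x|lebesgue_on \<Omega>. g' x * \<phi> x)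
      = (LINT x|lebesgue_on \<Omega>. c * (g x * \<phi> x) + d * (g' x * \<phi> x))"
      using *(1)[OF L(1)] *(1)[OF L(2)] by simp
    finally show ?thesis by (simp add: algebra_simps)
  qed
  with L show ?thesis
    unfolding is_weak_pd_def by (auto simp: loc_integrable_def)
qed

section \<open>Classical derivatives of test functions are weak derivatives\<close>

lemma Cinf_on_deriv_axis:
  assumes F: "Cinf_on UNIV F"
  shows "((\<lambda>t. F (x + t *\<^sub>R axis i 1)) has_real_derivative pd i F (x + t *\<^sub>R axis i 1)) (at t)"
proof -
  obtain F' where F': "(F has_derivative F') (at (x + t *\<^sub>R axis i 1))"
    using Cinf_on_differentiable[OF F, of "x + t *\<^sub>R axis i 1"] by (auto simp: differentiable_def)
  have "((\<lambda>t. x + t *\<^sub>R axis i 1) has_derivative (\<lambda>h. h *\<^sub>R axis i 1)) (at t)"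
    by (auto intro!: derivative_eq_intros)
  from has_derivative_compose[OF this F'] have "((\<lambda>t. F (x + t *\<^sub>R axis i 1)) has_derivative (\<lambda>h. F' (h *\<^sub>R axis i 1))) (at t)" .
  moreover have "(\<lambda>h. F' (h *\<^sub>R axis i 1)) = (*) (pd i F (x + t *\<^sub>R axis i 1))"
    using has_derivative_linear[OF F'] pd_eqI[OF F', of i]
    by (auto simp: fun_eq_iff linear_cmul)
  ultimately show ?thesis by (simp add: has_field_derivative_def)
qed

text \<open>The difference quotients along the i-th axis have integral 0 by translation invariance.
  The mean value theorem bounds them by the supremum of the derivative on a fixed ball, so dominated
  convergence carries the value 0 over to \<open>pd i F\<close>.\<close>

lemma integral_pd_zero:
  assumes F: "Cinf_on UNIV F" and K: "compact K" "\<And>x. x \<notin> K \<Longrightarrow> F x = 0"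
  shows "(LINT x|lborel. pd i F x) = 0"
proof -
  let ?e = "axis i 1 :: real ^ 3"
  define q where "q n x = (F (inverse (real (Suc n)) *\<^sub>R ?e + x) - F x) * real (Suc n)" for n x
  have cF: "continuous_on UNIV F" and cD: "continuous_on UNIV (pd i F)"
    using F by (auto intro: Cinf_on_continuous Cinf_on_pd)
  have FT: "F \<in> test_functions UNIV" using F K by (auto simp: test_functions_def)
  obtain B where B: "\<And>x. \<bar>pd i F x\<bar> \<le> B" "B > 0"
    using cc_fun_bounded[OF test_functions_cc[OF test_functions_pd[OF FT, of i]]] by metis
  have D: "((\<lambda>t. F (x + t *\<^sub>R ?e)) has_real_derivative pd i F (x + t *\<^sub>R ?e)) (at t)" for x t
    by (rule Cinf_on_deriv_axis[OF F])
  obtain R where R: "\<And>x. x \<in> K \<Longrightarrow> norm x \<le> R"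
    using compact_imp_bounded[OF K(1)] by (auto simp: bounded_iff)
  \<comment> \<open>The increment has length at most 1, so off the ball of radius
    \<open>R + 1\<close> both points of the quotient lie outside \<open>K\<close>.\<close>
  have bound: "\<bar>q n x\<bar> \<le> B * indicator (cball 0 (R + 1)) x" for n x
  proof (cases "norm x \<le> R + 1")
    case True
    let ?t = "inverse (real (Suc n))"
    have "?t > 0" by simp
    then obtain z where z: "F (x + ?t *\<^sub>R ?e) - F (x + 0 *\<^sub>R ?e) = (?t - 0) * pd i F (x + z *\<^sub>R ?e)"
      using MVT2[of 0 ?t "\<lambda>t. F (x + t *\<^sub>R ?e)" "\<lambda>t. pd i F (x + t *\<^sub>R ?e)"] D by blast
    then have "q n x = pd i F (x + z *\<^sub>R ?e)"
      by (simp add: q_def add.commute)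
    with True B show ?thesis by simp
  next
    case False
    have "norm (inverse (real (Suc n)) *\<^sub>R ?e) \<le> 1"
      by (simp add: norm_axis_1 inverse_le_1_iff del: inverse_Suc)
    then have "norm (inverse (real (Suc n)) *\<^sub>R ?e + x) > R"
      using False norm_triangle_ineq4[of "inverse (real (Suc n)) *\<^sub>R ?e + x" "inverse (real (Suc n)) *\<^sub>R ?e"]
      by simp
    with R False have "inverse (real (Suc n)) *\<^sub>R ?e + x \<notin> K" "x \<notin> K" by force+
    then show ?thesis using B(2) K(2) by (simp add: q_def)
  qed
  have mF[measurable]: "F \<in> borel_measurable borel" using cF by (rule borel_measurable_continuous_onI)
  have mD: "pd i F \<in> borel_measurable borel" using cD by (rule borel_measurable_continuous_onI)
  have iF: "integrable lborel F"
  proof -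
    obtain C where C: "\<And>x. \<bar>F x\<bar> \<le> C" "C > 0" using cc_fun_bounded[OF test_functions_cc[OF FT]] by metis
    show ?thesis
    proof (rule Bochner_Integration.integrable_bound[where f = "\<lambda>x. C * indicator (cball 0 R) x"])
      show "integrable lborel (\<lambda>x. C * indicator (cball 0 R) x)"
        by (intro integrable_mult_right integrable_real_indicator) (auto intro: emeasure_lborel_cball_finite[simplified])
      show "AE x in lborel. norm (F x) \<le> norm (C * indicator (cball 0 R) x)"
      proof (rule AE_I2)
        fix x show "norm (F x) \<le> norm (C * indicator (cball 0 R) x)"
          using C K(2)[of x] R[of x] by (auto simp: indicator_def)
      qed
    qed simp
  qed
  have q0: "(LINT x|lborel. q n x) = 0" for n
  proof -
    let ?c = "inverse (real (Suc n)) *\<^sub>R ?e"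
    have "(LINT x|lborel. F x) = (LINT x|distr lborel borel ((+) ?c). F x)"
      by (simp add: lborel_distr_plus)
    also have "\<dots> = (LINT x|lborel. F (?c + x))" by (subst integral_distr) auto
    finally have eq: "(LINT x|lborel. F (?c + x)) = (LINT x|lborel. F x)" by simp
    have "integrable (distr lborel borel ((+) ?c)) F" using iF by (simp add: lborel_distr_plus)
    then have "integrable lborel (\<lambda>x. F (?c + x))" by (subst (asm) integrable_distr_eq) auto
    with iF eq show ?thesis by (simp add: q_def del: inverse_Suc)
  qed
  have "(\<lambda>n. LINT x|lborel. q n x) \<longlonglongrightarrow> (LINT x|lborel. pd i F x)"
  proof (rule integral_dominated_convergence[where w = "\<lambda>x. B * indicator (cball 0 (R + 1)) x"])
    show "integrable lborel (\<lambda>x. B * indicator (cball 0 (R + 1)) x)"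
      by (intro integrable_mult_right integrable_real_indicator) (auto intro: emeasure_lborel_cball_finite[simplified])
    show "AE x in lborel. (\<lambda>n. q n x) \<longlonglongrightarrow> pd i F x"
    proof (rule AE_I2)
      fix x
      have "((\<lambda>h. (F (x + (0 + h) *\<^sub>R ?e) - F (x + 0 *\<^sub>R ?e)) / h) \<longlongrightarrow> pd i F (x + 0 *\<^sub>R ?e)) (at 0)"
        using D[of x 0] by (simp add: DERIV_def)
      then have "((\<lambda>h. (F (x + h *\<^sub>R ?e) - F x) / h) \<longlongrightarrow> pd i F x) (at 0)" by simp
      moreover have "filterlim (\<lambda>n. inverse (real (Suc n))) (at 0) sequentially"
        using LIMSEQ_inverse_real_of_nat by (auto simp: filterlim_at simp del: inverse_Suc)
      ultimately have "(\<lambda>n. (F (x + inverse (real (Suc n)) *\<^sub>R ?e) - F x) / inverse (real (Suc n))) \<longlonglongrightarrow> pd i F x"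
        by (rule filterlim_compose)
      then show "(\<lambda>n. q n x) \<longlonglongrightarrow> pd i F x"
        by (simp add: q_def add.commute divide_inverse del: of_nat_Suc)
    qed
    show "AE x in lborel. norm (q n x) \<le> B * indicator (cball 0 (R + 1)) x" for n
      using bound by (intro AE_I2) simp
    show "q n \<in> borel_measurable lborel" for n unfolding q_def by measurable
    show "pd i F \<in> borel_measurable lborel" using mD by simp
  qed
  with q0 show ?thesis by (simp add: LIMSEQ_const_iff)
qed

lemma cc_fun_loc_integrable:
  assumes "cc_fun \<Omega> f" "open \<Omega>" shows "loc_integrable \<Omega> f"
  unfolding loc_integrable_def
proof (intro allI impI)
  fix L assume L: "compact L \<and> L \<subseteq> \<Omega>"
  obtain C where C: "\<And>x. \<bar>f x\<bar> \<le> C" "C > 0" using cc_fun_bounded[OF assms(1)] by metis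
  interpret finite_measure "lebesgue_on L"
    using L by (intro finite_measure_lebesgue_on lmeasurable_compact) auto
  show "integrable (lebesgue_on L) f"
    by (rule integrable_const_bound[of _ C])
      (use C in \<open>auto intro: measurable_lebesgue_on_borel cc_fun_measurable[OF assms(1)]\<close>)
qed

text \<open>Integration by parts: \<open>integral_pd_zero\<close> is applied to the product of the
  two test functions.\<close>

lemma is_weak_pd_test:
  assumes "open \<Omega>" "f \<in> test_functions \<Omega>"
  shows "is_weak_pd \<Omega> i f (pd i f)"
  unfolding is_weak_pd_def
proof (intro conjI ballI)
  show "loc_integrable \<Omega> f" "loc_integrable \<Omega> (pd i f)"
    using assms by (auto intro: cc_fun_loc_integrable test_functions_cc test_functions_pd)
  fix \<phi> assume p: "\<phi> \<in> test_functions \<Omega>"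
  note int = cc_fun_loc_integrable[OF test_functions_cc[OF assms(2)] assms(1)]
    cc_fun_loc_integrable[OF test_functions_cc[OF test_functions_pd[OF assms(2)]] assms(1)]
  have 1: "integrable (lebesgue_on \<Omega>) (\<lambda>x. f x * pd i \<phi> x)"
    "integrable (lebesgue_on \<Omega>) (\<lambda>x. pd i f x * \<phi> x)"
    using p by (auto intro!: loc_integrable_mult_cc assms(1) int test_functions_cc test_functions_pd)
  have t: "(\<lambda>x. f x * \<phi> x) \<in> test_functions \<Omega>"
    using assms(2) p test_functions_Cinf by (intro test_functions_mult) auto
  then obtain K where K: "compact K" "K \<subseteq> \<Omega>" "\<And>x. x \<notin> K \<Longrightarrow> f x * \<phi> x = 0"
    by (auto simp: test_functions_def)
  have eq: "pd i (\<lambda>x. f x * \<phi> x) x = pd i f x * \<phi> x + f x * pd i \<phi> x" for x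
    using assms(2) p by (intro pd_mult) (auto intro!: Cinf_on_differentiable[of UNIV] test_functions_Cinf)
  have "(LINT x|lebesgue_on \<Omega>. pd i f x * \<phi> x) + (LINT x|lebesgue_on \<Omega>. f x * pd i \<phi> x)
    = (LINT x|lebesgue_on \<Omega>. pd i (\<lambda>x. f x * \<phi> x) x)"
    unfolding eq using 1 by simp
  also have "\<dots> = (LINT x|lborel. pd i (\<lambda>x. f x * \<phi> x) x)"
  proof (rule lebesgue_on_integral_support[OF assms(1)])
    show "pd i (\<lambda>x. f x * \<phi> x) x = 0" if "x \<notin> \<Omega>" for x
      using pd_eq_0_outside[of K "\<lambda>x. f x * \<phi> x"] K that by (auto dest: compact_imp_closed)
    show "pd i (\<lambda>x. f x * \<phi> x) \<in> borel_measurable borel"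
      using t test_functions_pd test_functions_cc cc_fun_measurable by blast
  qed
  also have "\<dots> = 0"
    using t K(1,3) by (intro integral_pd_zero) (auto intro: test_functions_Cinf)
  finally show "(LINT x|lebesgue_on \<Omega>. f x * pd i \<phi> x) = - (LINT x|lebesgue_on \<Omega>. pd i f x * \<phi> x)"
    by simp
qed

section \<open>The Gagliardo-Nirenberg-Sobolev inequality\<close>

text \<open>Permuting i, j, k lets any chosen coordinate become the innermost variable of an
  iterated integral.\<close>

definition triple_pt :: "3 \<Rightarrow> 3 \<Rightarrow> 3 \<Rightarrow> real \<times> real \<times> real \<Rightarrow> real ^ 3" where
  "triple_pt i j k = (\<lambda>(x, y, z). x *\<^sub>R axis i 1 + y *\<^sub>R axis j 1 + z *\<^sub>R axis k 1)"

lemma triple_pt_measurable [measurable]: "triple_pt i j k \<in> borel_measurable borel"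
  unfolding triple_pt_def split_beta
  by (intro borel_measurable_continuous_onI continuous_intros)

lemma lborel_distr_triple_pt:
  assumes d: "i \<noteq> j" "i \<noteq> k" "j \<noteq> k" and U: "UNIV = {i, j, k}"
  shows "distr lborel borel (triple_pt i j k) = lborel"
proof (rule lborel_eqI[symmetric])
  fix l u :: "real ^ 3"
  assume lu: "\<And>b. b \<in> Basis \<Longrightarrow> l \<bullet> b \<le> u \<bullet> b"
  have le: "l $ m \<le> u $ m" for m
    using lu[of "axis m 1"] by (simp add: inner_axis axis_in_Basis_iff)
  have all3: "(\<forall>m. Q m) \<longleftrightarrow> Q i \<and> Q j \<and> Q k" for Q :: "3 \<Rightarrow> bool"
    using U by (metis UNIV_I insertE singletonD)
  have vi: "triple_pt i j k -` box l u =
      {l $ i<..<u $ i} \<times> {l $ j<..<u $ j} \<times> {l $ k<..<u $ k}"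
    using d by (auto simp: triple_pt_def mem_box_cart all3 axis_def)
  have "emeasure (distr lborel borel (triple_pt i j k)) (box l u)
    = emeasure lborel (triple_pt i j k -` box l u)"
    by (subst emeasure_distr) auto
  also have "\<dots> = emeasure (lborel \<Otimes>\<^sub>M (lborel \<Otimes>\<^sub>M lborel))
      ({l $ i<..<u $ i} \<times> {l $ j<..<u $ j} \<times> {l $ k<..<u $ k})"
    unfolding vi lborel_prod ..
  also have "\<dots> = ennreal ((u $ i - l $ i) * ((u $ j - l $ j) * (u $ k - l $ k)))"
    using le
    by (subst lborel_prod, subst lborel.emeasure_pair_measure_Times)
      (auto simp: lborel.emeasure_pair_measure_Times lborel_prod[symmetric] ennreal_mult)
  also have "(u $ i - l $ i) * ((u $ j - l $ j) * (u $ k - l $ k)) = (\<Prod>m\<in>UNIV. (u - l) $ m)"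
    using d by (simp add: U)
  also have "\<dots> = (\<Prod>b\<in>Basis. (u - l) \<bullet> b)"
  proof -
    have B: "(Basis :: (real ^ 3) set) = (\<lambda>m. axis m 1) ` UNIV"
      by (auto simp: Basis_vec_def)
    show ?thesis
      unfolding B by (subst prod.reindex) (auto simp: inj_on_def axis_eq_axis inner_axis)
  qed
  finally show "emeasure (distr lborel borel (triple_pt i j k)) (box l u) = (\<Prod>b\<in>Basis. (u - l) \<bullet> b)" .
qed simp

lemma nn_integral_triple_pt:
  assumes d: "i \<noteq> j" "i \<noteq> k" "j \<noteq> k" and U: "UNIV = {i, j, k}"
    and [measurable]: "f \<in> borel_measurable borel"
  shows "(\<integral>\<^sup>+ v. f v \<partial>lborel) =
    (\<integral>\<^sup>+ x. \<integral>\<^sup>+ y. \<integral>\<^sup>+ z. f (triple_pt i j k (x, y, z)) \<partial>lborel \<partial>lborel \<partial>lborel)"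
proof -
  have m: "(\<lambda>q. f (triple_pt i j k q)) \<in> borel_measurable (lborel \<Otimes>\<^sub>M lborel)"
    by (simp add: lborel_prod)
  have m2: "(\<lambda>p. f (triple_pt i j k (x, p))) \<in> borel_measurable (lborel \<Otimes>\<^sub>M lborel)" for x
  proof -
    have "(\<lambda>p. (x, p)) \<in> borel \<rightarrow>\<^sub>M (borel :: (real \<times> real \<times> real) measure)"
      by (intro borel_measurable_continuous_onI continuous_intros)
    moreover have "(\<lambda>q. f (triple_pt i j k q)) \<in> borel_measurable borel" by measurable
    ultimately show ?thesis by (simp add: lborel_prod measurable_compose)
  qed
  have "(\<integral>\<^sup>+ v. f v \<partial>lborel) = (\<integral>\<^sup>+ v. f v \<partial>distr lborel borel (triple_pt i j k))"
    unfolding lborel_distr_triple_pt[OF d U] ..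
  also have "\<dots> = (\<integral>\<^sup>+ q. f (triple_pt i j k q) \<partial>(lborel \<Otimes>\<^sub>M lborel))"
    by (subst nn_integral_distr) (auto simp: lborel_prod)
  also have "\<dots> = (\<integral>\<^sup>+ x. \<integral>\<^sup>+ p. f (triple_pt i j k (x, p)) \<partial>lborel \<partial>lborel)"
    using lborel.nn_integral_fst[OF m] by simp
  also have "\<dots> = (\<integral>\<^sup>+ x. \<integral>\<^sup>+ p. f (triple_pt i j k (x, p)) \<partial>(lborel \<Otimes>\<^sub>M lborel) \<partial>lborel)"
    unfolding lborel_prod ..
  also have "\<dots> = (\<integral>\<^sup>+ x. \<integral>\<^sup>+ y. \<integral>\<^sup>+ z. f (triple_pt i j k (x, y, z)) \<partial>lborel \<partial>lborel \<partial>lborel)"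
    using lborel.nn_integral_fst[OF m2] by simp
  finally show ?thesis .
qed

text \<open>Cauchy-Schwarz twice. In z, for fixed x and y, it gives K(x, y)^2 \<le> A(y) B(x). In
  (x, y) it separates K from \<open>g3\<close>, and the integral of A(y) B(x) is a product.\<close>

lemma loomis_whitney:
  fixes g1 g2 g3 :: "real \<times> real \<Rightarrow> ennreal"
  assumes [measurable]: "g1 \<in> borel_measurable (borel \<Otimes>\<^sub>M borel)"
    "g2 \<in> borel_measurable (borel \<Otimes>\<^sub>M borel)" "g3 \<in> borel_measurable (borel \<Otimes>\<^sub>M borel)"
  shows "(\<integral>\<^sup>+ x. \<integral>\<^sup>+ y. \<integral>\<^sup>+ z. g1 (y, z) * g2 (x, z) * g3 (x, y) \<partial>lborel \<partial>lborel \<partial>lborel)\<^sup>2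
    \<le> (\<integral>\<^sup>+ y. \<integral>\<^sup>+ z. (g1 (y, z))\<^sup>2 \<partial>lborel \<partial>lborel) *
      (\<integral>\<^sup>+ x. \<integral>\<^sup>+ z. (g2 (x, z))\<^sup>2 \<partial>lborel \<partial>lborel) *
      (\<integral>\<^sup>+ x. \<integral>\<^sup>+ y. (g3 (x, y))\<^sup>2 \<partial>lborel \<partial>lborel)"
proof -
  define K where "K = (\<lambda>(x, y). \<integral>\<^sup>+ z. g1 (y, z) * g2 (x, z) \<partial>lborel)"
  define A where "A = (\<lambda>y. \<integral>\<^sup>+ z. (g1 (y, z))\<^sup>2 \<partial>lborel)"
  define B where "B = (\<lambda>x. \<integral>\<^sup>+ z. (g2 (x, z))\<^sup>2 \<partial>lborel)"
  have [measurable]: "K \<in> borel_measurable (borel \<Otimes>\<^sub>M borel)"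
    unfolding K_def split_beta by measurable
  have [measurable]: "A \<in> borel_measurable borel" "B \<in> borel_measurable borel"
    unfolding A_def B_def by measurable
  have K: "(K (x, y))\<^sup>2 \<le> A y * B x" for x y
    unfolding K_def A_def B_def prod.case by (rule Cauchy_Schwarz_nn_integral) measurable
  have eq: "(\<integral>\<^sup>+ x. \<integral>\<^sup>+ y. \<integral>\<^sup>+ z. g1 (y, z) * g2 (x, z) * g3 (x, y) \<partial>lborel \<partial>lborel \<partial>lborel)
    = (\<integral>\<^sup>+ p. K p * g3 p \<partial>(lborel \<Otimes>\<^sub>M lborel))"
    by (subst lborel.nn_integral_fst[symmetric]) (auto simp: K_def nn_integral_multc)
  have "(\<integral>\<^sup>+ p. K p * g3 p \<partial>(lborel \<Otimes>\<^sub>M lborel))\<^sup>2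
    \<le> (\<integral>\<^sup>+ p. (K p)\<^sup>2 \<partial>(lborel \<Otimes>\<^sub>M lborel)) * (\<integral>\<^sup>+ p. (g3 p)\<^sup>2 \<partial>(lborel \<Otimes>\<^sub>M lborel))"
    by (rule Cauchy_Schwarz_nn_integral) measurable
  also have "\<dots> \<le> ((\<integral>\<^sup>+ y. A y \<partial>lborel) * (\<integral>\<^sup>+ x. B x \<partial>lborel)) *
      (\<integral>\<^sup>+ p. (g3 p)\<^sup>2 \<partial>(lborel \<Otimes>\<^sub>M lborel))"
  proof (rule mult_right_mono)
    have "(\<integral>\<^sup>+ p. (K p)\<^sup>2 \<partial>(lborel \<Otimes>\<^sub>M lborel)) = (\<integral>\<^sup>+ x. \<integral>\<^sup>+ y. (K (x, y))\<^sup>2 \<partial>lborel \<partial>lborel)"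
      by (subst lborel.nn_integral_fst[symmetric]) auto
    also have "\<dots> \<le> (\<integral>\<^sup>+ x. \<integral>\<^sup>+ y. A y * B x \<partial>lborel \<partial>lborel)"
      by (intro nn_integral_mono K)
    also have "\<dots> = (\<integral>\<^sup>+ y. A y \<partial>lborel) * (\<integral>\<^sup>+ x. B x \<partial>lborel)"
      by (simp add: nn_integral_multc nn_integral_cmult)
    finally show "(\<integral>\<^sup>+ p. (K p)\<^sup>2 \<partial>(lborel \<Otimes>\<^sub>M lborel)) \<le> (\<integral>\<^sup>+ y. A y \<partial>lborel) * (\<integral>\<^sup>+ x. B x \<partial>lborel)" .
  qed simp
  also have "(\<integral>\<^sup>+ p. (g3 p)\<^sup>2 \<partial>(lborel \<Otimes>\<^sub>M lborel)) = (\<integral>\<^sup>+ x. \<integral>\<^sup>+ y. (g3 (x, y))\<^sup>2 \<partial>lborel \<partial>lborel)"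
    by (subst lborel.nn_integral_fst[symmetric]) auto
  finally show ?thesis unfolding eq by (simp add: A_def B_def)
qed

text \<open>The square root on the extended nonnegative reals. The line integrals below are kept in
  \<open>ennreal\<close>, so that no finiteness has to be known before taking roots.\<close>

definition ennsqrt :: "ennreal \<Rightarrow> ennreal" where
  "ennsqrt e = (if e = top then top else ennreal (sqrt (enn2real e)))"

lemma ennsqrt_measurable [measurable]: "ennsqrt \<in> borel_measurable borel"
  unfolding ennsqrt_def by measurable

lemma ennsqrt_sq: "(ennsqrt e)\<^sup>2 = e"
  by (cases e) (auto simp: ennsqrt_def ennreal_power ennreal_top_mult power2_eq_square ennreal_mult[symmetric] top_unique)

lemma le_ennsqrt:
  assumes "a \<ge> 0" "ennreal (a\<^sup>2) \<le> e" shows "ennreal a \<le> ennsqrt e"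
  using assms by (cases e) (auto simp: ennsqrt_def intro!: ennreal_leI real_le_rsqrt)

section \<open>The Sobolev inequality for test functions\<close>

text \<open>The fundamental theorem of calculus for u^4, started to the left of the support. The
  exponent 4 is chosen because Cauchy-Schwarz splits the derivative 4 u^3 u' into the integral of
  u^6, the quantity to be estimated, and that of u'^2.\<close>

lemma fourth_power_le_nn_integral:
  assumes D: "\<And>t. (u has_real_derivative u' t) (at t)" and c: "continuous_on UNIV u'"
    and R: "\<And>t. \<bar>t\<bar> > R \<Longrightarrow> u t = 0"
  shows "ennreal (u x ^ 4) \<le> (\<integral>\<^sup>+ t. ennreal (4 * \<bar>u t\<bar> ^ 3 * \<bar>u' t\<bar>) \<partial>lborel)"
proof -
  define l where "l = - (\<bar>R\<bar> + \<bar>x\<bar> + 1)"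
  have l: "l \<le> x" "u l = 0" using R[of l] by (auto simp: l_def)
  have cu: "continuous_on UNIV u"
    using D by (auto intro!: continuous_at_imp_continuous_on intro: DERIV_isCont)
  have cF: "continuous_on S (\<lambda>t. 4 * u t ^ 3 * u' t)" for S
    by (intro continuous_intros continuous_on_subset[OF cu] continuous_on_subset[OF c]) auto
  have "((\<lambda>t. u t ^ 4) has_real_derivative 4 * u t ^ 3 * u' t) (at t within S)" for t S
    by (rule has_field_derivative_at_within) (auto intro!: derivative_eq_intros D)
  then have I: "has_bochner_integral lborel (\<lambda>t. indicator {l..x} t *\<^sub>R (4 * u t ^ 3 * u' t)) (u x ^ 4 - u l ^ 4)"
    by (intro has_bochner_integral_FTC_Icc l(1) cF) (auto simp: has_real_derivative_iff_has_vector_derivative)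
  have "u x ^ 4 = (LINT t|lborel. indicator {l..x} t *\<^sub>R (4 * u t ^ 3 * u' t))"
    using I l(2) by (simp add: has_bochner_integral_iff)
  also have "\<dots> \<le> (LINT t|lborel. norm (indicator {l..x} t *\<^sub>R (4 * u t ^ 3 * u' t)))"
    using I by (intro integral_mono) (auto simp: has_bochner_integral_iff)
  finally have "ennreal (u x ^ 4) \<le> ennreal (LINT t|lborel. norm (indicator {l..x} t *\<^sub>R (4 * u t ^ 3 * u' t)))"
    by (rule ennreal_leI)
  also have "\<dots> = (\<integral>\<^sup>+ t. ennreal (norm (indicator {l..x} t *\<^sub>R (4 * u t ^ 3 * u' t))) \<partial>lborel)"
    using I by (subst nn_integral_eq_integral) (auto simp: has_bochner_integral_iff simp del: norm_scaleR real_scaleR_def real_norm_def)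
  also have "\<dots> \<le> (\<integral>\<^sup>+ t. ennreal (4 * \<bar>u t\<bar> ^ 3 * \<bar>u' t\<bar>) \<partial>lborel)"
    by (intro nn_integral_mono ennreal_leI) (auto simp: indicator_def abs_mult power_abs)
  finally show ?thesis .
qed

text \<open>F^4 is bounded by a line integral in each of the three axis directions, and each line
  integral is constant in its own coordinate. Multiplying the square roots of the three bounds
  dominates F^6 by a product of the shape required by \<open>loomis_whitney\<close>.\<close>

theorem gagliardo_nirenberg_sobolev_nn:
  assumes F: "Cinf_on UNIV F" and K: "compact K" "\<And>x. x \<notin> K \<Longrightarrow> F x = 0"
  shows "(\<integral>\<^sup>+ v. ennreal (F v ^ 6) \<partial>lborel)\<^sup>2 \<le>
    (\<Prod>i\<in>UNIV. \<integral>\<^sup>+ v. ennreal (4 * \<bar>F v\<bar> ^ 3 * \<bar>pd i F v\<bar>) \<partial>lborel)"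
proof -
  have mF[measurable]: "F \<in> borel_measurable borel" and mD[measurable]: "pd i F \<in> borel_measurable borel" for i
    using F by (auto intro!: borel_measurable_continuous_onI Cinf_on_continuous Cinf_on_pd)
  obtain R where R: "\<And>x. x \<in> K \<Longrightarrow> norm x \<le> R"
    using compact_imp_bounded[OF K(1)] by (auto simp: bounded_iff)
  let ?P = "triple_pt 1 2 3"
  define h where "h i v = ennreal (4 * \<bar>F v\<bar> ^ 3 * \<bar>pd i F v\<bar>)" for i v
  have mh[measurable]: "h i \<in> borel_measurable borel" for i unfolding h_def by measurable
  have line: "ennreal (F v ^ 4) \<le> (\<integral>\<^sup>+ t. h i (v + (t - v $ i) *\<^sub>R axis i 1) \<partial>lborel)" for v i
  proof -
    \<comment> \<open>Starting from the projection of v to the plane where the i-th coordinate is 0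
      makes the line parameter t equal to that coordinate, so |t| > R forces the norm above
      R.\<close>
    let ?w = "v - (v $ i) *\<^sub>R axis i 1"
    have "ennreal (F (?w + (v $ i) *\<^sub>R axis i 1) ^ 4)
       \<le> (\<integral>\<^sup>+ t. ennreal (4 * \<bar>F (?w + t *\<^sub>R axis i 1)\<bar> ^ 3 * \<bar>pd i F (?w + t *\<^sub>R axis i 1)\<bar>) \<partial>lborel)"
    proof (rule fourth_power_le_nn_integral[of "\<lambda>t. F (?w + t *\<^sub>R axis i 1)" "\<lambda>t. pd i F (?w + t *\<^sub>R axis i 1)" R])
      show "((\<lambda>t. F (?w + t *\<^sub>R axis i 1)) has_real_derivative pd i F (?w + t *\<^sub>R axis i 1)) (at t)" for t
        by (rule Cinf_on_deriv_axis[OF F])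
      show "continuous_on UNIV (\<lambda>t. pd i F (?w + t *\<^sub>R axis i 1))"
        by (rule continuous_on_compose2[of UNIV "pd i F"])
          (auto intro!: continuous_intros Cinf_on_continuous Cinf_on_pd F)
      fix t assume t: "\<bar>t\<bar> > R"
      have "(?w + t *\<^sub>R axis i 1) $ i = t" by (simp add: axis_def)
      then have "norm (?w + t *\<^sub>R axis i 1) > R"
        using t component_le_norm_cart[of "?w + t *\<^sub>R axis i 1" i] by simp
      then show "F (?w + t *\<^sub>R axis i 1) = 0" using K(2) R by force
    qed
    moreover have "?w + t *\<^sub>R axis i 1 = v + (t - v $ i) *\<^sub>R axis i 1" for t
      by (simp add: algebra_simps)
    ultimately show ?thesis by (simp add: h_def)
  qed
  define f1 where "f1 = (\<lambda>(y, z). \<integral>\<^sup>+ t. h 1 (?P (t, y, z)) \<partial>lborel)"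
  define f2 where "f2 = (\<lambda>(x, z). \<integral>\<^sup>+ t. h 2 (?P (x, t, z)) \<partial>lborel)"
  define f3 where "f3 = (\<lambda>(x, y). \<integral>\<^sup>+ t. h 3 (?P (x, y, t)) \<partial>lborel)"
  have [measurable]: "?P \<in> borel_measurable (borel \<Otimes>\<^sub>M (borel \<Otimes>\<^sub>M borel))"
    using triple_pt_measurable by (simp add: borel_prod)
  have [measurable]: "f1 \<in> borel_measurable (borel \<Otimes>\<^sub>M borel)" "f2 \<in> borel_measurable (borel \<Otimes>\<^sub>M borel)"
    "f3 \<in> borel_measurable (borel \<Otimes>\<^sub>M borel)"
    unfolding f1_def f2_def f3_def split_beta by measurable
  have U: "(UNIV :: 3 set) = {1, 2, 3}" "(UNIV :: 3 set) = {2, 3, 1}" "(UNIV :: 3 set) = {1, 3, 2}"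
    using exhaust_3 by auto
  have F1: "(\<integral>\<^sup>+ v. h 1 v \<partial>lborel) = (\<integral>\<^sup>+ y. \<integral>\<^sup>+ z. f1 (y, z) \<partial>lborel \<partial>lborel)"
    by (subst nn_integral_triple_pt[OF _ _ _ U(2)]) (auto simp: f1_def triple_pt_def algebra_simps)
  have F2: "(\<integral>\<^sup>+ v. h 2 v \<partial>lborel) = (\<integral>\<^sup>+ x. \<integral>\<^sup>+ z. f2 (x, z) \<partial>lborel \<partial>lborel)"
    by (subst nn_integral_triple_pt[OF _ _ _ U(3)]) (auto simp: f2_def triple_pt_def algebra_simps)
  have F3: "(\<integral>\<^sup>+ v. h 3 v \<partial>lborel) = (\<integral>\<^sup>+ x. \<integral>\<^sup>+ y. f3 (x, y) \<partial>lborel \<partial>lborel)"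
    by (subst nn_integral_triple_pt[OF _ _ _ U(1)]) (auto simp: f3_def)
  have pw: "ennreal (F (?P (x, y, z)) ^ 6) \<le> ennsqrt (f1 (y, z)) * ennsqrt (f2 (x, z)) * ennsqrt (f3 (x, y))" for x y z
  proof -
    let ?v = "?P (x, y, z)"
    have v: "?v $ 1 = x" "?v $ 2 = y" "?v $ 3 = z" by (simp_all add: triple_pt_def axis_def)
    have e: "?v + (t - x) *\<^sub>R axis 1 1 = ?P (t, y, z)" "?v + (t - y) *\<^sub>R axis 2 1 = ?P (x, t, z)"
      "?v + (t - z) *\<^sub>R axis 3 1 = ?P (x, y, t)" for t
      by (simp_all add: triple_pt_def algebra_simps)
    have sq: "((F ?v)\<^sup>2)\<^sup>2 = F ?v ^ 4" by simp
    have "ennreal ((F ?v)\<^sup>2) \<le> ennsqrt (f1 (y, z))" "ennreal ((F ?v)\<^sup>2) \<le> ennsqrt (f2 (x, z))"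
      "ennreal ((F ?v)\<^sup>2) \<le> ennsqrt (f3 (x, y))"
      using line[of ?v 1] line[of ?v 2] line[of ?v 3]
      by (auto intro!: le_ennsqrt simp only: sq zero_le_power2 v e f1_def f2_def f3_def prod.case)
    then have "ennreal ((F ?v)\<^sup>2) * ennreal ((F ?v)\<^sup>2) * ennreal ((F ?v)\<^sup>2)
      \<le> ennsqrt (f1 (y, z)) * ennsqrt (f2 (x, z)) * ennsqrt (f3 (x, y))"
      by (intro mult_mono) auto
    moreover have "ennreal (F ?v ^ 6) = ennreal ((F ?v)\<^sup>2) * ennreal ((F ?v)\<^sup>2) * ennreal ((F ?v)\<^sup>2)"
      by (simp add: ennreal_mult[symmetric] flip: power_add)
    ultimately show ?thesis by simp
  qed
  have "(\<integral>\<^sup>+ v. ennreal (F v ^ 6) \<partial>lborel)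
    = (\<integral>\<^sup>+ x. \<integral>\<^sup>+ y. \<integral>\<^sup>+ z. ennreal (F (?P (x, y, z)) ^ 6) \<partial>lborel \<partial>lborel \<partial>lborel)"
    by (rule nn_integral_triple_pt[OF _ _ _ U(1)]) auto
  also have "\<dots> \<le> (\<integral>\<^sup>+ x. \<integral>\<^sup>+ y. \<integral>\<^sup>+ z. ennsqrt (f1 (y, z)) * ennsqrt (f2 (x, z)) * ennsqrt (f3 (x, y)) \<partial>lborel \<partial>lborel \<partial>lborel)"
    by (intro nn_integral_mono pw)
  finally have "(\<integral>\<^sup>+ v. ennreal (F v ^ 6) \<partial>lborel)\<^sup>2 \<le>
    (\<integral>\<^sup>+ x. \<integral>\<^sup>+ y. \<integral>\<^sup>+ z. ennsqrt (f1 (y, z)) * ennsqrt (f2 (x, z)) * ennsqrt (f3 (x, y)) \<partial>lborel \<partial>lborel \<partial>lborel)\<^sup>2"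
    by (rule power_mono) simp
  also have "\<dots> \<le> (\<integral>\<^sup>+ v. h 1 v \<partial>lborel) * (\<integral>\<^sup>+ v. h 2 v \<partial>lborel) * (\<integral>\<^sup>+ v. h 3 v \<partial>lborel)"
    unfolding F1 F2 F3
    using loomis_whitney[of "\<lambda>p. ennsqrt (f1 p)" "\<lambda>p. ennsqrt (f2 p)" "\<lambda>p. ennsqrt (f3 p)"]
    by (simp add: ennsqrt_sq)
  also have "\<dots> = (\<Prod>i\<in>UNIV. \<integral>\<^sup>+ v. h i v \<partial>lborel)"
    by (subst U(1)) (simp add: mult.assoc)
  finally show ?thesis unfolding h_def .
qed

lemma cc_fun_integrable_lborel:
  assumes "cc_fun UNIV f" shows "integrable lborel f"
proof -
  from assms obtain K where K: "compact K" "\<And>x. x \<notin> K \<Longrightarrow> f x = 0" and c: "continuous_on UNIV f"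
    by (auto simp: cc_fun_def)
  have "integrable lborel (\<lambda>x. indicator K x *\<^sub>R f x)"
    using K(1) c by (intro borel_integrable_compact) (auto intro: continuous_on_subset)
  also have "(\<lambda>x. indicator K x *\<^sub>R f x) = f"
  proof
    show "indicator K x *\<^sub>R f x = f x" for x using K(2)[of x] by (auto simp: indicator_def)
  qed
  finally show ?thesis .
qed

lemma cc_fun_compose:
  assumes "cc_fun \<Omega> f" "continuous_on UNIV g" "g 0 = 0" shows "cc_fun \<Omega> (\<lambda>x. g (f x))"
  using assms unfolding cc_fun_def by (auto intro: continuous_on_compose2)

text \<open>With x the integral of F^6 and \<open>d i\<close> that of the squared i-th derivative,
  Cauchy-Schwarz bounds the square of each factor by 16 x d_i. Hence x^4 \<le> 16^3 x^3 d_1 d_2 d_3,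
  and x^3 cancels unless x = 0. The constant 4096 is 16^3.\<close>

theorem gagliardo_nirenberg_sobolev:
  assumes F: "F \<in> test_functions UNIV"
  shows "(LINT v|lborel. F v ^ 6) \<le> 4096 * (\<Prod>i\<in>UNIV. LINT v|lborel. (pd i F v)\<^sup>2)"
proof -
  define x where "x = (LINT v|lborel. F v ^ 6)"
  define d where "d i = (LINT v|lborel. (pd i F v)\<^sup>2)" for i
  have mF[measurable]: "F \<in> borel_measurable borel" and mD[measurable]: "pd i F \<in> borel_measurable borel" for i
    by (auto intro!: borel_measurable_continuous_onI Cinf_on_continuous Cinf_on_pd test_functions_Cinf[OF F])
  have "integrable lborel (\<lambda>v. F v ^ 6)" "integrable lborel (\<lambda>v. (pd i F v)\<^sup>2)" for i
    by (rule cc_fun_integrable_lborel, rule cc_fun_compose[of UNIV],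
        auto intro!: continuous_intros test_functions_cc F test_functions_pd[OF F])+
  then have X: "(\<integral>\<^sup>+ v. ennreal (F v ^ 6) \<partial>lborel) = ennreal x"
    and Dd: "(\<integral>\<^sup>+ v. ennreal ((pd i F v)\<^sup>2) \<partial>lborel) = ennreal (d i)" for i
    unfolding x_def d_def by (subst nn_integral_eq_integral; simp)+
  have x0: "x \<ge> 0" and d0: "d i \<ge> 0" for i
    by (auto simp: x_def d_def intro!: integral_nonneg)
  have CS: "(\<integral>\<^sup>+ v. ennreal (4 * \<bar>F v\<bar> ^ 3 * \<bar>pd i F v\<bar>) \<partial>lborel)\<^sup>2 \<le> ennreal (16 * x * d i)" for i
  proof -
    have "(\<integral>\<^sup>+ v. ennreal (4 * \<bar>F v\<bar> ^ 3 * \<bar>pd i F v\<bar>) \<partial>lborel)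
      = (\<integral>\<^sup>+ v. ennreal (4 * \<bar>F v\<bar> ^ 3) * ennreal \<bar>pd i F v\<bar> \<partial>lborel)"
      by (intro nn_integral_cong) (simp add: ennreal_mult)
    then have "(\<integral>\<^sup>+ v. ennreal (4 * \<bar>F v\<bar> ^ 3 * \<bar>pd i F v\<bar>) \<partial>lborel)\<^sup>2
      \<le> (\<integral>\<^sup>+ v. (ennreal (4 * \<bar>F v\<bar> ^ 3))\<^sup>2 \<partial>lborel) * (\<integral>\<^sup>+ v. (ennreal \<bar>pd i F v\<bar>)\<^sup>2 \<partial>lborel)"
      by (simp only:) (rule Cauchy_Schwarz_nn_integral; measurable)
    also have "(\<integral>\<^sup>+ v. (ennreal (4 * \<bar>F v\<bar> ^ 3))\<^sup>2 \<partial>lborel) = (\<integral>\<^sup>+ v. ennreal 16 * ennreal (F v ^ 6) \<partial>lborel)"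
      by (intro nn_integral_cong) (simp add: ennreal_power power_mult_distrib ennreal_mult power_even_abs flip: power_mult)
    also have "\<dots> = ennreal 16 * ennreal x" by (subst nn_integral_cmult) (auto simp: X)
    also have "(\<integral>\<^sup>+ v. (ennreal \<bar>pd i F v\<bar>)\<^sup>2 \<partial>lborel) = ennreal (d i)"
      unfolding Dd[symmetric] by (intro nn_integral_cong) (simp add: ennreal_power)
    finally show ?thesis using x0 d0 by (simp add: ennreal_mult)
  qed
  have "ennreal (x ^ 4) = ((ennreal x)\<^sup>2)\<^sup>2" using x0 by (simp add: ennreal_power)
  also have "\<dots> \<le> (\<Prod>i\<in>UNIV. \<integral>\<^sup>+ v. ennreal (4 * \<bar>F v\<bar> ^ 3 * \<bar>pd i F v\<bar>) \<partial>lborel)\<^sup>2"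
  proof (rule power_mono)
    from F obtain K where "compact K" "\<And>x. x \<notin> K \<Longrightarrow> F x = 0" by (auto simp: test_functions_def)
    from gagliardo_nirenberg_sobolev_nn[OF test_functions_Cinf[OF F] this]
    show "(ennreal x)\<^sup>2 \<le> (\<Prod>i\<in>UNIV. \<integral>\<^sup>+ v. ennreal (4 * \<bar>F v\<bar> ^ 3 * \<bar>pd i F v\<bar>) \<partial>lborel)"
      by (simp add: X)
  qed simp
  also have "\<dots> = (\<Prod>i\<in>UNIV. (\<integral>\<^sup>+ v. ennreal (4 * \<bar>F v\<bar> ^ 3 * \<bar>pd i F v\<bar>) \<partial>lborel)\<^sup>2)"
    by (simp add: prod_power_distrib)
  also have "\<dots> \<le> (\<Prod>i\<in>(UNIV :: 3 set). ennreal (16 * x * d i))"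
    by (subst (1 2) UNIV_3) (simp add: mult_mono CS)
  also have "\<dots> = ennreal (\<Prod>i\<in>(UNIV :: 3 set). 16 * x * d i)"
    by (rule prod_ennreal) (use x0 d0 in auto)
  also have "(\<Prod>i\<in>(UNIV :: 3 set). 16 * x * d i) = x ^ 3 * (4096 * (\<Prod>i\<in>UNIV. d i))"
    by (simp add: prod.distrib power_mult_distrib)
  finally have "x ^ 3 * x \<le> x ^ 3 * (4096 * (\<Prod>i\<in>UNIV. d i))"
    using x0 d0 by (subst (asm) ennreal_le_iff) (auto intro!: mult_nonneg_nonneg prod_nonneg simp: power4_eq_xxxx power3_eq_cube)
  then have "x = 0 \<or> x \<le> 4096 * (\<Prod>i\<in>UNIV. d i)"
    using x0 by (auto simp: mult_le_cancel_left)
  moreover have "(\<Prod>i\<in>UNIV. d i) \<ge> 0" using d0 by (intro prod_nonneg) auto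
  ultimately show ?thesis unfolding x_def[symmetric] d_def[symmetric] by auto
qed

section \<open>Sobolev spaces on a bounded domain\<close>

locale bounded_domain =
  fixes \<Omega> :: "(real ^ 3) set"
  assumes open_dom: "open \<Omega>" and bounded_dom: "bounded \<Omega>"
begin

abbreviation M :: "(real ^ 3) measure" where "M \<equiv> lebesgue_on \<Omega>"

lemma finite_measure_dom: "finite_measure M"
  by (intro finite_measure_lebesgue_on bounded_set_imp_lmeasurable bounded_dom) (use open_dom in auto)

sublocale dom: finite_measure M
  by (rule finite_measure_dom)

section \<open>Square-integrable functions on the domain\<close>

text \<open>Squared norms are used from here on: they are additive over components and
  differentiable along curves, while \<open>Lnorm\<close> wraps them into
  \<open>powr\<close>.\<close>

definition sqint :: "(real ^ 3 \<Rightarrow> real) \<Rightarrow> real" where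
  "sqint f = (LINT x|M. (f x)\<^sup>2)"

definition gradsq :: "(real ^ 3 \<Rightarrow> real) \<Rightarrow> real" where
  "gradsq f = (\<Sum>i\<in>UNIV. sqint (wpd \<Omega> i f))"

lemma sqint_nonneg [simp]: "sqint f \<ge> 0"
  unfolding sqint_def by (intro Bochner_Integration.integral_nonneg) auto

lemma gradsq_nonneg [simp]: "gradsq f \<ge> 0"
  unfolding gradsq_def by (intro sum_nonneg) simp

lemma sqint_wpd_le: "sqint (wpd \<Omega> i f) \<le> gradsq f"
  unfolding gradsq_def by (intro member_le_sum) auto

lemma L2D: "f \<in> L2 \<Omega> \<Longrightarrow> f \<in> borel_measurable M" "f \<in> L2 \<Omega> \<Longrightarrow> integrable M (\<lambda>x. (f x)\<^sup>2)"
  by (auto simp: L2_def)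

lemma L2_integrable_mult:
  assumes "f \<in> L2 \<Omega>" "g \<in> L2 \<Omega>" shows "integrable M (\<lambda>x. f x * g x)"
proof (rule Bochner_Integration.integrable_bound[where f = "\<lambda>x. (f x)\<^sup>2 + (g x)\<^sup>2"])
  show "integrable M (\<lambda>x. (f x)\<^sup>2 + (g x)\<^sup>2)" using assms by (intro Bochner_Integration.integrable_add L2D)
  show "(\<lambda>x. f x * g x) \<in> borel_measurable M" using assms by (intro borel_measurable_times L2D)
  show "AE x in M. norm (f x * g x) \<le> norm ((f x)\<^sup>2 + (g x)\<^sup>2)"
  proof (rule AE_I2)
    fix x
    have "2 * \<bar>f x * g x\<bar> \<le> (f x)\<^sup>2 + (g x)\<^sup>2"
      using sum_squares_bound[of "\<bar>f x\<bar>" "\<bar>g x\<bar>"] by (simp add: abs_mult)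
    then have "\<bar>f x * g x\<bar> \<le> (f x)\<^sup>2 + (g x)\<^sup>2" by linarith
    then show "norm (f x * g x) \<le> norm ((f x)\<^sup>2 + (g x)\<^sup>2)" by simp
  qed
qed

lemma L2_lincomb:
  assumes "f \<in> L2 \<Omega>" "g \<in> L2 \<Omega>" shows "(\<lambda>x. c * f x + d * g x) \<in> L2 \<Omega>"
proof -
  have "integrable M (\<lambda>x. c\<^sup>2 * (f x)\<^sup>2 + (d\<^sup>2 * (g x)\<^sup>2 + (2 * c * d) * (f x * g x)))"
    using assms by (intro Bochner_Integration.integrable_add integrable_mult_right L2D L2_integrable_mult)
  moreover have "c\<^sup>2 * (f x)\<^sup>2 + (d\<^sup>2 * (g x)\<^sup>2 + (2 * c * d) * (f x * g x)) = (c * f x + d * g x)\<^sup>2" for x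
    by (simp add: power2_sum power_mult_distrib)
  moreover have "(\<lambda>x. c * f x + d * g x) \<in> borel_measurable M"
    using assms by (intro borel_measurable_add borel_measurable_times borel_measurable_const L2D(1))
  ultimately show ?thesis by (simp add: L2_def)
qed

lemma L2_diff: "f \<in> L2 \<Omega> \<Longrightarrow> g \<in> L2 \<Omega> \<Longrightarrow> (\<lambda>x. f x - g x) \<in> L2 \<Omega>"
  using L2_lincomb[of f g 1 "-1"] by simp

lemma L2_const: "(\<lambda>x. c) \<in> L2 \<Omega>"
  by (simp add: L2_def)

lemma L2_integrable: "f \<in> L2 \<Omega> \<Longrightarrow> integrable M f"
  using L2_integrable_mult[OF _ L2_const[of 1], of f] by simp

lemma L2_AE_cong:
  assumes "g \<in> L2 \<Omega>" "f \<in> borel_measurable M" "AE x in M. f x = g x" shows "f \<in> L2 \<Omega>"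
proof -
  have "integrable M (\<lambda>x. (f x)\<^sup>2)"
  proof (subst integrable_cong_AE[where g = "\<lambda>x. (g x)\<^sup>2"])
    show "AE x in M. (f x)\<^sup>2 = (g x)\<^sup>2" using assms(3) by eventually_elim simp
    show "integrable M (\<lambda>x. (g x)\<^sup>2)" using assms(1) by (rule L2D)
  qed (use assms L2D in \<open>auto intro!: borel_measurable_power\<close>)
  with assms(2) show ?thesis by (simp add: L2_def)
qed

lemma sqint_AE_cong:
  assumes "f \<in> borel_measurable M" "g \<in> borel_measurable M" "AE x in M. f x = g x" shows "sqint f = sqint g"
  unfolding sqint_def
  by (intro integral_cong_AE borel_measurable_power assms eventually_mono[OF assms(3)]) auto

lemma Lnorm_2_sq: "(Lnorm \<Omega> 2 f)\<^sup>2 = (LINT x|M. (norm (f x))\<^sup>2)"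
proof -
  have "(LINT x|M. norm (f x) powr 2) = (LINT x|M. (norm (f x))\<^sup>2)" by simp
  moreover have "(LINT x|M. (norm (f x))\<^sup>2) \<ge> 0" by (intro Bochner_Integration.integral_nonneg) auto
  ultimately show ?thesis
    unfolding Lnorm_def by (simp add: powr_half_sqrt)
qed

lemma Lnorm_2_sqint: "(Lnorm \<Omega> 2 f)\<^sup>2 = sqint f"
  by (simp add: Lnorm_2_sq sqint_def)

lemma Lnorm_nonneg [simp]: "Lnorm \<Omega> q f \<ge> 0"
  by (simp add: Lnorm_def)

lemma L2_cauchy_schwarz:
  assumes "f \<in> L2 \<Omega>" "g \<in> L2 \<Omega>"
  shows "\<bar>LINT x|M. f x * g x\<bar> \<le> sqrt (sqint f) * sqrt (sqint g)"
proof -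
  let ?F = "sqint f" and ?G = "sqint g" and ?I = "LINT x|M. f x * g x"
  have q: "0 \<le> ?F + 2 * t * ?I + t\<^sup>2 * ?G" for t
  proof -
    have "0 \<le> sqint (\<lambda>x. f x + t * g x)" by simp
    also have "\<dots> = (LINT x|M. (f x)\<^sup>2 + ((2 * t) * (f x * g x) + t\<^sup>2 * (g x)\<^sup>2))"
      unfolding sqint_def by (simp add: power2_sum power_mult_distrib algebra_simps)
    also have "\<dots> = ?F + ((2 * t) * ?I + t\<^sup>2 * ?G)"
      using assms by (simp add: L2D L2_integrable_mult sqint_def)
    finally show ?thesis by simp
  qed
  have "?I\<^sup>2 \<le> ?F * ?G"
  proof (cases "?G = 0")
    case True
    have "?I = 0"
    proof (rule ccontr)
      assume "?I \<noteq> 0"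
      \<comment> \<open>The quadratic term vanishes, and this t would give the nonnegative
        expression the value - F - 2.\<close>
      then have "2 * (- (?F + 1) / ?I) * ?I = - 2 * ?F - 2" by (simp add: field_simps)
      moreover have "0 \<le> ?F + 2 * (- (?F + 1) / ?I) * ?I"
        using q[of "- (?F + 1) / ?I"] unfolding True by (simp only: mult_zero_right add_0_right)
      ultimately show False using sqint_nonneg[of f] by linarith
    qed
    with True show ?thesis by simp
  next
    case False
    then have G: "?G > 0" using sqint_nonneg[of g] by linarith
    \<comment> \<open>The quadratic polynomial is evaluated at its minimiser t = - I / G.\<close>
    have "0 \<le> (?F + 2 * (- ?I / ?G) * ?I + (- ?I / ?G)\<^sup>2 * ?G) * ?G"
      using q[of "- ?I / ?G"] G by (intro mult_nonneg_nonneg) auto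
    also have "\<dots> = ?F * ?G - ?I\<^sup>2" using G by (simp add: field_simps power2_eq_square)
    finally show ?thesis by simp
  qed
  then have "sqrt (?I\<^sup>2) \<le> sqrt (?F * ?G)" by (rule real_sqrt_le_mono)
  then show ?thesis by (simp add: real_sqrt_mult)
qed

lemma sqint_lincomb_le:
  assumes "f \<in> L2 \<Omega>" "g \<in> L2 \<Omega>"
  shows "sqint (\<lambda>x. c * f x + d * g x) \<le> 2 * c\<^sup>2 * sqint f + 2 * d\<^sup>2 * sqint g"
proof -
  have "sqint (\<lambda>x. c * f x + d * g x) \<le> (LINT x|M. 2 * c\<^sup>2 * (f x)\<^sup>2 + 2 * d\<^sup>2 * (g x)\<^sup>2)"
    unfolding sqint_def
  proof (rule integral_mono)
    show "integrable M (\<lambda>x. (c * f x + d * g x)\<^sup>2)" using L2_lincomb[OF assms] by (rule L2D)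
    show "integrable M (\<lambda>x. 2 * c\<^sup>2 * (f x)\<^sup>2 + 2 * d\<^sup>2 * (g x)\<^sup>2)"
      using assms by (intro Bochner_Integration.integrable_add integrable_mult_right L2D)
    show "(c * f x + d * g x)\<^sup>2 \<le> 2 * c\<^sup>2 * (f x)\<^sup>2 + 2 * d\<^sup>2 * (g x)\<^sup>2" for x
      using sum_squares_bound[of "c * f x" "d * g x"] by (simp add: power2_sum power_mult_distrib)
  qed
  also have "\<dots> = 2 * c\<^sup>2 * sqint f + 2 * d\<^sup>2 * sqint g"
    using assms by (simp add: L2D sqint_def)
  finally show ?thesis .
qed

text \<open>Stated for an arbitrary filter because it serves both sequences of test functions and
  limits in time.\<close>

lemma L2_tendsto_ip:
  assumes "\<forall>\<^sub>F s in F. f s \<in> L2 \<Omega>" "f0 \<in> L2 \<Omega>" "g \<in> L2 \<Omega>"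
    and "((\<lambda>s. sqint (\<lambda>x. f s x - f0 x)) \<longlongrightarrow> 0) F"
  shows "((\<lambda>s. LINT x|M. f s x * g x) \<longlongrightarrow> (LINT x|M. f0 x * g x)) F"
proof (rule LIM_zero_cancel, rule Lim_null_comparison)
  show "\<forall>\<^sub>F s in F. norm ((LINT x|M. f s x * g x) - (LINT x|M. f0 x * g x))
      \<le> sqrt (sqint (\<lambda>x. f s x - f0 x)) * sqrt (sqint g)"
    using assms(1)
  proof eventually_elim
    case (elim s)
    have "(LINT x|M. f s x * g x) - (LINT x|M. f0 x * g x) = (LINT x|M. (f s x - f0 x) * g x)"
      using elim assms by (simp add: left_diff_distrib L2_integrable_mult)
    then show ?case
      using L2_cauchy_schwarz[OF L2_diff[OF elim assms(2)] assms(3)] by simp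
  qed
  have "((\<lambda>s. sqrt (sqint (\<lambda>x. f s x - f0 x)) * sqrt (sqint g)) \<longlongrightarrow> sqrt 0 * sqrt (sqint g)) F"
    by (intro tendsto_intros assms)
  then show "((\<lambda>s. sqrt (sqint (\<lambda>x. f s x - f0 x)) * sqrt (sqint g)) \<longlongrightarrow> 0) F" by simp
qed

lemma sqint_expand:
  assumes "f \<in> L2 \<Omega>" "g \<in> L2 \<Omega>"
  shows "sqint f = sqint (\<lambda>x. f x - g x) + 2 * (LINT x|M. f x * g x) - sqint g"
proof -
  have "sqint (\<lambda>x. f x - g x) = (LINT x|M. (f x)\<^sup>2 + ((g x)\<^sup>2 - 2 * (f x * g x)))"
    unfolding sqint_def by (simp add: power2_diff algebra_simps)
  also have "\<dots> = sqint f + (sqint g - 2 * (LINT x|M. f x * g x))"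
    using assms by (simp add: L2D L2_integrable_mult sqint_def)
  finally show ?thesis by simp
qed

lemma L2_tendsto_sqint:
  assumes "\<forall>\<^sub>F s in F. f s \<in> L2 \<Omega>" "f0 \<in> L2 \<Omega>"
    and "((\<lambda>s. sqint (\<lambda>x. f s x - f0 x)) \<longlongrightarrow> 0) F"
  shows "((\<lambda>s. sqint (f s)) \<longlongrightarrow> sqint f0) F"
proof -
  have "((\<lambda>s. sqint (\<lambda>x. f s x - f0 x) + 2 * (LINT x|M. f s x * f0 x) - sqint f0)
      \<longlongrightarrow> 0 + 2 * (LINT x|M. f0 x * f0 x) - sqint f0) F"
    by (intro tendsto_intros L2_tendsto_ip assms)
  moreover have "0 + 2 * (LINT x|M. f0 x * f0 x) - sqint f0 = sqint f0"
    by (simp add: sqint_def power2_eq_square)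
  moreover have "\<forall>\<^sub>F s in F. sqint (\<lambda>x. f s x - f0 x) + 2 * (LINT x|M. f s x * f0 x) - sqint f0 = sqint (f s)"
    using assms(1) by eventually_elim (simp add: sqint_expand[OF _ assms(2)])
  ultimately show ?thesis using Lim_transform_eventually by fastforce
qed

lemma L2_AE_subseq:
  assumes "\<And>n::nat. f n \<in> L2 \<Omega>" "f0 \<in> L2 \<Omega>" "(\<lambda>n. sqint (\<lambda>x. f n x - f0 x)) \<longlonglongrightarrow> 0"
  obtains r :: "nat \<Rightarrow> nat" where "strict_mono r" "AE x in M. (\<lambda>n. f (r n) x) \<longlonglongrightarrow> f0 x"
proof -
  have d: "(\<lambda>x. f n x - f0 x) \<in> L2 \<Omega>" for n by (intro L2_diff assms)
  have "\<exists>r. strict_mono r \<and> (AE x in M. (\<lambda>n. (f (r n) x - f0 x)\<^sup>2) \<longlonglongrightarrow> 0)"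
    by (rule tendsto_L1_AE_subseq[where u = "\<lambda>n x. (f n x - f0 x)\<^sup>2"])
      (use assms(3) L2D(2)[OF d] in \<open>auto simp: sqint_def\<close>)
  then obtain r :: "nat \<Rightarrow> nat" where r: "strict_mono r" "AE x in M. (\<lambda>n. (f (r n) x - f0 x)\<^sup>2) \<longlonglongrightarrow> 0" by auto
  from r(2) have "AE x in M. (\<lambda>n. f (r n) x) \<longlonglongrightarrow> f0 x"
  proof eventually_elim
    case (elim x)
    then have "(\<lambda>n. f (r n) x - f0 x) \<longlonglongrightarrow> 0" by simp
    then show ?case by (rule LIM_zero_cancel)
  qed
  with r(1) show ?thesis by (rule that)
qed

section \<open>The spaces H1 and H01\<close>

lemma H1D:
  assumes "f \<in> H1 \<Omega>"
  shows "f \<in> L2 \<Omega>" "is_weak_pd \<Omega> i f (wpd \<Omega> i f)" "wpd \<Omega> i f \<in> L2 \<Omega>"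
proof -
  show "f \<in> L2 \<Omega>" using assms by (simp add: H1_def)
  from assms obtain g where g: "g \<in> L2 \<Omega>" "is_weak_pd \<Omega> i f g" by (auto simp: H1_def)
  show w: "is_weak_pd \<Omega> i f (wpd \<Omega> i f)" by (rule is_weak_pd_wpd[OF g(2)])
  then have "wpd \<Omega> i f \<in> borel_measurable M"
    by (intro loc_integrable_measurable[OF open_dom]) (simp add: is_weak_pd_def)
  then show "wpd \<Omega> i f \<in> L2 \<Omega>"
    by (rule L2_AE_cong[OF g(1) _ wpd_AE_eq[OF open_dom g(2)]])
qed

lemma L2_loc_integrable:
  assumes "f \<in> L2 \<Omega>" shows "loc_integrable \<Omega> f"
  unfolding loc_integrable_def
proof (intro allI impI)
  fix K assume K: "compact K \<and> K \<subseteq> \<Omega>"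
  then have s: "K \<in> sets lebesgue" "\<Omega> \<in> sets lebesgue" using open_dom by (auto simp: lmeasurable_compact fmeasurableD)
  have "integrable lebesgue (\<lambda>x. if x \<in> \<Omega> then f x else 0)"
    using L2_integrable[OF assms] s by (subst Lebesgue_Measure.integrable_restrict_UNIV)
  then have "integrable lebesgue (\<lambda>x. indicator K x *\<^sub>R (if x \<in> \<Omega> then f x else 0))"
    by (rule integrable_mult_indicator[OF s(1)])
  also have "(\<lambda>x. indicator K x *\<^sub>R (if x \<in> \<Omega> then f x else 0)) = (\<lambda>x. if x \<in> K then f x else 0)"
    using K by (auto simp: fun_eq_iff)
  finally show "integrable (lebesgue_on K) f"
    using s by (subst (asm) Lebesgue_Measure.integrable_restrict_UNIV)
qed

lemma H1I:
  assumes "f \<in> L2 \<Omega>" "\<And>i. g i \<in> L2 \<Omega>" "\<And>i. is_weak_pd \<Omega> i f (g i)" shows "f \<in> H1 \<Omega>"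
  using assms unfolding H1_def by blast

lemma
  assumes "f \<in> H1 \<Omega>" "g \<in> H1 \<Omega>"
  shows H1_lincomb: "(\<lambda>x. c * f x + d * g x) \<in> H1 \<Omega>"
    and wpd_lincomb: "AE x in M. wpd \<Omega> i (\<lambda>x. c * f x + d * g x) x = c * wpd \<Omega> i f x + d * wpd \<Omega> i g x"
proof -
  have w: "is_weak_pd \<Omega> i (\<lambda>x. c * f x + d * g x) (\<lambda>x. c * wpd \<Omega> i f x + d * wpd \<Omega> i g x)" for i
    by (intro is_weak_pd_lincomb open_dom H1D assms)
  show "(\<lambda>x. c * f x + d * g x) \<in> H1 \<Omega>"
    by (rule H1I[OF _ _ w]) (intro L2_lincomb H1D assms)+
  show "AE x in M. wpd \<Omega> i (\<lambda>x. c * f x + d * g x) x = c * wpd \<Omega> i f x + d * wpd \<Omega> i g x"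
    by (rule wpd_AE_eq[OF open_dom w])
qed

lemma H1_diff: "f \<in> H1 \<Omega> \<Longrightarrow> g \<in> H1 \<Omega> \<Longrightarrow> (\<lambda>x. f x - g x) \<in> H1 \<Omega>"
  using H1_lincomb[of f g 1 "-1"] by simp

lemma wpd_diff: "f \<in> H1 \<Omega> \<Longrightarrow> g \<in> H1 \<Omega> \<Longrightarrow> AE x in M. wpd \<Omega> i (\<lambda>x. f x - g x) x = wpd \<Omega> i f x - wpd \<Omega> i g x"
  using wpd_lincomb[of f g i 1 "-1"] by simp

lemma sqint_wpd_lincomb:
  assumes "f \<in> H1 \<Omega>" "g \<in> H1 \<Omega>"
  shows "sqint (wpd \<Omega> i (\<lambda>x. c * f x + d * g x)) = sqint (\<lambda>x. c * wpd \<Omega> i f x + d * wpd \<Omega> i g x)"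
  by (intro sqint_AE_cong wpd_lincomb assms L2D(1) H1D(3) H1_lincomb L2_lincomb)

lemma sqint_wpd_diff:
  assumes "f \<in> H1 \<Omega>" "g \<in> H1 \<Omega>"
  shows "sqint (wpd \<Omega> i (\<lambda>x. f x - g x)) = sqint (\<lambda>x. wpd \<Omega> i f x - wpd \<Omega> i g x)"
  using sqint_wpd_lincomb[OF assms, of i 1 "-1"] by simp

lemma norm_wgrad_sq: "(norm (wgrad \<Omega> f x))\<^sup>2 = (\<Sum>i\<in>UNIV. (wpd \<Omega> i f x)\<^sup>2)"
  by (simp add: wgrad_def norm_vec_def L2_set_def real_sqrt_pow2 sum_nonneg)

lemma integral_norm_wgrad_sq:
  assumes "f \<in> H1 \<Omega>" shows "(LINT x|M. (norm (wgrad \<Omega> f x))\<^sup>2) = gradsq f"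
  unfolding norm_wgrad_sq gradsq_def sqint_def
  by (intro Bochner_Integration.integral_sum L2D H1D assms)

lemma Lnorm_wgrad: "f \<in> H1 \<Omega> \<Longrightarrow> (Lnorm \<Omega> 2 (wgrad \<Omega> f))\<^sup>2 = gradsq f"
  by (simp add: Lnorm_2_sq integral_norm_wgrad_sq)

lemma H1norm_sq: "f \<in> H1 \<Omega> \<Longrightarrow> (H1norm \<Omega> f)\<^sup>2 = sqint f + gradsq f"
  by (simp add: H1norm_def Lnorm_wgrad Lnorm_2_sqint)

lemma H1norm_nonneg: "H1norm \<Omega> f \<ge> 0"
  by (simp add: H1norm_def)

lemma cc_fun_L2: "cc_fun S f \<Longrightarrow> f \<in> L2 \<Omega>"
proof -
  assume f: "cc_fun S f"
  then obtain C where C: "C > 0" "\<And>x. \<bar>f x\<bar> \<le> C" using cc_fun_bounded by blast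
  have m: "f \<in> borel_measurable M"
    by (intro measurable_lebesgue_on_borel cc_fun_measurable[OF f])
  have "integrable M (\<lambda>x. (f x)\<^sup>2)"
    by (rule dom.integrable_const_bound[of _ "C\<^sup>2"])
      (use C m in \<open>auto simp: abs_le_square_iff[symmetric] intro: order_trans[OF C(2)]\<close>)
  with m show ?thesis by (simp add: L2_def)
qed

lemma
  assumes "\<phi> \<in> test_functions \<Omega>"
  shows test_L2: "\<phi> \<in> L2 \<Omega>" and test_H1: "\<phi> \<in> H1 \<Omega>"
    and wpd_test: "AE x in M. wpd \<Omega> i \<phi> x = pd i \<phi> x"
proof -
  show "\<phi> \<in> L2 \<Omega>" using assms by (intro cc_fun_L2 test_functions_cc)
  then show "\<phi> \<in> H1 \<Omega>"
    using assms by (intro H1I[OF _ _ is_weak_pd_test[OF open_dom assms]]) (auto intro: cc_fun_L2 test_functions_cc test_functions_pd)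
  show "AE x in M. wpd \<Omega> i \<phi> x = pd i \<phi> x"
    by (rule wpd_AE_eq[OF open_dom is_weak_pd_test[OF open_dom assms]])
qed

lemma H01_H1: "f \<in> H01 \<Omega> \<Longrightarrow> f \<in> H1 \<Omega>"
  by (simp add: H01_def H1_closure_def)

lemma sqint_pd_diff_wpd:
  assumes "f \<in> H1 \<Omega>" "\<phi> \<in> test_functions \<Omega>"
  shows "sqint (wpd \<Omega> i (\<lambda>x. f x - \<phi> x)) = sqint (\<lambda>x. pd i \<phi> x - wpd \<Omega> i f x)"
proof -
  have "sqint (wpd \<Omega> i (\<lambda>x. f x - \<phi> x)) = sqint (\<lambda>x. wpd \<Omega> i f x - wpd \<Omega> i \<phi> x)"
    by (intro sqint_wpd_diff assms test_H1)
  also have "\<dots> = sqint (\<lambda>x. wpd \<Omega> i f x - pd i \<phi> x)"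
  proof (rule sqint_AE_cong)
    show "AE x in M. wpd \<Omega> i f x - wpd \<Omega> i \<phi> x = wpd \<Omega> i f x - pd i \<phi> x"
      using wpd_test[OF assms(2), of i] by eventually_elim simp
  qed (intro L2D(1) L2_diff H1D(3) assms test_H1 test_L2 test_functions_pd)+
  also have "\<dots> = sqint (\<lambda>x. pd i \<phi> x - wpd \<Omega> i f x)"
    unfolding sqint_def by (simp add: power2_commute)
  finally show ?thesis .
qed

text \<open>Convergence in the H1 norm, with the classical derivatives of the test functions in
  place of their chosen weak ones.\<close>

definition approx_seq :: "(real ^ 3 \<Rightarrow> real) \<Rightarrow> (nat \<Rightarrow> real ^ 3 \<Rightarrow> real) \<Rightarrow> bool" where
  "approx_seq f \<phi> \<longleftrightarrow> (\<forall>n. \<phi> n \<in> test_functions \<Omega>) \<and>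
     (\<lambda>n. sqint (\<lambda>x. \<phi> n x - f x)) \<longlonglongrightarrow> 0 \<and>
     (\<forall>i. (\<lambda>n. sqint (\<lambda>x. pd i (\<phi> n) x - wpd \<Omega> i f x)) \<longlonglongrightarrow> 0)"

lemma approx_seqD:
  assumes "approx_seq f \<phi>"
  shows "\<phi> n \<in> test_functions \<Omega>" "(\<lambda>n. sqint (\<lambda>x. \<phi> n x - f x)) \<longlonglongrightarrow> 0"
    "(\<lambda>n. sqint (\<lambda>x. pd i (\<phi> n) x - wpd \<Omega> i f x)) \<longlonglongrightarrow> 0"
  using assms by (auto simp: approx_seq_def)

lemma H01_approx:
  assumes "f \<in> H01 \<Omega>"
  obtains \<phi> where "approx_seq f \<phi>"
proof -
  note fH = H01_H1[OF assms]
  have "\<exists>\<phi>\<in>test_functions \<Omega>. H1norm \<Omega> (\<lambda>x. f x - \<phi> x) < inverse (real (Suc n))" for n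
    using assms unfolding H01_def H1_closure_def by (auto simp del: of_nat_Suc inverse_Suc)
  then obtain \<phi> where p: "\<And>n. \<phi> n \<in> test_functions \<Omega>"
    "\<And>n. H1norm \<Omega> (\<lambda>x. f x - \<phi> n x) < inverse (real (Suc n))" by metis
  have H: "(\<lambda>x. f x - \<phi> n x) \<in> H1 \<Omega>" for n by (intro H1_diff fH test_H1 p)
  have b: "sqint (\<lambda>x. f x - \<phi> n x) + gradsq (\<lambda>x. f x - \<phi> n x) \<le> (inverse (real (Suc n)))\<^sup>2" for n
    unfolding H1norm_sq[OF H, symmetric]
    using p(2)[of n] H1norm_nonneg by (intro power_mono) (auto simp del: inverse_Suc)
  have "(\<lambda>n. (inverse (real (Suc n)))\<^sup>2) \<longlonglongrightarrow> 0\<^sup>2"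
    by (intro tendsto_power LIMSEQ_inverse_real_of_nat)
  then have z: "(\<lambda>n. (inverse (real (Suc n)))\<^sup>2) \<longlonglongrightarrow> 0" by (simp del: inverse_Suc)
  have "approx_seq f \<phi>"
    unfolding approx_seq_def
  proof (intro conjI allI p(1))
    show "(\<lambda>n. sqint (\<lambda>x. \<phi> n x - f x)) \<longlonglongrightarrow> 0"
    proof (rule Lim_null_comparison[OF _ z], rule always_eventually, rule allI)
      fix n
      have "sqint (\<lambda>x. \<phi> n x - f x) = sqint (\<lambda>x. f x - \<phi> n x)"
        unfolding sqint_def by (simp add: power2_commute)
      also have "\<dots> \<le> (inverse (real (Suc n)))\<^sup>2"
        using b[of n] gradsq_nonneg[of "\<lambda>x. f x - \<phi> n x"] by linarith
      finally show "norm (sqint (\<lambda>x. \<phi> n x - f x)) \<le> (inverse (real (Suc n)))\<^sup>2" by simp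
    qed
    show "(\<lambda>n. sqint (\<lambda>x. pd i (\<phi> n) x - wpd \<Omega> i f x)) \<longlonglongrightarrow> 0" for i
    proof (rule Lim_null_comparison[OF _ z], rule always_eventually, rule allI)
      fix n
      have "sqint (\<lambda>x. pd i (\<phi> n) x - wpd \<Omega> i f x) = sqint (wpd \<Omega> i (\<lambda>x. f x - \<phi> n x))"
        by (rule sqint_pd_diff_wpd[OF fH p(1), symmetric])
      also have "\<dots> \<le> (inverse (real (Suc n)))\<^sup>2"
        using b[of n] sqint_wpd_le[of i "\<lambda>x. f x - \<phi> n x"] sqint_nonneg[of "\<lambda>x. f x - \<phi> n x"] by linarith
      finally show "norm (sqint (\<lambda>x. pd i (\<phi> n) x - wpd \<Omega> i f x)) \<le> (inverse (real (Suc n)))\<^sup>2" by simp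
    qed
  qed
  then show ?thesis by (rule that)
qed

lemma test_functions_lincomb:
  assumes "\<phi> \<in> test_functions \<Omega>" "\<psi> \<in> test_functions \<Omega>"
  shows "(\<lambda>x. c * \<phi> x + d * \<psi> x) \<in> test_functions \<Omega>"
  using test_functions_add[OF test_functions_mult[OF assms(1) Cinf_on_const[of UNIV c]]
      test_functions_mult[OF assms(2) Cinf_on_const[of UNIV d]]] by (simp add: mult.commute)

lemma H1norm_lincomb_le:
  assumes "f \<in> H1 \<Omega>" "g \<in> H1 \<Omega>"
  shows "(H1norm \<Omega> (\<lambda>x. c * f x + d * g x))\<^sup>2 \<le> 2 * c\<^sup>2 * (H1norm \<Omega> f)\<^sup>2 + 2 * d\<^sup>2 * (H1norm \<Omega> g)\<^sup>2"
proof -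
  have "gradsq (\<lambda>x. c * f x + d * g x)
    \<le> (\<Sum>i\<in>UNIV. 2 * c\<^sup>2 * sqint (wpd \<Omega> i f) + 2 * d\<^sup>2 * sqint (wpd \<Omega> i g))"
    unfolding gradsq_def sqint_wpd_lincomb[OF assms]
    by (intro sum_mono sqint_lincomb_le H1D assms)
  also have "\<dots> = 2 * c\<^sup>2 * gradsq f + 2 * d\<^sup>2 * gradsq g"
    by (simp add: gradsq_def sum.distrib sum_distrib_left)
  finally show ?thesis
    using sqint_lincomb_le[OF assms[THEN H1D(1)], of c d]
    unfolding H1norm_sq[OF assms(1)] H1norm_sq[OF assms(2)] H1norm_sq[OF H1_lincomb[OF assms]]
    by (simp add: algebra_simps)
qed

lemma H01_lincomb:
  assumes "f \<in> H01 \<Omega>" "g \<in> H01 \<Omega>" shows "(\<lambda>x. c * f x + d * g x) \<in> H01 \<Omega>"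
  unfolding H01_def H1_closure_def
proof (intro CollectI conjI H1_lincomb H01_H1 assms allI impI)
  fix e :: real assume e: "e > 0"
  \<comment> \<open>The summand 1 keeps C positive and makes the final estimate strict; r is the
    solution of C r^2 = e^2.\<close>
  define C where "C = 2 * c\<^sup>2 + 2 * d\<^sup>2 + 1"
  have C: "C > 0" by (simp add: C_def add_nonneg_pos)
  define r where "r = e / sqrt C"
  have r: "r > 0" "C * r\<^sup>2 = e\<^sup>2" using e C by (simp_all add: r_def power_divide)
  obtain \<phi> \<psi> where p: "\<phi> \<in> test_functions \<Omega>" "H1norm \<Omega> (\<lambda>x. f x - \<phi> x) < r"
    and q: "\<psi> \<in> test_functions \<Omega>" "H1norm \<Omega> (\<lambda>x. g x - \<psi> x) < r"
    using assms r(1) unfolding H01_def H1_closure_def by blast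
  have H: "(\<lambda>x. f x - \<phi> x) \<in> H1 \<Omega>" "(\<lambda>x. g x - \<psi> x) \<in> H1 \<Omega>"
    by (intro H1_diff H01_H1 assms test_H1 p q)+
  have "(H1norm \<Omega> (\<lambda>x. c * (f x - \<phi> x) + d * (g x - \<psi> x)))\<^sup>2
      \<le> 2 * c\<^sup>2 * (H1norm \<Omega> (\<lambda>x. f x - \<phi> x))\<^sup>2 + 2 * d\<^sup>2 * (H1norm \<Omega> (\<lambda>x. g x - \<psi> x))\<^sup>2"
    by (rule H1norm_lincomb_le[OF H])
  also have "\<dots> \<le> 2 * c\<^sup>2 * r\<^sup>2 + 2 * d\<^sup>2 * r\<^sup>2"
    using p(2) q(2) H1norm_nonneg by (intro add_mono mult_left_mono power_mono) auto
  also have "\<dots> < C * r\<^sup>2" using r(1) by (simp add: C_def algebra_simps)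
  finally have "H1norm \<Omega> (\<lambda>x. c * (f x - \<phi> x) + d * (g x - \<psi> x)) < e"
    unfolding r(2) using e by (simp add: power2_less_imp_less)
  moreover have "(\<lambda>x. c * (f x - \<phi> x) + d * (g x - \<psi> x)) = (\<lambda>x. c * f x + d * g x - (c * \<phi> x + d * \<psi> x))"
    by (simp add: fun_eq_iff algebra_simps)
  ultimately show "\<exists>h\<in>test_functions \<Omega>. H1norm \<Omega> (\<lambda>x. c * f x + d * g x - h x) < e"
    using test_functions_lincomb[OF p(1) q(1)] by (intro bexI[of _ "\<lambda>x. c * \<phi> x + d * \<psi> x"]) simp_all
qed

section \<open>The Sobolev inequality on H01\<close>

text \<open>The inequality for test functions passes to an almost everywhere convergent subsequence
  by Fatou's lemma, which yields the integrability of f^6 along with the bound. The three derivative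
  integrals on the right converge and are each at most \<open>gradsq f\<close>.\<close>

theorem sobolev_6:
  assumes "f \<in> H01 \<Omega>"
  shows "integrable M (\<lambda>x. f x ^ 6)" "(LINT x|M. f x ^ 6) \<le> 4096 * gradsq f ^ 3"
proof -
  obtain \<phi> where "approx_seq f \<phi>" using H01_approx[OF assms] .
  note p = approx_seqD[OF this]
  note fH = H01_H1[OF assms]
  have pL: "\<phi> n \<in> L2 \<Omega>" "pd i (\<phi> n) \<in> L2 \<Omega>" for n i by (intro test_L2 test_functions_pd p)+
  obtain r where r: "strict_mono r" "AE x in M. (\<lambda>n. \<phi> (r n) x) \<longlonglongrightarrow> f x"
    using L2_AE_subseq[OF pL(1) H1D(1)[OF fH] p(2)] .
  define B where "B n = 4096 * (\<Prod>i\<in>UNIV. sqint (pd i (\<phi> n)))" for n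
  have lim: "B \<longlonglongrightarrow> 4096 * (\<Prod>i\<in>UNIV. sqint (wpd \<Omega> i f))"
    unfolding B_def
    by (intro tendsto_intros L2_tendsto_sqint p always_eventually allI pL H1D fH)
  have bd: "(\<integral>\<^sup>+ x. ennreal (\<phi> n x ^ 6) \<partial>M) \<le> ennreal (B n)" for n
  proof -
    have c6: "cc_fun \<Omega> (\<lambda>x. \<phi> n x ^ 6)" and c2: "cc_fun \<Omega> (\<lambda>x. (pd i (\<phi> n) x)\<^sup>2)" for i
      by (intro cc_fun_compose[of _ _ "\<lambda>x. x ^ 6"] cc_fun_compose[of _ _ "\<lambda>x. x\<^sup>2"] test_functions_cc test_functions_pd p continuous_intros; simp)+
    have out: "g x = 0" if "cc_fun \<Omega> g" "x \<notin> \<Omega>" for g :: "real ^ 3 \<Rightarrow> real" and x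
      using that by (auto simp: cc_fun_def)
    have s6: "(LINT x|M. \<phi> n x ^ 6) = (LINT x|lborel. \<phi> n x ^ 6)"
      by (rule lebesgue_on_integral_support[OF open_dom out[OF c6] cc_fun_measurable[OF c6]])
    have s2: "sqint (pd i (\<phi> n)) = (LINT x|lborel. (pd i (\<phi> n) x)\<^sup>2)" for i
      unfolding sqint_def by (rule lebesgue_on_integral_support[OF open_dom out[OF c2] cc_fun_measurable[OF c2]])
    have "\<phi> n \<in> test_functions UNIV" using p(1)[of n] by (auto simp: test_functions_def)
    from gagliardo_nirenberg_sobolev[OF this] have "(LINT x|M. \<phi> n x ^ 6) \<le> B n"
      by (simp add: s6 s2 B_def)
    moreover have "integrable M (\<lambda>x. \<phi> n x ^ 6)"
      using L2_integrable[OF cc_fun_L2[OF c6]] .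
    ultimately show ?thesis by (subst nn_integral_eq_integral) (auto intro: ennreal_leI)
  qed
  have mf: "f \<in> borel_measurable M" by (intro L2D H1D fH)
  have mp: "\<phi> n \<in> borel_measurable M" for n by (intro L2D pL)
  have "(\<integral>\<^sup>+ x. ennreal (f x ^ 6) \<partial>M) = (\<integral>\<^sup>+ x. liminf (\<lambda>n. ennreal (\<phi> (r n) x ^ 6)) \<partial>M)"
  proof (rule nn_integral_cong_AE)
    show "AE x in M. ennreal (f x ^ 6) = liminf (\<lambda>n. ennreal (\<phi> (r n) x ^ 6))"
      using r(2)
    proof eventually_elim
      case (elim x)
      then have "(\<lambda>n. ennreal (\<phi> (r n) x ^ 6)) \<longlonglongrightarrow> ennreal (f x ^ 6)"
        by (intro tendsto_ennrealI tendsto_power)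
      then show ?case by (intro lim_imp_Liminf[symmetric]) auto
    qed
  qed
  also have "\<dots> \<le> liminf (\<lambda>n. \<integral>\<^sup>+ x. ennreal (\<phi> (r n) x ^ 6) \<partial>M)"
    using mp by (intro nn_integral_liminf) simp
  also have "\<dots> \<le> liminf (\<lambda>n. ennreal (B (r n)))"
    by (intro Liminf_mono always_eventually allI bd)
  also have "\<dots> = ennreal (4096 * (\<Prod>i\<in>UNIV. sqint (wpd \<Omega> i f)))"
    using LIMSEQ_subseq_LIMSEQ[OF lim r(1)]
    by (intro lim_imp_Liminf tendsto_ennrealI) (auto simp: o_def)
  also have "\<dots> \<le> ennreal (4096 * gradsq f ^ 3)"
  proof -
    have "(\<Prod>i\<in>(UNIV::3 set). sqint (wpd \<Omega> i f)) \<le> (\<Prod>i\<in>(UNIV::3 set). gradsq f)"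
      by (intro prod_mono conjI sqint_wpd_le) simp
    then show ?thesis by (intro ennreal_leI) simp
  qed
  finally have le: "(\<integral>\<^sup>+ x. ennreal (f x ^ 6) \<partial>M) \<le> ennreal (4096 * gradsq f ^ 3)" .
  show int: "integrable M (\<lambda>x. f x ^ 6)"
  proof (rule integrableI_nonneg)
    show "(\<lambda>x. f x ^ 6) \<in> borel_measurable M" using mf by simp
    show "(\<integral>\<^sup>+ x. ennreal (f x ^ 6) \<partial>M) < \<infinity>"
      using le by (rule le_less_trans) simp
  qed simp
  have "(\<integral>\<^sup>+ x. ennreal (f x ^ 6) \<partial>M) = ennreal (LINT x|M. f x ^ 6)"
    by (rule nn_integral_eq_integral[OF int]) simp
  with le show "(LINT x|M. f x ^ 6) \<le> 4096 * gradsq f ^ 3"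
    by (simp add: ennreal_le_iff)
qed

text \<open>Splitting at \<open>\<bar>f\<bar> = s\<close> instead of interpolating between Lebesgue spaces gives the bound with the
  right homogeneity in \<open>s\<close>.\<close>

definition sobconst :: real where
  "sobconst = measure M \<Omega> + 4096"

lemma sobconst_pos: "sobconst > 0"
  unfolding sobconst_def by (simp add: add_nonneg_pos)

lemma powr_split_6:
  fixes y s q :: real assumes "s > 0" "0 \<le> q" "q \<le> 6"
  shows "\<bar>y\<bar> powr q \<le> s powr q + s powr (q - 6) * y ^ 6"
proof (cases "\<bar>y\<bar> \<le> s")
  case True
  then have "\<bar>y\<bar> powr q \<le> s powr q" using assms by (intro powr_mono2) auto
  then show ?thesis by (simp add: add_increasing2)
next
  case False
  have "\<bar>y\<bar> powr q = \<bar>y\<bar> powr (q - 6 + 6)" by simp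
  also have "\<dots> = \<bar>y\<bar> powr (q - 6) * \<bar>y\<bar> powr 6" by (rule powr_add)
  also have "\<bar>y\<bar> powr 6 = y ^ 6" using False assms by (simp add: powr_numeral power_even_abs)
  also have "\<bar>y\<bar> powr (q - 6) * y ^ 6 \<le> s powr (q - 6) * y ^ 6"
    using False assms by (intro mult_right_mono powr_mono2') auto
  finally show ?thesis by (simp add: add_increasing)
qed

text \<open>The parameter s stands for the gradient norm or a bound of it. In
  \<open>sobconst\<close> the measure of \<Omega> accounts for the part where |f| \<le> s and 4096
  for the rest, where |f|^q is at most s^(q-6) f^6.\<close>

theorem sobolev_powr:
  assumes f: "f \<in> H01 \<Omega>" and q: "0 \<le> q" "q \<le> 6"
  shows "integrable M (\<lambda>x. \<bar>f x\<bar> powr q)"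
    and "s > 0 \<Longrightarrow> gradsq f \<le> s\<^sup>2 \<Longrightarrow> (LINT x|M. \<bar>f x\<bar> powr q) \<le> sobconst * s powr q"
proof -
  have m: "(\<lambda>x. \<bar>f x\<bar> powr q) \<in> borel_measurable M"
    using L2D(1)[OF H1D(1)[OF H01_H1[OF f]]] by simp
  have i: "integrable M (\<lambda>x. s powr q + s powr (q - 6) * f x ^ 6)" for s
    by (intro Bochner_Integration.integrable_add integrable_mult_right sobolev_6(1)[OF f]) simp
  show int: "integrable M (\<lambda>x. \<bar>f x\<bar> powr q)"
    by (rule Bochner_Integration.integrable_bound[OF i[of 1] m])
      (use powr_split_6[of 1 q] q in \<open>auto\<close>)
  assume s: "s > 0" "gradsq f \<le> s\<^sup>2"
  have "(LINT x|M. \<bar>f x\<bar> powr q) \<le> (LINT x|M. s powr q + s powr (q - 6) * f x ^ 6)"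
    by (intro integral_mono int i powr_split_6 s q)
  also have "\<dots> = measure M \<Omega> * s powr q + s powr (q - 6) * (LINT x|M. f x ^ 6)"
    using sobolev_6(1)[OF f] by simp
  also have "\<dots> \<le> measure M \<Omega> * s powr q + s powr (q - 6) * (4096 * (s\<^sup>2) ^ 3)"
    using sobolev_6(2)[OF f] power_mono[OF s(2), of 3]
    by (intro add_left_mono mult_left_mono) auto
  also have "s powr (q - 6) * (4096 * (s\<^sup>2) ^ 3) = 4096 * s powr q"
  proof -
    have "(s\<^sup>2) ^ 3 = s powr 6" using s(1) by (simp add: powr_numeral flip: power_mult)
    then show ?thesis by (simp flip: powr_add)
  qed
  finally show "(LINT x|M. \<bar>f x\<bar> powr q) \<le> sobconst * s powr q"
    by (simp add: sobconst_def algebra_simps)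
qed

end

section \<open>The principal eigenvalue bounds the Rayleigh quotient\<close>

text \<open>\<open>softinv n\<close> is a smooth bounded substitute for \<open>1 / s\<close>: since \<open>softplus n\<close> has the logistic
  derivative \<open>logis n\<close>, \<open>G = softinv n\<close> satisfies \<open>G' = - logis n * G\<^sup>2\<close> on the whole line, and
  \<open>logis n \<ge> n / (1 + n)\<close> for \<open>s \<ge> 0\<close>.\<close>

definition logis :: "real \<Rightarrow> real \<Rightarrow> real" where
  "logis n s = n * exp (n * s) / (1 + n * exp (n * s))"

text \<open>The summand 1/n keeps \<open>softplus n\<close> at least 1/n and hence
  \<open>softinv n\<close> at most n. The factor n inside the logarithm drives the slope to 1
  uniformly on s \<ge> 0 and costs only ln n / n in the distance to s.\<close>

definition softplus :: "real \<Rightarrow> real \<Rightarrow> real" where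
  "softplus n s = 1 / n + ln (1 + n * exp (n * s)) / n"

definition softinv :: "real \<Rightarrow> real \<Rightarrow> real" where
  "softinv n s = inverse (softplus n s)"

lemma logis_bounds: "n > 0 \<Longrightarrow> 0 < logis n s" "n > 0 \<Longrightarrow> logis n s < 1"
  by (auto simp: logis_def add_pos_pos divide_simps)

lemma logis_ge:
  assumes "n > 0" "s \<ge> 0" shows "logis n s \<ge> n / (1 + n)"
proof -
  have "n \<le> n * exp (n * s)" using assms by simp
  then show ?thesis using assms unfolding logis_def
    by (simp add: divide_simps add_pos_pos) (simp add: algebra_simps)
qed

text \<open>The derivative is a polynomial in \<open>logis n\<close> itself, so the induction for
  smoothness closes. It is written with \<open>1 + - 1 * logis n s\<close> so that
  \<open>Dk_add\<close>, \<open>Dk_mult\<close> and \<open>Dk_const\<close> match it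
  literally.\<close>

lemma logis_deriv:
  assumes "n > 0" shows "(logis n has_real_derivative n * (logis n s * (1 + - 1 * logis n s))) (at s)"
proof -
  have p: "1 + n * exp (n * s) > 0" using assms by (simp add: add_pos_pos)
  have "(logis n has_real_derivative
      (n * (n * exp (n * s)) * (1 + n * exp (n * s)) - n * exp (n * s) * (n * (n * exp (n * s))))
        / (1 + n * exp (n * s))\<^sup>2) (at s)"
    unfolding logis_def using p
    by (auto intro!: derivative_eq_intros simp: power2_eq_square)
  moreover have "(n * (n * exp (n * s)) * (1 + n * exp (n * s)) - n * exp (n * s) * (n * (n * exp (n * s))))
        / (1 + n * exp (n * s))\<^sup>2 = n * (logis n s * (1 + - 1 * logis n s))"
    using p by (simp add: logis_def field_simps power2_eq_square)
  ultimately show ?thesis by simp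
qed

lemma Dk_logis:
  assumes "n > 0" shows "Dk k (logis n)"
proof (induction k)
  case 0
  then show ?case using logis_deriv[OF assms]
    by (auto intro!: continuous_at_imp_continuous_on intro: DERIV_isCont)
next
  case (Suc k)
  show ?case
    by (rule Dk_SucI[OF logis_deriv[OF assms]]) (intro Dk_mult Dk_add Dk_const Suc)
qed

lemma softplus_ge: "n > 0 \<Longrightarrow> softplus n s \<ge> 1 / n"
  by (simp add: softplus_def)

text \<open>For s > 0 this says s * \<open>softinv n s\<close> \<le> 1, the domination used when n
  tends to infinity in \<open>rayleigh_test\<close>.\<close>

lemma softplus_ge_self:
  assumes "n \<ge> 1" shows "softplus n s \<ge> s"
proof -
  have "exp (n * s) \<le> n * exp (n * s)" using assms by simp
  then have "exp (n * s) \<le> 1 + n * exp (n * s)" by linarith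
  then have "ln (exp (n * s)) \<le> ln (1 + n * exp (n * s))"
    by (subst ln_le_cancel_iff) (use assms in \<open>auto simp: add_pos_pos\<close>)
  then have "s \<le> ln (1 + n * exp (n * s)) / n" using assms by (simp add: field_simps)
  moreover have "1 / n > 0" using assms by simp
  ultimately show ?thesis unfolding softplus_def by linarith
qed

lemma softplus_le:
  assumes "n \<ge> 1" "s \<ge> 0" shows "softplus n s \<le> 1 / n + ln 2 / n + ln n / n + s"
proof -
  have "1 \<le> n * exp (n * s)" using assms by (simp add: mult_ge1_I)
  then have "1 + n * exp (n * s) \<le> 2 * n * exp (n * s)" by linarith
  then have "ln (1 + n * exp (n * s)) \<le> ln (2 * n * exp (n * s))"
    by (subst ln_le_cancel_iff) (use assms in \<open>auto simp: add_pos_pos\<close>)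
  also have "\<dots> = ln 2 + ln n + n * s" using assms by (simp add: ln_mult)
  finally have "ln (1 + n * exp (n * s)) / n \<le> (ln 2 + ln n + n * s) / n"
    using assms by (intro divide_right_mono) auto
  also have "\<dots> = ln 2 / n + ln n / n + s" using assms by (simp add: add_divide_distrib)
  finally show ?thesis by (simp add: softplus_def)
qed

lemma softplus_tendsto:
  assumes "s \<ge> 0" shows "(\<lambda>n. softplus (real (Suc n)) s) \<longlonglongrightarrow> s"
proof (rule tendsto_sandwich)
  show "\<forall>\<^sub>F n in sequentially. s \<le> softplus (real (Suc n)) s"
    by (intro always_eventually allI softplus_ge_self) simp
  show "\<forall>\<^sub>F n in sequentially. softplus (real (Suc n)) s \<le>
      1 / real (Suc n) + ln 2 / real (Suc n) + ln (real (Suc n)) / real (Suc n) + s"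
    by (intro always_eventually allI softplus_le assms) simp
  have "(\<lambda>n. 1 / real n + ln 2 / real n + ln (real n) / real n + s) \<longlonglongrightarrow> 0 + 0 + 0 + s"
    by (intro tendsto_intros lim_ln_over_n lim_const_over_n)
  from LIMSEQ_Suc[OF this]
  show "(\<lambda>n. 1 / real (Suc n) + ln 2 / real (Suc n) + ln (real (Suc n)) / real (Suc n) + s) \<longlonglongrightarrow> s" by simp
qed simp

lemma softplus_deriv:
  assumes "n > 0" shows "(softplus n has_real_derivative logis n s) (at s)"
proof -
  have p: "1 + n * exp (n * s) > 0" using assms by (simp add: add_pos_pos)
  have d1: "((\<lambda>s. 1 + n * exp (n * s)) has_real_derivative n * (n * exp (n * s))) (at s)"
    by (auto intro!: derivative_eq_intros)
  have "(softplus n has_real_derivative 0 + (1 / (1 + n * exp (n * s)) * (n * (n * exp (n * s)))) / n) (at s)"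
    unfolding softplus_def[abs_def]
    by (intro DERIV_add DERIV_const DERIV_cdivide DERIV_chain2[OF DERIV_ln_divide[OF p] d1])
  then show ?thesis using assms by (simp add: logis_def)
qed

lemma softinv_deriv:
  assumes "n > 0" shows "(softinv n has_real_derivative (- 1 * logis n s) * (softinv n s * softinv n s)) (at s)"
proof -
  have "softplus n s \<noteq> 0" using softplus_ge[OF assms, of s] assms
    by (metis divide_pos_pos less_le_not_le zero_less_one)
  from DERIV_inverse'[OF softplus_deriv[OF assms] this]
  show ?thesis unfolding softinv_def[abs_def] by (simp add: mult.commute mult.left_commute)
qed

lemma Dk_softinv:
  assumes "n > 0" shows "Dk k (softinv n)"
proof (induction k)
  case 0
  then show ?case using softinv_deriv[OF assms]
    by (auto intro!: continuous_at_imp_continuous_on intro: DERIV_isCont)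
next
  case (Suc k)
  show ?case
    by (rule Dk_SucI[OF softinv_deriv[OF assms]]) (intro Dk_mult Dk_const Dk_logis assms Suc)
qed

lemma softinv_bounds:
  assumes "n > 0" shows "0 < softinv n s" "softinv n s \<le> n"
proof -
  have "1 / n > 0" using assms by simp
  then have p: "softplus n s > 0" using softplus_ge[OF assms, of s] by linarith
  then show "0 < softinv n s" by (simp add: softinv_def)
  have "inverse (softplus n s) \<le> inverse (1 / n)"
    using softplus_ge[OF assms, of s] \<open>1 / n > 0\<close> by (rule le_imp_inverse_le)
  then show "softinv n s \<le> n" by (simp add: softinv_def)
qed

context bounded_domain
begin

section \<open>Products with bounded factors, and their limits\<close>

lemma integrable_mult_bounded:
  assumes "integrable M h" "b \<in> borel_measurable M" "AE x in M. \<bar>b x\<bar> \<le> C"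
  shows "integrable M (\<lambda>x. h x * b x :: real)"
proof (rule Bochner_Integration.integrable_bound[where f = "\<lambda>x. C * h x"])
  show "AE x in M. norm (h x * b x) \<le> norm (C * h x)"
    using assms(3)
  proof eventually_elim
    case (elim x)
    then have "\<bar>b x\<bar> * \<bar>h x\<bar> \<le> \<bar>C\<bar> * \<bar>h x\<bar>" by (intro mult_right_mono) auto
    then show ?case by (simp add: abs_mult mult.commute)
  qed
qed (use assms in \<open>auto intro!: borel_measurable_times\<close>)

lemma tendsto_integral_bounded:
  assumes h: "integrable M h" and b: "\<And>k::nat. b k \<in> borel_measurable M" "b0 \<in> borel_measurable M"
    and C: "\<And>k. AE x in M. \<bar>b k x\<bar> \<le> C" and lim: "AE x in M. (\<lambda>k. b k x) \<longlonglongrightarrow> b0 x"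
  shows "(\<lambda>k. LINT x|M. h x * b k x) \<longlonglongrightarrow> (LINT x|M. h x * b0 x :: real)"
proof (rule integral_dominated_convergence[where w = "\<lambda>x. \<bar>C * h x\<bar>"])
  show "integrable M (\<lambda>x. \<bar>C * h x\<bar>)" using h by simp
  show "AE x in M. (\<lambda>k. h x * b k x) \<longlonglongrightarrow> h x * b0 x"
    using lim by eventually_elim (intro tendsto_mult tendsto_const)
  show "AE x in M. norm (h x * b k x) \<le> \<bar>C * h x\<bar>" for k
    using C[of k]
  proof eventually_elim
    case (elim x)
    then have "\<bar>b k x\<bar> * \<bar>h x\<bar> \<le> \<bar>C\<bar> * \<bar>h x\<bar>" by (intro mult_right_mono) auto
    then show ?case by (simp add: abs_mult mult.commute)
  qed
qed (use h b in \<open>auto intro!: borel_measurable_times\<close>)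

lemma L2_mult_bounded:
  assumes "h \<in> L2 \<Omega>" "b \<in> borel_measurable M" "\<And>x. \<bar>b x\<bar> \<le> C"
  shows "(\<lambda>x. h x * b x) \<in> L2 \<Omega>" "sqint (\<lambda>x. h x * b x) \<le> C\<^sup>2 * sqint h"
proof -
  have b2: "(b x)\<^sup>2 \<le> C\<^sup>2" for x using assms(3)[of x] by (simp add: abs_le_square_iff[symmetric])
  have i: "integrable M (\<lambda>x. (h x)\<^sup>2 * (b x)\<^sup>2)"
    using b2 by (intro integrable_mult_bounded[OF L2D(2)[OF assms(1)] borel_measurable_power[OF assms(2)], where C = "C\<^sup>2"]) auto
  then show "(\<lambda>x. h x * b x) \<in> L2 \<Omega>"
    using assms L2D(1)[OF assms(1)] by (simp add: L2_def power_mult_distrib)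
  have "sqint (\<lambda>x. h x * b x) \<le> (LINT x|M. C\<^sup>2 * (h x)\<^sup>2)"
    unfolding sqint_def power_mult_distrib
  proof (rule integral_mono[OF i])
    show "integrable M (\<lambda>x. C\<^sup>2 * (h x)\<^sup>2)" using L2D(2)[OF assms(1)] by simp
    show "(h x)\<^sup>2 * (b x)\<^sup>2 \<le> C\<^sup>2 * (h x)\<^sup>2" for x
      using mult_right_mono[OF b2[of x] zero_le_power2[of "h x"]] by (simp add: mult.commute)
  qed
  then show "sqint (\<lambda>x. h x * b x) \<le> C\<^sup>2 * sqint h" by (simp add: sqint_def)
qed

text \<open>Replacing \<open>d k\<close> by its L2 limit h costs an error controlled by
  Cauchy-Schwarz, because the factors \<open>b k\<close> are uniformly bounded. What remains is
  dominated convergence for h^2 \<open>b k\<close>.\<close>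

lemma tendsto_integral_L2_bounded:
  assumes h: "h \<in> L2 \<Omega>" and d: "\<And>k. d k \<in> L2 \<Omega>" "(\<lambda>k. sqint (\<lambda>x. d k x - h x)) \<longlonglongrightarrow> 0"
    and b: "\<And>k::nat. b k \<in> borel_measurable M" "b0 \<in> borel_measurable M"
    and C: "\<And>k x. \<bar>b k x\<bar> \<le> C" and lim: "AE x in M. (\<lambda>k. b k x) \<longlonglongrightarrow> b0 x"
  shows "(\<lambda>k. LINT x|M. h x * (b k x * d k x)) \<longlonglongrightarrow> (LINT x|M. h x * (b0 x * h x) :: real)"
proof -
  have "(\<lambda>k. LINT x|M. (h x * b k x) * (d k x - h x)) \<longlonglongrightarrow> 0"
  proof (rule Lim_null_comparison, rule always_eventually, rule allI)
    fix k
    have "\<bar>LINT x|M. (h x * b k x) * (d k x - h x)\<bar> \<le> sqrt (sqint (\<lambda>x. h x * b k x)) * sqrt (sqint (\<lambda>x. d k x - h x))"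
      by (intro L2_cauchy_schwarz L2_mult_bounded[OF h b(1) C] L2_diff d h)
    also have "\<dots> \<le> sqrt (C\<^sup>2 * sqint h) * sqrt (sqint (\<lambda>x. d k x - h x))"
      by (intro mult_right_mono real_sqrt_le_mono L2_mult_bounded[OF h b(1) C]) auto
    finally show "norm (LINT x|M. (h x * b k x) * (d k x - h x)) \<le> sqrt (C\<^sup>2 * sqint h) * sqrt (sqint (\<lambda>x. d k x - h x))"
      by simp
  next
    have "(\<lambda>k. sqrt (C\<^sup>2 * sqint h) * sqrt (sqint (\<lambda>x. d k x - h x))) \<longlonglongrightarrow> sqrt (C\<^sup>2 * sqint h) * sqrt 0"
      by (intro tendsto_intros d)
    then show "(\<lambda>k. sqrt (C\<^sup>2 * sqint h) * sqrt (sqint (\<lambda>x. d k x - h x))) \<longlonglongrightarrow> 0" by simp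
  qed
  moreover have "(\<lambda>k. LINT x|M. (h x)\<^sup>2 * b k x) \<longlonglongrightarrow> (LINT x|M. (h x)\<^sup>2 * b0 x)"
    using C lim b by (intro tendsto_integral_bounded[where C = C] L2D(2)[OF h]) auto
  ultimately have "(\<lambda>k. (LINT x|M. (h x * b k x) * (d k x - h x)) + (LINT x|M. (h x)\<^sup>2 * b k x))
      \<longlonglongrightarrow> 0 + (LINT x|M. (h x)\<^sup>2 * b0 x)" by (rule tendsto_add)
  moreover have "(LINT x|M. (h x * b k x) * (d k x - h x)) + (LINT x|M. (h x)\<^sup>2 * b k x) = (LINT x|M. h x * (b k x * d k x))" for k
  proof -
    have "integrable M (\<lambda>x. (h x * b k x) * (d k x - h x))"
      by (intro L2_integrable_mult L2_mult_bounded[OF h b(1) C] L2_diff d h)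
    moreover have "integrable M (\<lambda>x. (h x)\<^sup>2 * b k x)"
      using C b by (intro integrable_mult_bounded[where C = C] L2D(2)[OF h]) auto
    ultimately have "(LINT x|M. (h x * b k x) * (d k x - h x)) + (LINT x|M. (h x)\<^sup>2 * b k x)
       = (LINT x|M. (h x * b k x) * (d k x - h x) + (h x)\<^sup>2 * b k x)" by simp
    also have "\<dots> = (LINT x|M. h x * (b k x * d k x))"
      by (simp add: power2_eq_square algebra_simps)
    finally show ?thesis .
  qed
  ultimately show ?thesis by (simp add: power2_eq_square mult_ac)
qed

section \<open>Jacobi's method and the Rayleigh inequality\<close>

lemma integral_inner_wgrad:
  assumes "f \<in> H1 \<Omega>" "g \<in> H1 \<Omega>"
  shows "(LINT x|M. wgrad \<Omega> f x \<bullet> wgrad \<Omega> g x) = (\<Sum>i\<in>UNIV. LINT x|M. wpd \<Omega> i f x * wpd \<Omega> i g x)"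
  unfolding wgrad_def inner_vec_def
  by (simp, intro Bochner_Integration.integral_sum L2_integrable_mult H1D assms)

lemma test_H01:
  assumes "\<phi> \<in> test_functions \<Omega>" shows "\<phi> \<in> H01 \<Omega>"
proof -
  have H: "\<phi> \<in> H1 \<Omega>" by (rule test_H1[OF assms])
  have "sqint (wpd \<Omega> i (\<lambda>x. \<phi> x - \<phi> x)) = 0" for i
    by (subst sqint_wpd_diff[OF H H]) (simp add: sqint_def)
  then have "(H1norm \<Omega> (\<lambda>x. \<phi> x - \<phi> x))\<^sup>2 = 0"
    by (subst H1norm_sq[OF H1_diff[OF H H]]) (simp add: gradsq_def sqint_def)
  then have "H1norm \<Omega> (\<lambda>x. \<phi> x - \<phi> x) < e" if "e > 0" for e using that by simp
  with H assms show ?thesis unfolding H01_def H1_closure_def by blast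
qed

text \<open>The eigenvalue equation is tested with \<open>\<phi>\<^sup>2 G(\<psi>\<^sub>k)\<close>, where the test functions \<open>\<psi>\<^sub>k\<close> approximate
  \<open>\<psi>\<close>; thus no chain rule for weak derivatives is needed. In the limit, completing the square
  absorbs the cross term into \<open>G'\<close>.\<close>

lemma jacobi_test:
  assumes ev: "dirichlet_eigenpair \<Omega> l \<psi>" and pos: "AE x in M. \<psi> x > 0"
    and p: "\<phi> \<in> test_functions \<Omega>" and n: "n > 0"
  shows "l * (LINT x|M. \<psi> x * ((\<phi> x)\<^sup>2 * softinv n (\<psi> x))) \<le> (1 + n) / n * (\<Sum>i\<in>UNIV. sqint (pd i \<phi>))"
proof -
  define G where "G = softinv n"
  define G' where "G' s = (- 1 * logis n s) * (G s * G s)" for s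
  have G: "\<And>s. (G has_real_derivative G' s) (at s)" "\<And>k. Dk k G"
    using softinv_deriv[OF n] Dk_softinv[OF n] by (auto simp: G_def G'_def)
  have Gb: "0 < G s" "G s \<le> n" for s using softinv_bounds[OF n] by (auto simp: G_def)
  have Gb': "\<bar>G' s\<bar> \<le> n * n" for s
  proof -
    have "\<bar>G' s\<bar> = logis n s * (G s * G s)"
      using logis_bounds[OF n, of s] Gb(1)[of s] by (simp add: G'_def abs_mult)
    also have "\<dots> \<le> 1 * (n * n)"
      using logis_bounds[OF n, of s] Gb[of s] by (intro mult_mono) auto
    finally show ?thesis by simp
  qed
  have cG: "continuous_on UNIV G" "continuous_on UNIV G'"
  proof -
    show "continuous_on UNIV G" using G(2)[of 0] by simp
    then show "continuous_on UNIV G'" using Dk_logis[OF n, of 0] unfolding G'_def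
      by (auto intro!: continuous_intros)
  qed
  then have [measurable]: "G \<in> borel_measurable borel" "G' \<in> borel_measurable borel"
    by (auto intro: borel_measurable_continuous_onI)
  have psi: "\<psi> \<in> H01 \<Omega>" using ev by (simp add: dirichlet_eigenpair_def)
  then have psiH: "\<psi> \<in> H1 \<Omega>" by (rule H01_H1)
  obtain \<psi>0 where "approx_seq \<psi> \<psi>0" using H01_approx[OF psi] .
  note a0 = approx_seqD[OF this]
  \<comment> \<open>Convergence almost everywhere is needed to pass to the limit inside G and G';
    the derivatives of the approximations converge in L2 only.\<close>
  obtain r where r: "strict_mono r" "AE x in M. (\<lambda>k. \<psi>0 (r k) x) \<longlonglongrightarrow> \<psi> x"
    using L2_AE_subseq[OF test_L2[OF a0(1)] H1D(1)[OF psiH] a0(2)] .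
  define q where "q k = \<psi>0 (r k)" for k
  have q: "q k \<in> test_functions \<Omega>" "AE x in M. (\<lambda>k. q k x) \<longlonglongrightarrow> \<psi> x"
    "(\<lambda>k. sqint (\<lambda>x. pd i (q k) x - wpd \<Omega> i \<psi> x)) \<longlonglongrightarrow> 0" for k i
    using a0(1) r(2) LIMSEQ_subseq_LIMSEQ[OF a0(3) r(1)] by (auto simp: q_def o_def)
  have mq[measurable]: "q k \<in> borel_measurable M" for k by (intro L2D test_L2 q)
  have mpsi[measurable]: "\<psi> \<in> borel_measurable M" by (intro L2D H1D psiH)
  have mp[measurable]: "\<phi> \<in> borel_measurable M" by (intro L2D test_L2 p)
  obtain C1 where C1: "C1 > 0" "\<And>x. \<bar>\<phi> x\<bar> \<le> C1" using cc_fun_bounded[OF test_functions_cc[OF p]] by metis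
  have C2: "(\<phi> x)\<^sup>2 \<le> C1\<^sup>2" for x using C1(2)[of x] by (simp add: abs_le_square_iff[symmetric])
  have wL: "wpd \<Omega> i \<psi> \<in> L2 \<Omega>" and pL: "pd i \<phi> \<in> L2 \<Omega>" and qL: "pd i (q k) \<in> L2 \<Omega>" for i k
    by (rule H1D(3)[OF psiH], rule test_L2[OF test_functions_pd[OF p]], rule test_L2[OF test_functions_pd[OF q(1)]])
  have aG: "\<bar>G t\<bar> \<le> n" for t using Gb[of t] by simp
  have bG: "\<bar>2 * \<phi> x * G t\<bar> \<le> 2 * C1 * n" for x t
    unfolding abs_mult using C1 aG by (intro mult_mono) auto
  have bG': "\<bar>(\<phi> x)\<^sup>2 * G' t\<bar> \<le> C1\<^sup>2 * (n * n)" for x t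
    unfolding abs_mult using C2 Gb' by (intro mult_mono) auto
  have bG2: "\<bar>(\<phi> x)\<^sup>2 * G t\<bar> \<le> C1\<^sup>2 * n" for x t
    unfolding abs_mult using C2 aG by (intro mult_mono) auto
  have int1: "integrable M (\<lambda>x. (wpd \<Omega> i \<psi> x * pd i \<phi> x) * (2 * \<phi> x * G (h x)))"
    if [measurable]: "h \<in> borel_measurable M" for h i
    by (rule integrable_mult_bounded[where C = "2 * C1 * n"])
      (use bG in \<open>auto intro!: L2_integrable_mult wL pL\<close>)
  have int2: "integrable M (\<lambda>x. wpd \<Omega> i \<psi> x * (((\<phi> x)\<^sup>2 * G' (h x)) * d x))"
    if [measurable]: "h \<in> borel_measurable M" and "d \<in> L2 \<Omega>" for h d i
  proof -
    have "integrable M (\<lambda>x. (wpd \<Omega> i \<psi> x * d x) * ((\<phi> x)\<^sup>2 * G' (h x)))"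
      by (rule integrable_mult_bounded[where C = "C1\<^sup>2 * (n * n)"])
        (use bG' that in \<open>auto intro!: L2_integrable_mult wL\<close>)
    then show ?thesis by (simp add: mult_ac)
  qed
  have limG: "AE x in M. (\<lambda>k. G (q k x)) \<longlonglongrightarrow> G (\<psi> x)" "AE x in M. (\<lambda>k. G' (q k x)) \<longlonglongrightarrow> G' (\<psi> x)"
  proof -
    have "isCont G s" "isCont G' s" for s
      using cG by (simp_all add: continuous_on_eq_continuous_at)
    then show "AE x in M. (\<lambda>k. G (q k x)) \<longlonglongrightarrow> G (\<psi> x)" "AE x in M. (\<lambda>k. G' (q k x)) \<longlonglongrightarrow> G' (\<psi> x)"
      using q(2) by (auto elim!: eventually_mono intro: isCont_tendsto_compose)
  qed
  have wt: "(\<lambda>x. (\<phi> x * \<phi> x) * G (q k x)) \<in> test_functions \<Omega>" for k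
    using test_functions_mult[OF p Cinf_on_mult[OF test_functions_Cinf[OF p]
      Cinf_on_compose[OF G(2) test_functions_Cinf[OF q(1)]]]]
    by (simp add: mult.assoc)
  have pdw: "pd i (\<lambda>x. (\<phi> x * \<phi> x) * G (q k x)) x
      = 2 * \<phi> x * pd i \<phi> x * G (q k x) + ((\<phi> x)\<^sup>2 * G' (q k x)) * pd i (q k) x" for i k x
  proof -
    have d: "\<phi> differentiable (at x)" "q k differentiable (at x)"
      using p q(1) by (auto intro!: Cinf_on_differentiable[of UNIV] test_functions_Cinf)
    show ?thesis
      using d pd_compose[OF d(2) G(1)]
      by (simp add: pd_mult power2_eq_square algebra_simps)
  qed
  have eqk: "(\<Sum>i\<in>UNIV. (LINT x|M. (wpd \<Omega> i \<psi> x * pd i \<phi> x) * (2 * \<phi> x * G (q k x)))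
      + (LINT x|M. wpd \<Omega> i \<psi> x * (((\<phi> x)\<^sup>2 * G' (q k x)) * pd i (q k) x)))
    = l * (LINT x|M. \<psi> x * ((\<phi> x)\<^sup>2 * G (q k x)))" for k
  proof -
    let ?w = "\<lambda>x. (\<phi> x * \<phi> x) * G (q k x)"
    have "(LINT x|M. wgrad \<Omega> \<psi> x \<bullet> wgrad \<Omega> ?w x) = l * (LINT x|M. \<psi> x * ?w x)"
      using ev test_H01[OF wt[of k]] unfolding dirichlet_eigenpair_def by blast
    moreover have "(LINT x|M. wgrad \<Omega> \<psi> x \<bullet> wgrad \<Omega> ?w x) = (\<Sum>i\<in>UNIV. LINT x|M. wpd \<Omega> i \<psi> x * wpd \<Omega> i ?w x)"
      by (intro integral_inner_wgrad psiH test_H1 wt)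
    moreover have "(LINT x|M. wpd \<Omega> i \<psi> x * wpd \<Omega> i ?w x) =
       (LINT x|M. (wpd \<Omega> i \<psi> x * pd i \<phi> x) * (2 * \<phi> x * G (q k x)))
      + (LINT x|M. wpd \<Omega> i \<psi> x * (((\<phi> x)\<^sup>2 * G' (q k x)) * pd i (q k) x))" for i
    proof -
      have "(LINT x|M. wpd \<Omega> i \<psi> x * wpd \<Omega> i ?w x) = (LINT x|M. wpd \<Omega> i \<psi> x * pd i ?w x)"
      proof (rule integral_cong_AE)
        show "AE x in M. wpd \<Omega> i \<psi> x * wpd \<Omega> i ?w x = wpd \<Omega> i \<psi> x * pd i ?w x"
          using wpd_test[OF wt[of k], of i] by eventually_elim simp
      qed (intro borel_measurable_times L2D(1) H1D psiH test_H1 wt test_L2 test_functions_pd)+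
      also have "\<dots> = (LINT x|M. (wpd \<Omega> i \<psi> x * pd i \<phi> x) * (2 * \<phi> x * G (q k x))
          + wpd \<Omega> i \<psi> x * (((\<phi> x)\<^sup>2 * G' (q k x)) * pd i (q k) x))"
        unfolding pdw by (simp add: algebra_simps)
      also have "\<dots> = (LINT x|M. (wpd \<Omega> i \<psi> x * pd i \<phi> x) * (2 * \<phi> x * G (q k x)))
          + (LINT x|M. wpd \<Omega> i \<psi> x * (((\<phi> x)\<^sup>2 * G' (q k x)) * pd i (q k) x))"
        by (rule Bochner_Integration.integral_add[OF int1[OF mq] int2[OF mq qL]])
      finally show ?thesis .
    qed
    ultimately show ?thesis by (simp add: power2_eq_square)
  qed
  have l1: "(\<lambda>k. LINT x|M. (wpd \<Omega> i \<psi> x * pd i \<phi> x) * (2 * \<phi> x * G (q k x)))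
      \<longlonglongrightarrow> (LINT x|M. (wpd \<Omega> i \<psi> x * pd i \<phi> x) * (2 * \<phi> x * G (\<psi> x)))" for i
  proof (rule tendsto_integral_bounded[where C = "2 * C1 * n"])
    show "AE x in M. \<bar>2 * \<phi> x * G (q k x)\<bar> \<le> 2 * C1 * n" for k
      using bG by (intro AE_I2)
    show "AE x in M. (\<lambda>k. 2 * \<phi> x * G (q k x)) \<longlonglongrightarrow> 2 * \<phi> x * G (\<psi> x)"
      using limG(1) by eventually_elim (intro tendsto_intros)
  qed (use wL pL qL in \<open>auto intro!: L2_integrable_mult\<close>)
  have l2: "(\<lambda>k. LINT x|M. wpd \<Omega> i \<psi> x * (((\<phi> x)\<^sup>2 * G' (q k x)) * pd i (q k) x))
      \<longlonglongrightarrow> (LINT x|M. wpd \<Omega> i \<psi> x * (((\<phi> x)\<^sup>2 * G' (\<psi> x)) * wpd \<Omega> i \<psi> x))" for i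
  proof (rule tendsto_integral_L2_bounded[where C = "C1\<^sup>2 * (n * n)"])
    show "\<bar>(\<phi> x)\<^sup>2 * G' (q k x)\<bar> \<le> C1\<^sup>2 * (n * n)" for k x
      by (rule bG')
    show "AE x in M. (\<lambda>k. (\<phi> x)\<^sup>2 * G' (q k x)) \<longlonglongrightarrow> (\<phi> x)\<^sup>2 * G' (\<psi> x)"
      using limG(2) by eventually_elim (intro tendsto_intros)
  qed (use wL qL q(3) in \<open>auto\<close>)
  have l3: "(\<lambda>k. LINT x|M. \<psi> x * ((\<phi> x)\<^sup>2 * G (q k x))) \<longlonglongrightarrow> (LINT x|M. \<psi> x * ((\<phi> x)\<^sup>2 * G (\<psi> x)))"
  proof (rule tendsto_integral_bounded[where C = "C1\<^sup>2 * n"])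
    show "AE x in M. \<bar>(\<phi> x)\<^sup>2 * G (q k x)\<bar> \<le> C1\<^sup>2 * n" for k
      using bG2 by (intro AE_I2)
    show "AE x in M. (\<lambda>k. (\<phi> x)\<^sup>2 * G (q k x)) \<longlonglongrightarrow> (\<phi> x)\<^sup>2 * G (\<psi> x)"
      using limG(1) by eventually_elim (intro tendsto_intros)
  qed (use H1D(1)[OF psiH] in \<open>auto intro!: L2_integrable\<close>)
  have eq: "(\<Sum>i\<in>UNIV. (LINT x|M. (wpd \<Omega> i \<psi> x * pd i \<phi> x) * (2 * \<phi> x * G (\<psi> x)))
      + (LINT x|M. wpd \<Omega> i \<psi> x * (((\<phi> x)\<^sup>2 * G' (\<psi> x)) * wpd \<Omega> i \<psi> x)))
    = l * (LINT x|M. \<psi> x * ((\<phi> x)\<^sup>2 * G (\<psi> x)))"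
  proof (rule LIMSEQ_unique)
    show "(\<lambda>k. l * (LINT x|M. \<psi> x * ((\<phi> x)\<^sup>2 * G (q k x)))) \<longlonglongrightarrow> l * (LINT x|M. \<psi> x * ((\<phi> x)\<^sup>2 * G (\<psi> x)))"
      by (intro tendsto_intros l3)
    show "(\<lambda>k. l * (LINT x|M. \<psi> x * ((\<phi> x)\<^sup>2 * G (q k x)))) \<longlonglongrightarrow>
      (\<Sum>i\<in>UNIV. (LINT x|M. (wpd \<Omega> i \<psi> x * pd i \<phi> x) * (2 * \<phi> x * G (\<psi> x)))
      + (LINT x|M. wpd \<Omega> i \<psi> x * (((\<phi> x)\<^sup>2 * G' (\<psi> x)) * wpd \<Omega> i \<psi> x)))"
      unfolding eqk[symmetric] by (intro tendsto_intros l1 l2)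
  qed
  have "(LINT x|M. (wpd \<Omega> i \<psi> x * pd i \<phi> x) * (2 * \<phi> x * G (\<psi> x)))
      + (LINT x|M. wpd \<Omega> i \<psi> x * (((\<phi> x)\<^sup>2 * G' (\<psi> x)) * wpd \<Omega> i \<psi> x)) \<le> (1 + n) / n * sqint (pd i \<phi>)" for i
  proof -
    note i1 = int1[OF mpsi, of i] and i2 = int2[OF mpsi wL, of i]
    have i3: "integrable M (\<lambda>x. (1 + n) / n * (pd i \<phi> x)\<^sup>2)"
      by (intro integrable_mult_right L2D test_L2 test_functions_pd p)
    have "(LINT x|M. (wpd \<Omega> i \<psi> x * pd i \<phi> x) * (2 * \<phi> x * G (\<psi> x)) + wpd \<Omega> i \<psi> x * (((\<phi> x)\<^sup>2 * G' (\<psi> x)) * wpd \<Omega> i \<psi> x))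
      \<le> (LINT x|M. (1 + n) / n * (pd i \<phi> x)\<^sup>2)"
    proof (rule integral_mono_AE)
      show "AE x in M. (wpd \<Omega> i \<psi> x * pd i \<phi> x) * (2 * \<phi> x * G (\<psi> x)) + wpd \<Omega> i \<psi> x * (((\<phi> x)\<^sup>2 * G' (\<psi> x)) * wpd \<Omega> i \<psi> x)
        \<le> (1 + n) / n * (pd i \<phi> x)\<^sup>2"
        using pos
      proof eventually_elim
        case (elim x)
        \<comment> \<open>The relation G' = - L G^2 turns the integrand into 2
          (\<open>pd i \<phi> x\<close>) A - L A^2, whose maximum over A is
          (\<open>pd i \<phi> x\<close>)^2 / L. Positivity of \<psi> supplies the lower bound n / (1
          + n) for L.\<close>
        define L where "L = logis n (\<psi> x)"
        define A where "A = \<phi> x * G (\<psi> x) * wpd \<Omega> i \<psi> x"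
        have L: "L > 0" "L \<ge> n / (1 + n)" using logis_bounds[OF n] logis_ge[OF n] elim by (auto simp: L_def)
        have "(wpd \<Omega> i \<psi> x * pd i \<phi> x) * (2 * \<phi> x * G (\<psi> x)) + wpd \<Omega> i \<psi> x * (((\<phi> x)\<^sup>2 * G' (\<psi> x)) * wpd \<Omega> i \<psi> x)
          = 2 * pd i \<phi> x * A - L * A\<^sup>2"
          by (simp add: A_def G'_def L_def power2_eq_square algebra_simps)
        also have "\<dots> \<le> inverse L * (pd i \<phi> x)\<^sup>2"
        proof -
          have "0 \<le> inverse L * (pd i \<phi> x - L * A)\<^sup>2" using L by simp
          also have "\<dots> = inverse L * (pd i \<phi> x)\<^sup>2 - (2 * pd i \<phi> x * A - L * A\<^sup>2)"
            using L by (simp add: power2_eq_square field_simps)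
          finally show ?thesis by simp
        qed
        also have "\<dots> \<le> (1 + n) / n * (pd i \<phi> x)\<^sup>2"
        proof (rule mult_right_mono)
          have "inverse L \<le> inverse (n / (1 + n))" using L n by (intro le_imp_inverse_le) auto
          then show "inverse L \<le> (1 + n) / n" by simp
        qed simp
        finally show ?case .
      qed
    qed (intro Bochner_Integration.integrable_add i1 i2 i3)+
    with i1 i2 show ?thesis by (simp add: sqint_def)
  qed
  then have "l * (LINT x|M. \<psi> x * ((\<phi> x)\<^sup>2 * G (\<psi> x))) \<le> (\<Sum>i\<in>UNIV. (1 + n) / n * sqint (pd i \<phi>))"
    unfolding eq[symmetric] by (intro sum_mono)
  then show ?thesis by (simp add: G_def sum_distrib_left)
qed

text \<open>The parameter n of \<open>jacobi_test\<close> is sent to infinity. Where \<psi> > 0, the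
  product of \<psi> and \<open>softinv n\<close> at \<psi> is bounded by 1 and tends to 1, so only
  \<phi>^2 survives on the left; the factor (1 + n) / n tends to 1.\<close>

lemma rayleigh_test:
  assumes ev: "principal_eigenpair \<Omega> l \<psi>" and p: "\<phi> \<in> test_functions \<Omega>"
  shows "l * sqint \<phi> \<le> (\<Sum>i\<in>UNIV. sqint (pd i \<phi>))"
proof -
  let ?D = "\<Sum>i\<in>UNIV. sqint (pd i \<phi>)"
  have e: "dirichlet_eigenpair \<Omega> l \<psi>" and pos: "AE x in M. \<psi> x > 0"
    using ev by (auto simp: principal_eigenpair_def)
  then have psiH: "\<psi> \<in> H1 \<Omega>" by (auto simp: dirichlet_eigenpair_def H01_H1)
  have mpsi[measurable]: "\<psi> \<in> borel_measurable M" by (intro L2D H1D psiH)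
  have mG: "softinv n \<in> borel_measurable borel" if "n > 0" for n
    using Dk_softinv[OF that, of 0] by (simp add: borel_measurable_continuous_onI)
  have "(\<lambda>n. LINT x|M. (\<phi> x)\<^sup>2 * (\<psi> x * softinv (real (Suc n)) (\<psi> x))) \<longlonglongrightarrow> (LINT x|M. (\<phi> x)\<^sup>2 * 1)"
  proof (rule tendsto_integral_bounded[where C = 1])
    show "integrable M (\<lambda>x. (\<phi> x)\<^sup>2)" by (intro L2D test_L2 p)
    show "(\<lambda>x. \<psi> x * softinv (real (Suc n)) (\<psi> x)) \<in> borel_measurable M" for n
      by (intro borel_measurable_times mpsi measurable_compose[OF mpsi mG]) simp
    show "AE x in M. \<bar>\<psi> x * softinv (real (Suc n)) (\<psi> x)\<bar> \<le> 1" for n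
      using pos
    proof eventually_elim
      case (elim x)
      have "softplus (real (Suc n)) (\<psi> x) \<ge> \<psi> x" by (rule softplus_ge_self) simp
      with elim show ?case by (simp add: softinv_def field_simps)
    qed
    show "AE x in M. (\<lambda>n. \<psi> x * softinv (real (Suc n)) (\<psi> x)) \<longlonglongrightarrow> 1"
      using pos
    proof eventually_elim
      case (elim x)
      then have "(\<lambda>n. \<psi> x * softinv (real (Suc n)) (\<psi> x)) \<longlonglongrightarrow> \<psi> x * inverse (\<psi> x)"
        unfolding softinv_def by (intro tendsto_intros softplus_tendsto) auto
      with elim show ?case by simp
    qed
  qed simp
  then have L: "(\<lambda>n. l * (LINT x|M. (\<phi> x)\<^sup>2 * (\<psi> x * softinv (real (Suc n)) (\<psi> x)))) \<longlonglongrightarrow> l * sqint \<phi>"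
    by (intro tendsto_intros) (simp add: sqint_def)
  have R: "(\<lambda>n. (1 + real (Suc n)) / real (Suc n) * ?D) \<longlonglongrightarrow> 1 * ?D"
  proof (intro tendsto_intros)
    have "(\<lambda>n. inverse (real (Suc n)) + 1) \<longlonglongrightarrow> 0 + 1"
      by (intro tendsto_intros LIMSEQ_inverse_real_of_nat)
    then show "(\<lambda>n. (1 + real (Suc n)) / real (Suc n)) \<longlonglongrightarrow> 1"
      by (simp add: add_divide_distrib inverse_eq_divide del: of_nat_Suc)
  qed
  have "l * sqint \<phi> \<le> 1 * ?D"
  proof (rule LIMSEQ_le[OF L R], intro exI allI impI)
    fix n
    show "l * (LINT x|M. (\<phi> x)\<^sup>2 * (\<psi> x * softinv (real (Suc n)) (\<psi> x))) \<le> (1 + real (Suc n)) / real (Suc n) * ?D"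
      using jacobi_test[OF e pos p, of "real (Suc n)"] by (simp add: mult_ac del: of_nat_Suc)
  qed
  then show ?thesis by simp
qed

theorem rayleigh:
  assumes ev: "principal_eigenpair \<Omega> l \<psi>" and f: "f \<in> H01 \<Omega>"
  shows "l * sqint f \<le> gradsq f"
proof -
  obtain \<phi> where "approx_seq f \<phi>" using H01_approx[OF f] .
  note a = approx_seqD[OF this]
  note fH = H01_H1[OF f]
  have "(\<lambda>n. l * sqint (\<phi> n)) \<longlonglongrightarrow> l * sqint f"
    by (intro tendsto_intros L2_tendsto_sqint always_eventually allI test_L2 a H1D fH)
  moreover have "(\<lambda>n. \<Sum>i\<in>UNIV. sqint (pd i (\<phi> n))) \<longlonglongrightarrow> gradsq f"
    unfolding gradsq_def
    by (intro tendsto_intros L2_tendsto_sqint always_eventually allI test_L2 test_functions_pd a H1D fH)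
  ultimately show ?thesis
    by (rule LIMSEQ_le) (use rayleigh_test[OF ev a(1)] in blast)
qed

end

section \<open>Differentiation along curves and the energy identity\<close>

text \<open>The delicate point is z = 0. There the difference quotients are, up to sign, |h|^p and
  |h|^(p-1), which tend to 0 because p > 1.\<close>

lemma signed_powr_deriv:
  fixes z p :: real assumes p: "p > 1"
  shows "((\<lambda>z. \<bar>z\<bar> powr (p + 1)) has_real_derivative (p + 1) * (\<bar>z\<bar> powr (p - 1) * z)) (at z)"
    and "((\<lambda>z. \<bar>z\<bar> powr (p - 1) * z) has_real_derivative p * \<bar>z\<bar> powr (p - 1)) (at z)"
proof -
  have *: "((\<lambda>z. \<bar>z\<bar> powr (p + 1)) has_real_derivative (p + 1) * (\<bar>z\<bar> powr (p - 1) * z)) (at z) \<and>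
    ((\<lambda>z. \<bar>z\<bar> powr (p - 1) * z) has_real_derivative p * \<bar>z\<bar> powr (p - 1)) (at z)"
  proof -
    consider "z > 0" | "z = 0" | "z < 0" by linarith
    then show ?thesis
    proof cases
      case 1
      have pz: "z powr p = z powr (p - 1) * z" using 1 by (simp add: powr_diff)
      have "((\<lambda>z. z powr (p + 1)) has_real_derivative (p + 1) * (\<bar>z\<bar> powr (p - 1) * z)) (at z)"
        using 1 pz by (auto intro!: derivative_eq_intros)
      moreover have "((\<lambda>z. z powr p) has_real_derivative p * \<bar>z\<bar> powr (p - 1)) (at z)"
        using 1 by (auto intro!: derivative_eq_intros)
      ultimately show ?thesis
        using 1 by (auto intro: has_field_derivative_transform_within_open[of _ _ _ "{0<..}"] simp: powr_diff)
    next
      case 3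
      have pz: "(- z) powr p = (- z) powr (p - 1) * (- z)" using 3 by (simp add: powr_diff)
      have "((\<lambda>z. (- z) powr (p + 1)) has_real_derivative (p + 1) * (\<bar>z\<bar> powr (p - 1) * z)) (at z)"
        using 3 pz by (auto intro!: derivative_eq_intros)
      moreover have "((\<lambda>z. - ((- z) powr p)) has_real_derivative p * \<bar>z\<bar> powr (p - 1)) (at z)"
        using 3 by (auto intro!: derivative_eq_intros)
      ultimately show ?thesis
        using 3 by (auto intro: has_field_derivative_transform_within_open[of _ _ _ "{..<0}"] simp: powr_diff)
    next
      case 2
      have c: "((\<lambda>h::real. \<bar>h\<bar> powr q) \<longlongrightarrow> 0) (at 0)" if "q > 0" for q
      proof -
        have a: "((\<lambda>h::real. \<bar>h\<bar>) \<longlongrightarrow> 0) (at 0)"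
          using tendsto_rabs[OF tendsto_ident_at[of "0::real" UNIV]] by simp
        have "((\<lambda>h::real. \<bar>h\<bar> powr q) \<longlongrightarrow> 0 powr q) (at 0)"
          by (rule tendsto_powr'[OF a tendsto_const]) (use that in auto)
        then show ?thesis by simp
      qed
      have "((\<lambda>h. \<bar>h\<bar> powr (p - 1) * h) \<longlongrightarrow> 0 * 0) (at 0)"
        using p by (intro tendsto_mult c) auto
      moreover have "\<forall>\<^sub>F h in at 0. \<bar>h\<bar> powr (p - 1) * h = (\<bar>0 + h\<bar> powr (p + 1) - \<bar>0\<bar> powr (p + 1)) / h"
        by (rule eventually_at_filter[THEN iffD2], rule always_eventually)
          (auto simp: powr_add powr_diff field_simps abs_mult_self_eq split: abs_split)
      ultimately have "((\<lambda>h. (\<bar>0 + h\<bar> powr (p + 1) - \<bar>0\<bar> powr (p + 1)) / h) \<longlongrightarrow> 0 * 0) (at 0)"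
        by (rule Lim_transform_eventually)
      moreover have "((\<lambda>h. (\<bar>0 + h\<bar> powr (p - 1) * (0 + h) - \<bar>0\<bar> powr (p - 1) * 0) / h) \<longlongrightarrow> 0) (at 0)"
      proof (rule Lim_transform_eventually[OF c[of "p - 1"]])
        show "\<forall>\<^sub>F h in at 0. \<bar>h\<bar> powr (p - 1) = (\<bar>0 + h\<bar> powr (p - 1) * (0 + h) - \<bar>0\<bar> powr (p - 1) * 0) / h"
          by (rule eventually_at_filter[THEN iffD2], rule always_eventually) auto
      qed (use p in auto)
      ultimately show ?thesis using 2 p by (simp add: DERIV_def)
    qed
  qed
  then show "((\<lambda>z. \<bar>z\<bar> powr (p + 1)) has_real_derivative (p + 1) * (\<bar>z\<bar> powr (p - 1) * z)) (at z)"
    "((\<lambda>z. \<bar>z\<bar> powr (p - 1) * z) has_real_derivative p * \<bar>z\<bar> powr (p - 1)) (at z)" by auto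
qed

lemma mvt_exists:
  fixes f f' :: "real \<Rightarrow> real"
  assumes "\<And>z. (f has_real_derivative f' z) (at z)"
  shows "\<exists>\<xi>. f y - f x = (y - x) * f' \<xi> \<and> min x y \<le> \<xi> \<and> \<xi> \<le> max x y"
proof -
  consider "x < y" | "x = y" | "y < x" by linarith
  then show ?thesis
  proof cases
    case 1
    from MVT2[OF 1, of f f'] assms obtain z where "x < z" "z < y" "f y - f x = (y - x) * f' z" by blast
    then show ?thesis by (intro exI[of _ z]) auto
  next
    case 2
    then show ?thesis by (intro exI[of _ x]) auto
  next
    case 3
    from MVT2[OF 3, of f f'] assms obtain z where "y < z" "z < x" "f x - f y = (x - y) * f' z" by blast
    then show ?thesis by (intro exI[of _ z]) (auto simp: algebra_simps)
  qed
qed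

text \<open>The mean value theorem is used twice, for the power and then for its derivative. Both
  intermediate points stay between x and y, whence the factor (|x| + |y|)^(p-1).\<close>

lemma powr_taylor_bound:
  fixes x y p :: real assumes p: "p > 1"
  shows "\<bar>\<bar>y\<bar> powr (p + 1) - \<bar>x\<bar> powr (p + 1) - (p + 1) * (\<bar>x\<bar> powr (p - 1) * x) * (y - x)\<bar>
    \<le> (p + 1) * p * (\<bar>x\<bar> + \<bar>y\<bar>) powr (p - 1) * (y - x)\<^sup>2"
proof -
  let ?m = "\<lambda>z. \<bar>z\<bar> powr (p - 1) * z"
  obtain \<xi> where xi: "\<bar>y\<bar> powr (p + 1) - \<bar>x\<bar> powr (p + 1) = (y - x) * ((p + 1) * ?m \<xi>)"
    "min x y \<le> \<xi>" "\<xi> \<le> max x y"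
    using mvt_exists[of "\<lambda>z. \<bar>z\<bar> powr (p + 1)" "\<lambda>z. (p + 1) * ?m z" y x] signed_powr_deriv(1)[OF p] by blast
  obtain \<eta> where eta: "?m \<xi> - ?m x = (\<xi> - x) * (p * \<bar>\<eta>\<bar> powr (p - 1))" "min x \<xi> \<le> \<eta>" "\<eta> \<le> max x \<xi>"
    using mvt_exists[of ?m "\<lambda>z. p * \<bar>z\<bar> powr (p - 1)" \<xi> x] signed_powr_deriv(2)[OF p] by blast
  have b: "\<bar>\<xi> - x\<bar> \<le> \<bar>y - x\<bar>" "\<bar>\<eta>\<bar> \<le> \<bar>x\<bar> + \<bar>y\<bar>"
    using xi(2,3) eta(2,3) by linarith+
  have "\<bar>y\<bar> powr (p + 1) - \<bar>x\<bar> powr (p + 1) - (p + 1) * ?m x * (y - x) = (p + 1) * (y - x) * (?m \<xi> - ?m x)"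
    unfolding xi(1) by (simp add: algebra_simps)
  also have "\<bar>\<dots>\<bar> = ((p + 1) * p * \<bar>\<eta>\<bar> powr (p - 1)) * (\<bar>y - x\<bar> * \<bar>\<xi> - x\<bar>)"
    unfolding eta(1) using p by (simp add: abs_mult)
  also have "\<dots> \<le> ((p + 1) * p * (\<bar>x\<bar> + \<bar>y\<bar>) powr (p - 1)) * (\<bar>y - x\<bar> * \<bar>y - x\<bar>)"
    using p b by (intro mult_mono powr_mono2) auto
  finally show ?thesis by (simp add: power2_eq_square)
qed

lemma powr_le_1_plus_power:
  fixes A q :: real assumes "A \<ge> 0" "0 \<le> q" "q \<le> real n"
  shows "A powr q \<le> 1 + A ^ n"
proof (cases "A \<le> 1")
  case True
  then have "A powr q \<le> 1 powr q" using assms by (intro powr_mono2) auto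
  moreover have "A ^ n \<ge> 0" using assms by simp
  ultimately show ?thesis by simp
next
  case False
  then have "A powr q \<le> A powr real n" using assms by (intro powr_mono) auto
  also have "\<dots> = A ^ n" using False by (simp add: powr_realpow)
  finally show ?thesis by simp
qed

text \<open>A crude form of Young's inequality. It takes the place of Hoelder's inequality below,
  reducing mixed products of total degree 6 to sixth powers.\<close>

lemma power_mult_le_sum:
  fixes A B :: real assumes "A \<ge> 0" "B \<ge> 0"
  shows "A ^ m * B ^ n \<le> A ^ (m + n) + B ^ (m + n)"
proof (cases "A \<le> B")
  case True
  then have "A ^ m * B ^ n \<le> B ^ m * B ^ n" using assms by (intro mult_right_mono power_mono) auto
  then show ?thesis using assms by (simp add: power_add add_increasing)
next
  case False
  then have "A ^ m * B ^ n \<le> A ^ m * A ^ n" using assms by (intro mult_left_mono power_mono) auto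
  then show ?thesis using assms by (simp add: power_add add_increasing2)
qed

lemma sum_power6_le:
  fixes A B :: real assumes "A \<ge> 0" "B \<ge> 0" shows "(A + B) ^ 6 \<le> 64 * (A ^ 6 + B ^ 6)"
proof -
  have "(A + B) ^ 6 \<le> (2 * max A B) ^ 6" using assms by (intro power_mono) auto
  also have "\<dots> = 64 * max A B ^ 6" by (simp add: power_mult_distrib)
  also have "max A B ^ 6 \<le> A ^ 6 + B ^ 6" using assms by (auto simp: max_def)
  finally show ?thesis by simp
qed

section \<open>The time interval\<close>

lemma time_dom_open_ray:
  assumes "t \<in> time_dom T" obtains t' where "t < t'" "{t..<t'} \<subseteq> time_dom T"
proof -
  from assms obtain t' where "t < t'" "ereal t' < T"
    unfolding time_dom_def using ereal_dense2[of "ereal t" T] by auto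
  then show ?thesis using assms
    by (intro that[of t']) (auto simp: time_dom_def intro: less_trans[of _ "ereal t'" T] dest: order_le_less_trans)
qed

text \<open>Limits in time are therefore unique, also at 0, where they are one-sided.\<close>

lemma time_dom_at_nontrivial:
  assumes "t \<in> time_dom T" shows "at t within time_dom T \<noteq> bot"
proof -
  obtain t' where t': "t < t'" "{t..<t'} \<subseteq> time_dom T" using time_dom_open_ray[OF assms] .
  have "{t<..<t'} \<subseteq> time_dom T - {t}" using t'(2) by auto
  then have "closure {t<..<t'} \<subseteq> closure (time_dom T - {t})" by (rule closure_mono)
  then have "t \<in> closure (time_dom T - {t})" using t'(1) by auto
  then show ?thesis by (simp add: at_within_eq_bot_iff)
qed

lemma time_dom_at_interior:
  assumes "t \<in> time_dom T" "t > 0" shows "at t within time_dom T = at t"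
proof -
  obtain t' where t': "t < t'" "{t..<t'} \<subseteq> time_dom T" using time_dom_open_ray[OF assms(1)] .
  have "s \<in> time_dom T" if "s \<in> {0<..<t'}" for s
  proof (cases "s < t")
    case True
    with that assms show ?thesis by (auto simp: time_dom_def intro: less_trans[of _ "ereal t" T])
  qed (use that t' in auto)
  then show ?thesis
    using t' assms(2) by (intro at_within_open_subset[of t "{0<..<t'}"]) auto
qed

lemma time_dom_interval: "t \<in> time_dom T \<Longrightarrow> {0..t} \<subseteq> time_dom T"
  by (auto simp: time_dom_def intro: le_less_trans[of _ "ereal t" T])

lemma eventually_time_dom: "\<forall>\<^sub>F s in at t within time_dom T. s \<in> time_dom T \<and> s \<noteq> t"
  by (simp add: eventually_at_filter)

context bounded_domain
begin

section \<open>Derivatives of the energy terms along a curve\<close>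

lemma L2_quot:
  assumes "f \<in> L2 \<Omega>" "g \<in> L2 \<Omega>" "h \<in> L2 \<Omega>"
  shows "(\<lambda>x. (f x - g x) / c - h x) \<in> L2 \<Omega>" "(\<lambda>x. (f x - g x) / c) \<in> L2 \<Omega>"
proof -
  show 1: "(\<lambda>x. (f x - g x) / c) \<in> L2 \<Omega>"
    using L2_lincomb[OF assms(1,2), of "1 / c" "- 1 / c"] by (simp add: diff_divide_distrib)
  show "(\<lambda>x. (f x - g x) / c - h x) \<in> L2 \<Omega>" by (rule L2_diff[OF 1 assms(3)])
qed

lemma H01_diff: "f \<in> H01 \<Omega> \<Longrightarrow> g \<in> H01 \<Omega> \<Longrightarrow> (\<lambda>x. f x - g x) \<in> H01 \<Omega>"
  using H01_lincomb[of f g 1 "-1"] by simp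

lemma H01_quot:
  assumes "f \<in> H01 \<Omega>" "g \<in> H01 \<Omega>" "h \<in> H01 \<Omega>"
  shows "(\<lambda>x. (f x - g x) / c - h x) \<in> H01 \<Omega>" "(\<lambda>x. (f x - g x) / c) \<in> H01 \<Omega>"
proof -
  show 1: "(\<lambda>x. (f x - g x) / c) \<in> H01 \<Omega>"
    using H01_lincomb[OF assms(1,2), of "1 / c" "- 1 / c"] by (simp add: diff_divide_distrib)
  show "(\<lambda>x. (f x - g x) / c - h x) \<in> H01 \<Omega>" by (rule H01_diff[OF 1 assms(3)])
qed

lemma sqint_wpd_quot:
  assumes "f \<in> H1 \<Omega>" "g \<in> H1 \<Omega>" "h \<in> H1 \<Omega>"
  shows "sqint (wpd \<Omega> i (\<lambda>x. (f x - g x) / c - h x))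
    = sqint (\<lambda>x. (wpd \<Omega> i f x - wpd \<Omega> i g x) / c - wpd \<Omega> i h x)"
proof -
  have 1: "(\<lambda>x. (f x - g x) / c) \<in> H1 \<Omega>"
    using H1_lincomb[OF assms(1,2), of "1 / c" "- 1 / c"] by (simp add: diff_divide_distrib)
  have 2: "AE x in M. wpd \<Omega> i (\<lambda>x. (f x - g x) / c) x = (wpd \<Omega> i f x - wpd \<Omega> i g x) / c"
    using wpd_lincomb[OF assms(1,2), of i "1 / c" "- 1 / c"] by (simp add: diff_divide_distrib)
  show ?thesis
  proof (rule sqint_AE_cong)
    show "AE x in M. wpd \<Omega> i (\<lambda>x. (f x - g x) / c - h x) x = (wpd \<Omega> i f x - wpd \<Omega> i g x) / c - wpd \<Omega> i h x"
      using wpd_diff[OF 1 assms(3), of i] 2 by eventually_elim simp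
    show "wpd \<Omega> i (\<lambda>x. (f x - g x) / c - h x) \<in> borel_measurable M"
      by (rule L2D(1)[OF H1D(3)[OF H1_diff[OF 1 assms(3)]]])
    show "(\<lambda>x. (wpd \<Omega> i f x - wpd \<Omega> i g x) / c - wpd \<Omega> i h x) \<in> borel_measurable M"
      by (rule L2D(1)[OF L2_quot(1)[OF assms[THEN H1D(3)]]])
  qed
qed

text \<open>With w the difference quotient, F s = F t + (s - t) w. Expanding the square leaves twice
  the inner product of w with F t, plus (s - t) times the square integral of w; both converge
  because w converges in L2.\<close>

lemma sqint_has_derivative:
  assumes F: "\<And>s. s \<in> D \<Longrightarrow> F s \<in> L2 \<Omega>" and t: "t \<in> D" and G: "G \<in> L2 \<Omega>"
    and lim: "((\<lambda>s. sqint (\<lambda>x. (F s x - F t x) / (s - t) - G x)) \<longlongrightarrow> 0) (at t within D)"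
  shows "((\<lambda>s. sqint (F s)) has_real_derivative 2 * (LINT x|M. F t x * G x)) (at t within D)"
proof -
  define w where "w s x = (F s x - F t x) / (s - t)" for s x
  have ev: "\<forall>\<^sub>F s in at t within D. s \<in> D \<and> s \<noteq> t" by (simp add: eventually_at_filter)
  have wL: "w s \<in> L2 \<Omega>" if "s \<in> D" for s
    unfolding w_def[abs_def] by (rule L2_quot(2)[OF F[OF that] F[OF t] G])
  have evL: "\<forall>\<^sub>F s in at t within D. w s \<in> L2 \<Omega>" using ev by eventually_elim (auto intro: wL)
  have lim': "((\<lambda>s. sqint (\<lambda>x. w s x - G x)) \<longlongrightarrow> 0) (at t within D)" using lim by (simp add: w_def)
  have l1: "((\<lambda>s. LINT x|M. w s x * F t x) \<longlongrightarrow> (LINT x|M. G x * F t x)) (at t within D)"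
    by (rule L2_tendsto_ip[OF evL G F[OF t] lim'])
  have l2: "((\<lambda>s. sqint (w s)) \<longlongrightarrow> sqint G) (at t within D)"
    by (rule L2_tendsto_sqint[OF evL G lim'])
  have "((\<lambda>s. 2 * (LINT x|M. w s x * F t x) + (s - t) * sqint (w s))
      \<longlongrightarrow> 2 * (LINT x|M. G x * F t x) + (t - t) * sqint G) (at t within D)"
    by (intro tendsto_intros l1 l2)
  then have l: "((\<lambda>s. 2 * (LINT x|M. w s x * F t x) + (s - t) * sqint (w s))
      \<longlongrightarrow> 2 * (LINT x|M. F t x * G x)) (at t within D)" by (simp add: mult.commute)
  show ?thesis
    unfolding has_field_derivative_iff
  proof (rule Lim_transform_eventually[OF l])
    show "\<forall>\<^sub>F s in at t within D. 2 * (LINT x|M. w s x * F t x) + (s - t) * sqint (w s) = (sqint (F s) - sqint (F t)) / (s - t)"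
      using ev
    proof eventually_elim
      case (elim s)
      have "sqint (F s) = (LINT x|M. (F t x)\<^sup>2 + (2 * (s - t) * (w s x * F t x) + (s - t)\<^sup>2 * (w s x)\<^sup>2))"
        unfolding sqint_def
      proof (rule Bochner_Integration.integral_cong)
        fix x
        have e: "F s x = F t x + (s - t) * w s x" using elim by (simp add: w_def)
        show "(F s x)\<^sup>2 = (F t x)\<^sup>2 + (2 * (s - t) * (w s x * F t x) + (s - t)\<^sup>2 * (w s x)\<^sup>2)"
          unfolding e by (simp add: power2_eq_square algebra_simps)
      qed simp
      also have "\<dots> = sqint (F t) + (2 * (s - t) * (LINT x|M. w s x * F t x) + (s - t)\<^sup>2 * sqint (w s))"
        unfolding sqint_def
        using L2_integrable_mult[OF wL F[OF t], of s] L2D(2)[OF wL, of s] L2D(2)[OF F[OF t]] elim by simp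
      finally have "(sqint (F s) - sqint (F t)) / (s - t)
          = (2 * (s - t) * (LINT x|M. w s x * F t x) + (s - t)\<^sup>2 * sqint (w s)) / (s - t)" by simp
      also have "\<dots> = 2 * (LINT x|M. w s x * F t x) + (s - t) * sqint (w s)"
      proof -
        have "(2 * d * A + d\<^sup>2 * B) / d = 2 * A + d * B" if "d \<noteq> 0" for d A B :: real
          using that by (simp add: field_simps power2_eq_square)
        from this[of "s - t"] elim show ?thesis by simp
      qed
      finally show ?case by simp
    qed
  qed
qed

lemma H01_measurable: "f \<in> H01 \<Omega> \<Longrightarrow> f \<in> borel_measurable M"
  by (intro L2D(1) H1D(1) H01_H1)

lemma integrable_sum_power6:
  assumes "f \<in> H01 \<Omega>" "g \<in> H01 \<Omega>"
  shows "integrable M (\<lambda>x. (c + \<bar>f x\<bar> + \<bar>g x\<bar>) ^ 6)"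
proof (rule Bochner_Integration.integrable_bound[where f = "\<lambda>x. 64 * (64 * (\<bar>c\<bar> ^ 6 + f x ^ 6) + g x ^ 6)"])
  show "integrable M (\<lambda>x. 64 * (64 * (\<bar>c\<bar> ^ 6 + f x ^ 6) + g x ^ 6))"
    using sobolev_6(1)[OF assms(1)] sobolev_6(1)[OF assms(2)] by simp
  show "(\<lambda>x. (c + \<bar>f x\<bar> + \<bar>g x\<bar>) ^ 6) \<in> borel_measurable M"
    using assms[THEN H01_measurable] by measurable
  show "AE x in M. norm ((c + \<bar>f x\<bar> + \<bar>g x\<bar>) ^ 6) \<le> norm (64 * (64 * (\<bar>c\<bar> ^ 6 + f x ^ 6) + g x ^ 6))"
  proof (rule AE_I2)
    fix x
    have "norm ((c + \<bar>f x\<bar> + \<bar>g x\<bar>) ^ 6) = \<bar>c + \<bar>f x\<bar> + \<bar>g x\<bar>\<bar> ^ 6" by (simp add: power_abs)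
    also have "\<dots> \<le> (\<bar>c\<bar> + \<bar>f x\<bar> + \<bar>g x\<bar>) ^ 6" by (intro power_mono) auto
    also have "\<dots> \<le> 64 * ((\<bar>c\<bar> + \<bar>f x\<bar>) ^ 6 + \<bar>g x\<bar> ^ 6)" by (intro sum_power6_le) auto
    also have "\<dots> \<le> 64 * (64 * (\<bar>c\<bar> ^ 6 + \<bar>f x\<bar> ^ 6) + \<bar>g x\<bar> ^ 6)"
      using sum_power6_le[of "\<bar>c\<bar>" "\<bar>f x\<bar>"] by simp
    finally show "norm ((c + \<bar>f x\<bar> + \<bar>g x\<bar>) ^ 6) \<le> norm (64 * (64 * (\<bar>c\<bar> ^ 6 + f x ^ 6) + g x ^ 6))"
      by (simp add: power_even_abs)
  qed
qed

text \<open>Continuity of the pairing with |f|^(p-1) f in the gradient norm of z. Any positive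
  \<sigma> above that norm is allowed, which covers a vanishing gradient, and the bound is linear in
  \<sigma>.\<close>

lemma nonlinearity_bound:
  assumes f: "f \<in> H01 \<Omega>" and z: "z \<in> H01 \<Omega>" and p: "1 < p" "p \<le> 5"
  shows "integrable M (\<lambda>x. \<bar>f x\<bar> powr (p - 1) * f x * z x)"
    and "\<sigma> > 0 \<Longrightarrow> gradsq z \<le> \<sigma>\<^sup>2 \<Longrightarrow>
      \<bar>LINT x|M. \<bar>f x\<bar> powr (p - 1) * f x * z x\<bar> \<le> \<sigma> * ((LINT x|M. (1 + \<bar>f x\<bar>) ^ 6) + 4096)"
proof -
  have pw: "\<bar>\<bar>f x\<bar> powr (p - 1) * f x * z x\<bar> \<le> \<sigma> * ((1 + \<bar>f x\<bar>) ^ 6 + z x ^ 6 / \<sigma> ^ 6)" if "\<sigma> > 0" for x \<sigma>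
  proof -
    \<comment> \<open>Adding 1 allows the exponent p - 1 to be raised to 4; dividing z by \<sigma>
      makes the Sobolev bound of its sixth power integral the pure constant 4096.\<close>
    let ?A = "1 + \<bar>f x\<bar>" and ?B = "\<bar>z x\<bar> / \<sigma>"
    have "\<bar>f x\<bar> powr (p - 1) \<le> ?A powr (p - 1)" using p by (intro powr_mono2) auto
    also have "\<dots> \<le> ?A powr 4" using p by (intro powr_mono) auto
    also have "\<dots> = ?A ^ 4" by (simp add: powr_numeral)
    finally have "\<bar>f x\<bar> powr (p - 1) * \<bar>f x\<bar> \<le> ?A ^ 4 * ?A" by (intro mult_mono) auto
    also have "\<dots> = ?A ^ 5" by (simp add: eval_nat_numeral)
    finally have "\<bar>f x\<bar> powr (p - 1) * \<bar>f x\<bar> * \<bar>z x\<bar> \<le> ?A ^ 5 * \<bar>z x\<bar>" by (intro mult_right_mono) auto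
    also have "\<dots> = \<sigma> * (?A ^ 5 * ?B ^ 1)" using that by simp
    also have "\<dots> \<le> \<sigma> * (?A ^ (5 + 1) + ?B ^ (5 + 1))"
      using that by (intro mult_left_mono power_mult_le_sum) auto
    finally show ?thesis by (simp add: abs_mult power_divide power_even_abs)
  qed
  have m: "(\<lambda>x. \<bar>f x\<bar> powr (p - 1) * f x * z x) \<in> borel_measurable M"
    using H01_measurable[OF f] H01_measurable[OF z] by measurable
  have A6: "integrable M (\<lambda>x. (1 + \<bar>f x\<bar>) ^ 6)"
    using integrable_sum_power6[OF f H01_diff[OF f f], of 1] by simp
  have i: "integrable M (\<lambda>x. \<sigma> * ((1 + \<bar>f x\<bar>) ^ 6 + z x ^ 6 / \<sigma> ^ 6))" for \<sigma>
    using A6 sobolev_6(1)[OF z] by simp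
  show int: "integrable M (\<lambda>x. \<bar>f x\<bar> powr (p - 1) * f x * z x)"
    by (rule Bochner_Integration.integrable_bound[OF i[of 1] m])
      (use pw[of 1] in \<open>auto intro: order_trans[OF _ abs_ge_self]\<close>)
  assume s: "\<sigma> > 0" "gradsq z \<le> \<sigma>\<^sup>2"
  have "\<bar>LINT x|M. \<bar>f x\<bar> powr (p - 1) * f x * z x\<bar> \<le> (LINT x|M. \<bar>\<bar>f x\<bar> powr (p - 1) * f x * z x\<bar>)"
    by (rule integral_abs_bound)
  also have "\<dots> \<le> (LINT x|M. \<sigma> * ((1 + \<bar>f x\<bar>) ^ 6 + z x ^ 6 / \<sigma> ^ 6))"
    by (intro integral_mono integrable_abs int i pw s)
  also have "\<dots> = \<sigma> * ((LINT x|M. (1 + \<bar>f x\<bar>) ^ 6) + (LINT x|M. z x ^ 6) / \<sigma> ^ 6)"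
    using A6 sobolev_6(1)[OF z] by simp
  also have "\<dots> \<le> \<sigma> * ((LINT x|M. (1 + \<bar>f x\<bar>) ^ 6) + 4096)"
  proof -
    have "(LINT x|M. z x ^ 6) \<le> 4096 * (\<sigma>\<^sup>2) ^ 3"
      using sobolev_6(2)[OF z] power_mono[OF s(2) gradsq_nonneg, of 3] by linarith
    then have "(LINT x|M. z x ^ 6) / \<sigma> ^ 6 \<le> 4096"
      using s(1) by (simp add: divide_simps flip: power_mult)
    then show ?thesis using s(1) by (intro mult_left_mono add_left_mono) auto
  qed
  finally show "\<bar>LINT x|M. \<bar>f x\<bar> powr (p - 1) * f x * z x\<bar> \<le> \<sigma> * ((LINT x|M. (1 + \<bar>f x\<bar>) ^ 6) + 4096)" .
qed

lemma gradsq_tendsto: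
  assumes "\<forall>\<^sub>F s in F. f s \<in> H1 \<Omega>" "g \<in> H1 \<Omega>" "((\<lambda>s. gradsq (\<lambda>x. f s x - g x)) \<longlongrightarrow> 0) F"
  shows "((\<lambda>s. gradsq (f s)) \<longlongrightarrow> gradsq g) F"
  unfolding gradsq_def
proof (rule tendsto_sum, rule L2_tendsto_sqint)
  fix i
  show "\<forall>\<^sub>F s in F. wpd \<Omega> i (f s) \<in> L2 \<Omega>" using assms(1) by eventually_elim (rule H1D)
  show "wpd \<Omega> i g \<in> L2 \<Omega>" by (rule H1D[OF assms(2)])
  show "((\<lambda>s. sqint (\<lambda>x. wpd \<Omega> i (f s) x - wpd \<Omega> i g x)) \<longlongrightarrow> 0) F"
  proof (rule Lim_null_comparison[OF _ assms(3)])
    show "\<forall>\<^sub>F s in F. norm (sqint (\<lambda>x. wpd \<Omega> i (f s) x - wpd \<Omega> i g x)) \<le> gradsq (\<lambda>x. f s x - g x)"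
      using assms(1)
    proof eventually_elim
      case (elim s)
      show ?case using sqint_wpd_le[of i "\<lambda>x. f s x - g x"] sqint_wpd_diff[OF elim assms(2), of i] by simp
    qed
  qed
qed

text \<open>Two errors have to vanish as s tends to t. \<open>t1\<close> is the Taylor remainder, of
  size |s - t| times sixth power integrals of the difference quotient \<open>w s\<close>.
  \<open>t2\<close> is the error of replacing \<open>w s\<close> by its limit v in the linear term,
  controlled by \<open>nonlinearity_bound\<close>.\<close>

lemma powr_integral_has_derivative:
  assumes f: "\<And>s. s \<in> D \<Longrightarrow> f s \<in> H01 \<Omega>" and t: "t \<in> D" and v: "v \<in> H01 \<Omega>" and p: "1 < p" "p \<le> 5"
    and lim: "((\<lambda>s. gradsq (\<lambda>x. (f s x - f t x) / (s - t) - v x)) \<longlongrightarrow> 0) (at t within D)"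
  shows "((\<lambda>s. LINT x|M. \<bar>f s x\<bar> powr (p + 1)) has_real_derivative
    (p + 1) * (LINT x|M. \<bar>f t x\<bar> powr (p - 1) * f t x * v x)) (at t within D)"
proof -
  define w where "w s x = (f s x - f t x) / (s - t)" for s x
  define P where "P g = (LINT x|M. \<bar>g x\<bar> powr (p + 1))" for g :: "real ^ 3 \<Rightarrow> real"
  define N where "N z = (LINT x|M. \<bar>f t x\<bar> powr (p - 1) * f t x * z x)" for z
  define Cf where "Cf = (LINT x|M. (1 + \<bar>f t x\<bar>) ^ 6) + 4096"
  have ev: "\<forall>\<^sub>F s in at t within D. s \<in> D \<and> s \<noteq> t" by (simp add: eventually_at_filter)
  have wH: "w s \<in> H01 \<Omega>" and zH: "(\<lambda>x. w s x - v x) \<in> H01 \<Omega>" if "s \<in> D" for s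
    unfolding w_def[abs_def] by (rule H01_quot(2)[OF f[OF that] f[OF t] v], rule H01_quot(1)[OF f[OF that] f[OF t] v])
  have lim': "((\<lambda>s. gradsq (\<lambda>x. w s x - v x)) \<longlongrightarrow> 0) (at t within D)" using lim by (simp add: w_def)
  have Pint: "integrable M (\<lambda>x. \<bar>g x\<bar> powr (p + 1))" if "g \<in> H01 \<Omega>" for g
    using that p by (intro sobolev_powr(1)) auto
  define K where "K s = (p + 1) * p * (measure M \<Omega> + (LINT x|M. (2 * \<bar>f t x\<bar> + \<bar>w s x\<bar>) ^ 6) + 2 * (LINT x|M. w s x ^ 6))" for s
  have t1: "\<bar>(P (f s) - P (f t)) / (s - t) - (p + 1) * N (w s)\<bar> \<le> \<bar>s - t\<bar> * K s"
    if s: "s \<in> D" "s \<noteq> t" "\<bar>s - t\<bar> \<le> 1" for s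
  proof -
    \<comment> \<open>The pointwise Taylor remainder at f t, since f s - f t = (s - t) w s.\<close>
    let ?R = "\<lambda>x. \<bar>f s x\<bar> powr (p + 1) - \<bar>f t x\<bar> powr (p + 1) - (s - t) * (p + 1) * (\<bar>f t x\<bar> powr (p - 1) * f t x * w s x)"
    have R0: "P (f s) - P (f t) - (s - t) * (p + 1) * N (w s) = (LINT x|M. ?R x)"
      unfolding P_def N_def
      using Pint[OF f[OF s(1)]] Pint[OF f[OF t]] nonlinearity_bound(1)[OF f[OF t] wH[OF s(1)] p] by simp
    have d: "f s x - f t x = (s - t) * w s x" for x using s by (simp add: w_def)
    have A6: "integrable M (\<lambda>x. (2 * \<bar>f t x\<bar> + \<bar>w s x\<bar>) ^ 6)"
      using integrable_sum_power6[OF H01_lincomb[OF f[OF t] f[OF t], of 2 0] wH[OF s(1)], of 0] by (simp add: abs_mult)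
    have Rb: "\<bar>?R x\<bar> \<le> \<bar>s - t\<bar>\<^sup>2 * ((p + 1) * p * (1 + (2 * \<bar>f t x\<bar> + \<bar>w s x\<bar>) ^ 6 + 2 * w s x ^ 6))" for x
    proof -
      let ?A = "2 * \<bar>f t x\<bar> + \<bar>w s x\<bar>"
      have "\<bar>f s x\<bar> \<le> \<bar>f t x\<bar> + \<bar>s - t\<bar> * \<bar>w s x\<bar>" using d[of x] by (metis abs_mult abs_triangle_ineq add.commute diff_add_cancel)
      also have "\<bar>s - t\<bar> * \<bar>w s x\<bar> \<le> 1 * \<bar>w s x\<bar>" by (intro mult_right_mono s) auto
      finally have fs: "\<bar>f t x\<bar> + \<bar>f s x\<bar> \<le> ?A" by simp
      have "\<bar>?R x\<bar> \<le> (p + 1) * p * (\<bar>f t x\<bar> + \<bar>f s x\<bar>) powr (p - 1) * (f s x - f t x)\<^sup>2"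
        using powr_taylor_bound[OF p(1), of "f s x" "f t x"] by (simp add: d mult_ac)
      also have "\<dots> \<le> (p + 1) * p * ?A powr (p - 1) * (f s x - f t x)\<^sup>2"
        using p fs by (intro mult_right_mono mult_left_mono powr_mono2) auto
      also have "\<dots> = \<bar>s - t\<bar>\<^sup>2 * ((p + 1) * p * (?A powr (p - 1) * (w s x)\<^sup>2))"
        by (simp add: d power_mult_distrib mult_ac)
      also have "\<dots> \<le> \<bar>s - t\<bar>\<^sup>2 * ((p + 1) * p * (1 + ?A ^ 6 + 2 * w s x ^ 6))"
      proof (intro mult_left_mono)
        have "?A powr (p - 1) * (w s x)\<^sup>2 \<le> (1 + ?A ^ 4) * (w s x)\<^sup>2"
          using p by (intro mult_right_mono powr_le_1_plus_power) auto
        also have "\<dots> = \<bar>w s x\<bar>\<^sup>2 + ?A ^ 4 * \<bar>w s x\<bar>\<^sup>2" by (simp add: algebra_simps)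
        also have "\<dots> \<le> (1 + \<bar>w s x\<bar> ^ 6) + (?A ^ 6 + \<bar>w s x\<bar> ^ 6)"
        proof (rule add_mono)
          show "\<bar>w s x\<bar>\<^sup>2 \<le> 1 + \<bar>w s x\<bar> ^ 6" using power_mult_le_sum[of 1 "\<bar>w s x\<bar>" 4 2] by simp
          show "?A ^ 4 * \<bar>w s x\<bar>\<^sup>2 \<le> ?A ^ 6 + \<bar>w s x\<bar> ^ 6" using power_mult_le_sum[of ?A "\<bar>w s x\<bar>" 4 2] by simp
        qed
        finally show "?A powr (p - 1) * (w s x)\<^sup>2 \<le> 1 + ?A ^ 6 + 2 * w s x ^ 6" by (simp add: power_even_abs)
      qed (use p in auto)
      finally show ?thesis .
    qed
    have iR: "integrable M ?R"
      using Pint[OF f[OF s(1)]] Pint[OF f[OF t]] nonlinearity_bound(1)[OF f[OF t] wH[OF s(1)] p] by simp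
    have "\<bar>LINT x|M. ?R x\<bar> \<le> (LINT x|M. \<bar>?R x\<bar>)" by (rule integral_abs_bound)
    also have "\<dots> \<le> (LINT x|M. \<bar>s - t\<bar>\<^sup>2 * ((p + 1) * p * (1 + (2 * \<bar>f t x\<bar> + \<bar>w s x\<bar>) ^ 6 + 2 * w s x ^ 6)))"
      using A6 sobolev_6(1)[OF wH[OF s(1)]] iR by (intro integral_mono Rb) auto
    also have "\<dots> = \<bar>s - t\<bar>\<^sup>2 * K s"
      unfolding K_def using A6 sobolev_6(1)[OF wH[OF s(1)]] by simp
    finally have le: "\<bar>P (f s) - P (f t) - (s - t) * (p + 1) * N (w s)\<bar> \<le> \<bar>s - t\<bar>\<^sup>2 * K s" unfolding R0 .
    have "(P (f s) - P (f t)) / (s - t) - (p + 1) * N (w s) = (P (f s) - P (f t) - (s - t) * (p + 1) * N (w s)) / (s - t)"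
      using s by (simp add: diff_divide_distrib)
    also have "\<bar>\<dots>\<bar> = \<bar>P (f s) - P (f t) - (s - t) * (p + 1) * N (w s)\<bar> / \<bar>s - t\<bar>" by simp
    also have "\<dots> \<le> \<bar>s - t\<bar>\<^sup>2 * K s / \<bar>s - t\<bar>" by (intro divide_right_mono le) auto
    also have "\<dots> = \<bar>s - t\<bar> * K s"
    proof -
      have "e\<^sup>2 * A / e = e * A" if "e \<noteq> 0" for e A :: real
        using that by (simp add: power2_eq_square)
      from this[of "\<bar>s - t\<bar>"] s(2) show ?thesis by simp
    qed
    finally show ?thesis .
  qed
  have t2: "\<bar>N (w s) - N v\<bar> \<le> (sqrt (gradsq (\<lambda>x. w s x - v x)) + \<bar>s - t\<bar>) * Cf" if s: "s \<in> D" "s \<noteq> t" for s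
  proof -
    \<comment> \<open>The summand |s - t| keeps this positive when the gradient distance vanishes,
      and it still tends to 0.\<close>
    let ?\<sigma> = "sqrt (gradsq (\<lambda>x. w s x - v x)) + \<bar>s - t\<bar>"
    have "N (w s) - N v = (LINT x|M. \<bar>f t x\<bar> powr (p - 1) * f t x * (w s x - v x))"
      unfolding N_def right_diff_distrib
      using nonlinearity_bound(1)[OF f[OF t] wH[OF s(1)] p] nonlinearity_bound(1)[OF f[OF t] v p] by simp
    moreover have "?\<sigma> > 0" using s by (simp add: add_nonneg_pos)
    moreover have "gradsq (\<lambda>x. w s x - v x) \<le> ?\<sigma>\<^sup>2"
    proof -
      have "(sqrt (gradsq (\<lambda>x. w s x - v x)))\<^sup>2 \<le> ?\<sigma>\<^sup>2" by (intro power_mono) auto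
      then show ?thesis by simp
    qed
    ultimately show ?thesis
      using nonlinearity_bound(2)[OF f[OF t] zH[OF s(1)] p, of ?\<sigma>] by (simp add: Cf_def)
  qed
  define W where "W s = gradsq (w s)" for s
  \<comment> \<open>For \<open>t1\<close> it is enough that \<open>K s\<close> stays bounded.
    \<open>Kf\<close> dominates it by a polynomial in \<open>gradsq (w s)\<close>, which converges;
    the factors 64 come from \<open>sum_power6_le\<close> and from the sixth power of 2.\<close>
  define Kf where "Kf y = (p + 1) * p * (measure M \<Omega> + 64 * (64 * (LINT x|M. f t x ^ 6) + 4096 * y ^ 3) + 2 * (4096 * y ^ 3))" for y
  define K' where "K' s = Kf (W s)" for s
  have KK: "K s \<le> K' s" if s: "s \<in> D" for s
  proof -
    have A6: "integrable M (\<lambda>x. (2 * \<bar>f t x\<bar> + \<bar>w s x\<bar>) ^ 6)"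
      using integrable_sum_power6[OF H01_lincomb[OF f[OF t] f[OF t], of 2 0] wH[OF s], of 0] by (simp add: abs_mult)
    have "(LINT x|M. (2 * \<bar>f t x\<bar> + \<bar>w s x\<bar>) ^ 6) \<le> (LINT x|M. 64 * (64 * f t x ^ 6 + w s x ^ 6))"
    proof (rule integral_mono[OF A6])
      show "integrable M (\<lambda>x. 64 * (64 * f t x ^ 6 + w s x ^ 6))"
        using sobolev_6(1)[OF wH[OF s]] sobolev_6(1)[OF f[OF t]] by simp
      fix x
      have "(2 * \<bar>f t x\<bar> + \<bar>w s x\<bar>) ^ 6 \<le> 64 * ((2 * \<bar>f t x\<bar>) ^ 6 + \<bar>w s x\<bar> ^ 6)" by (intro sum_power6_le) auto
      then show "(2 * \<bar>f t x\<bar> + \<bar>w s x\<bar>) ^ 6 \<le> 64 * (64 * f t x ^ 6 + w s x ^ 6)"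
        by (simp add: power_mult_distrib power_even_abs)
    qed
    also have "\<dots> = 64 * (64 * (LINT x|M. f t x ^ 6) + (LINT x|M. w s x ^ 6))"
      using sobolev_6(1)[OF wH[OF s]] sobolev_6(1)[OF f[OF t]] by simp
    finally show ?thesis
      using sobolev_6(2)[OF wH[OF s]] p
      unfolding K_def K'_def Kf_def W_def by (intro mult_left_mono add_mono) auto
  qed
  have "(W \<longlongrightarrow> gradsq v) (at t within D)"
    unfolding W_def
  proof (rule gradsq_tendsto[OF _ H01_H1[OF v] lim'])
    show "\<forall>\<^sub>F s in at t within D. w s \<in> H1 \<Omega>" using ev by eventually_elim (auto intro: H01_H1 wH)
  qed
  then have K'lim: "(K' \<longlongrightarrow> Kf (gradsq v)) (at t within D)"
    unfolding K'_def Kf_def by (intro tendsto_intros)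
  have bound: "((\<lambda>s. \<bar>s - t\<bar> * K' s + (p + 1) * ((sqrt (gradsq (\<lambda>x. w s x - v x)) + \<bar>s - t\<bar>) * Cf)) \<longlongrightarrow>
     \<bar>t - t\<bar> * Kf (gradsq v)
      + (p + 1) * ((sqrt 0 + \<bar>t - t\<bar>) * Cf)) (at t within D)"
    by (intro tendsto_intros K'lim lim')
  have "((\<lambda>s. (P (f s) - P (f t)) / (s - t)) \<longlongrightarrow> (p + 1) * N v) (at t within D)"
  proof (rule LIM_zero_cancel, rule Lim_null_comparison)
    show "((\<lambda>s. \<bar>s - t\<bar> * K' s + (p + 1) * ((sqrt (gradsq (\<lambda>x. w s x - v x)) + \<bar>s - t\<bar>) * Cf)) \<longlongrightarrow> 0) (at t within D)"
      using bound by simp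
    have "\<forall>\<^sub>F s in at t within D. dist s t < 1" unfolding eventually_at by (intro exI[of _ 1]) auto
    with ev show "\<forall>\<^sub>F s in at t within D. norm ((P (f s) - P (f t)) / (s - t) - (p + 1) * N v)
        \<le> \<bar>s - t\<bar> * K' s + (p + 1) * ((sqrt (gradsq (\<lambda>x. w s x - v x)) + \<bar>s - t\<bar>) * Cf)"
    proof eventually_elim
      case (elim s)
      have "(P (f s) - P (f t)) / (s - t) - (p + 1) * N v
         = ((P (f s) - P (f t)) / (s - t) - (p + 1) * N (w s)) + (p + 1) * (N (w s) - N v)" by (simp add: algebra_simps)
      also have "\<bar>\<dots>\<bar> \<le> \<bar>(P (f s) - P (f t)) / (s - t) - (p + 1) * N (w s)\<bar> + \<bar>(p + 1) * (N (w s) - N v)\<bar>"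
        by (rule abs_triangle_ineq)
      also have "\<bar>(p + 1) * (N (w s) - N v)\<bar> = (p + 1) * \<bar>N (w s) - N v\<bar>" using p by (simp add: abs_mult)
      also have "\<bar>(P (f s) - P (f t)) / (s - t) - (p + 1) * N (w s)\<bar> + (p + 1) * \<bar>N (w s) - N v\<bar>
        \<le> \<bar>s - t\<bar> * K' s + (p + 1) * ((sqrt (gradsq (\<lambda>x. w s x - v x)) + \<bar>s - t\<bar>) * Cf)"
      proof (rule add_mono)
        have "\<bar>(P (f s) - P (f t)) / (s - t) - (p + 1) * N (w s)\<bar> \<le> \<bar>s - t\<bar> * K s"
          using elim by (intro t1) (auto simp: dist_real_def)
        also have "\<dots> \<le> \<bar>s - t\<bar> * K' s" using elim by (intro mult_left_mono KK) auto
        finally show "\<bar>(P (f s) - P (f t)) / (s - t) - (p + 1) * N (w s)\<bar> \<le> \<bar>s - t\<bar> * K' s" .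
        show "(p + 1) * \<bar>N (w s) - N v\<bar> \<le> (p + 1) * ((sqrt (gradsq (\<lambda>x. w s x - v x)) + \<bar>s - t\<bar>) * Cf)"
          using elim p by (intro mult_left_mono t2) auto
      qed
      finally show ?case by simp
    qed
  qed
  then show ?thesis unfolding has_field_derivative_iff P_def N_def .
qed

lemma gradsq_has_derivative:
  assumes f: "\<And>s. s \<in> D \<Longrightarrow> f s \<in> H1 \<Omega>" and t: "t \<in> D" and v: "v \<in> H1 \<Omega>"
    and lim: "((\<lambda>s. gradsq (\<lambda>x. (f s x - f t x) / (s - t) - v x)) \<longlongrightarrow> 0) (at t within D)"
  shows "((\<lambda>s. gradsq (f s)) has_real_derivative
    2 * (\<Sum>i\<in>UNIV. LINT x|M. wpd \<Omega> i (f t) x * wpd \<Omega> i v x)) (at t within D)"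
proof -
  have "((\<lambda>s. sqint (wpd \<Omega> i (f s))) has_real_derivative 2 * (LINT x|M. wpd \<Omega> i (f t) x * wpd \<Omega> i v x)) (at t within D)" for i
  proof (rule sqint_has_derivative)
    show "((\<lambda>s. sqint (\<lambda>x. (wpd \<Omega> i (f s) x - wpd \<Omega> i (f t) x) / (s - t) - wpd \<Omega> i v x)) \<longlongrightarrow> 0) (at t within D)"
    proof (rule Lim_null_comparison[OF _ lim])
      have "\<forall>\<^sub>F s in at t within D. s \<in> D \<and> s \<noteq> t" by (simp add: eventually_at_filter)
      then show "\<forall>\<^sub>F s in at t within D. norm (sqint (\<lambda>x. (wpd \<Omega> i (f s) x - wpd \<Omega> i (f t) x) / (s - t) - wpd \<Omega> i v x))
          \<le> gradsq (\<lambda>x. (f s x - f t x) / (s - t) - v x)"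
      proof eventually_elim
        case (elim s)
        show ?case
          using sqint_wpd_le[of i "\<lambda>x. (f s x - f t x) / (s - t) - v x"]
            sqint_wpd_quot[OF f f[OF t] v, of s i "s - t"] elim by simp
      qed
    qed
  qed (use f t v in \<open>auto intro: H1D\<close>)
  then show ?thesis
    unfolding gradsq_def sum_distrib_left by (intro DERIV_sum) auto
qed

text \<open>The defining identity of the second weak derivatives, tested with functions
  approximating v in H1. No boundary term appears because v is a limit of compactly supported
  functions.\<close>

lemma green_formula:
  assumes u: "u \<in> H2 \<Omega>" and v: "v \<in> H01 \<Omega>"
  shows "wlaplacian \<Omega> u \<in> L2 \<Omega>"
    "(\<Sum>i\<in>UNIV. LINT x|M. wpd \<Omega> i u x * wpd \<Omega> i v x) = - (LINT x|M. wlaplacian \<Omega> u x * v x)"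
proof -
  have wH: "wpd \<Omega> i u \<in> H1 \<Omega>" for i using u by (simp add: H2_def)
  have ww: "wpd \<Omega> i (wpd \<Omega> i u) \<in> L2 \<Omega>" for i by (rule H1D[OF wH])
  have vH: "v \<in> H1 \<Omega>" by (rule H01_H1[OF v])
  show "wlaplacian \<Omega> u \<in> L2 \<Omega>"
    unfolding wlaplacian_def[abs_def] UNIV_3
    using L2_lincomb[OF L2_lincomb[OF ww[of 1] ww[of 2], of 1 1] ww[of 3], of 1 1] by (simp add: add_ac)
  obtain \<phi> where "approx_seq v \<phi>" using H01_approx[OF v] .
  note a = approx_seqD[OF this]
  have "(LINT x|M. wpd \<Omega> i u x * wpd \<Omega> i v x) = - (LINT x|M. wpd \<Omega> i (wpd \<Omega> i u) x * v x)" for i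
  proof (rule LIMSEQ_unique)
    have "(\<lambda>n. LINT x|M. pd i (\<phi> n) x * wpd \<Omega> i u x) \<longlonglongrightarrow> (LINT x|M. wpd \<Omega> i v x * wpd \<Omega> i u x)"
      by (rule L2_tendsto_ip[OF _ H1D(3)[OF vH] H1D(3) a(3)])
        (use test_L2[OF test_functions_pd[OF a(1)]] u in \<open>auto simp: H2_def\<close>)
    then show "(\<lambda>n. LINT x|M. wpd \<Omega> i u x * pd i (\<phi> n) x) \<longlonglongrightarrow> (LINT x|M. wpd \<Omega> i u x * wpd \<Omega> i v x)"
      by (simp add: mult.commute)
    have "(\<lambda>n. LINT x|M. \<phi> n x * wpd \<Omega> i (wpd \<Omega> i u) x) \<longlonglongrightarrow> (LINT x|M. v x * wpd \<Omega> i (wpd \<Omega> i u) x)"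
      by (rule L2_tendsto_ip[OF _ H1D(1)[OF vH] ww a(2)]) (use test_L2[OF a(1)] in auto)
    then have "(\<lambda>n. - (LINT x|M. wpd \<Omega> i (wpd \<Omega> i u) x * \<phi> n x)) \<longlonglongrightarrow> - (LINT x|M. wpd \<Omega> i (wpd \<Omega> i u) x * v x)"
      by (intro tendsto_minus) (simp add: mult.commute)
    moreover have "(LINT x|M. wpd \<Omega> i u x * pd i (\<phi> n) x) = - (LINT x|M. wpd \<Omega> i (wpd \<Omega> i u) x * \<phi> n x)" for n
      using H1D(2)[OF wH[of i], of i] a(1)[of n] unfolding is_weak_pd_def by blast
    ultimately show "(\<lambda>n. LINT x|M. wpd \<Omega> i u x * pd i (\<phi> n) x) \<longlonglongrightarrow> - (LINT x|M. wpd \<Omega> i (wpd \<Omega> i u) x * v x)"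
      by simp
  qed
  then have "(\<Sum>i\<in>UNIV. LINT x|M. wpd \<Omega> i u x * wpd \<Omega> i v x) = - (\<Sum>i\<in>UNIV. LINT x|M. wpd \<Omega> i (wpd \<Omega> i u) x * v x)"
    by (simp add: sum_negf)
  also have "(\<Sum>i\<in>UNIV. LINT x|M. wpd \<Omega> i (wpd \<Omega> i u) x * v x) = (LINT x|M. wlaplacian \<Omega> u x * v x)"
    unfolding wlaplacian_def sum_distrib_right
    by (rule Bochner_Integration.integral_sum[symmetric]) (intro L2_integrable_mult ww H1D vH)
  finally show "(\<Sum>i\<in>UNIV. LINT x|M. wpd \<Omega> i u x * wpd \<Omega> i v x) = - (LINT x|M. wlaplacian \<Omega> u x * v x)" .
qed

end

section \<open>Invariant sets\<close>

context bounded_domain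
begin

section \<open>The functionals in terms of gradient, square and power integrals\<close>

definition powint :: "real \<Rightarrow> (real ^ 3 \<Rightarrow> real) \<Rightarrow> real" where
  "powint p f = (LINT x|M. \<bar>f x\<bar> powr (p + 1))"

lemma Lnorm_powr: "q > 0 \<Longrightarrow> Lnorm \<Omega> q f powr q = (LINT x|M. norm (f x) powr q)"
  unfolding Lnorm_def by (simp add: powr_powr Bochner_Integration.integral_nonneg)

lemma power4_sq: "(x::real) ^ 4 = (x\<^sup>2)\<^sup>2"
  by simp

lemma Jfun_eq:
  assumes "f \<in> H1 \<Omega>" "p > 1"
  shows "Jfun \<Omega> a b lam p f = a / 4 * (gradsq f)\<^sup>2 + b / 2 * gradsq f - lam / 2 * sqint f - 1 / (p + 1) * powint p f"
  unfolding Jfun_def power4_sq Lnorm_wgrad[OF assms(1)] Lnorm_2_sqint powint_def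
  using assms(2) by (simp add: Lnorm_powr)

lemma Ifun_eq:
  assumes "f \<in> H1 \<Omega>" "p > 1"
  shows "Ifun \<Omega> a b lam p f = a * (gradsq f)\<^sup>2 + b * gradsq f - lam * sqint f - powint p f"
  unfolding Ifun_def power4_sq Lnorm_wgrad[OF assms(1)] Lnorm_2_sqint powint_def
  using assms(2) by (simp add: Lnorm_powr)

text \<open>Functions equal almost everywhere satisfy the same test identities, so their weak
  derivatives agree as well. This is needed because initial data are attained, and the zero element
  is described, only almost everywhere.\<close>

lemma gradsq_AE_cong:
  assumes f: "f \<in> H1 \<Omega>" and g: "g \<in> H1 \<Omega>" and eq: "AE x in M. f x = g x" shows "gradsq f = gradsq g"
  unfolding gradsq_def
proof (rule sum.cong[OF refl], rule sqint_AE_cong)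
  fix i
  have "is_weak_pd \<Omega> i g (wpd \<Omega> i f)"
    unfolding is_weak_pd_def
  proof (intro conjI ballI)
    show "loc_integrable \<Omega> g" by (intro L2_loc_integrable H1D g)
    show "loc_integrable \<Omega> (wpd \<Omega> i f)" by (intro L2_loc_integrable H1D f)
    fix \<phi> assume p: "\<phi> \<in> test_functions \<Omega>"
    have "(LINT x|M. g x * pd i \<phi> x) = (LINT x|M. f x * pd i \<phi> x)"
    proof (rule integral_cong_AE)
      show "AE x in M. g x * pd i \<phi> x = f x * pd i \<phi> x" using eq by eventually_elim simp
    qed (intro borel_measurable_times L2D(1) H1D f g test_L2 test_functions_pd p)+
    also have "\<dots> = - (LINT x|M. wpd \<Omega> i f x * \<phi> x)"
      using H1D(2)[OF f, of i] p by (simp add: is_weak_pd_def)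
    finally show "(LINT x|M. g x * pd i \<phi> x) = - (LINT x|M. wpd \<Omega> i f x * \<phi> x)" .
  qed
  from is_weak_pd_unique[OF open_dom this H1D(2)[OF g]]
  show "AE x in M. wpd \<Omega> i f x = wpd \<Omega> i g x" .
qed (intro L2D(1) H1D f g)+

lemma powint_AE_cong:
  assumes "f \<in> borel_measurable M" "g \<in> borel_measurable M" "AE x in M. f x = g x"
  shows "powint p f = powint p g"
  unfolding powint_def
proof (rule integral_cong_AE)
  show "AE x in M. \<bar>f x\<bar> powr (p + 1) = \<bar>g x\<bar> powr (p + 1)" using assms(3) by eventually_elim simp
qed (use assms in measurable)

lemma functionals_AE_cong:
  assumes "f \<in> H01 \<Omega>" "g \<in> H01 \<Omega>" "AE x in M. f x = g x" "p > 1"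
  shows "Jfun \<Omega> a b lam p f = Jfun \<Omega> a b lam p g" "Ifun \<Omega> a b lam p f = Ifun \<Omega> a b lam p g"
  using gradsq_AE_cong[OF H01_H1[OF assms(1)] H01_H1[OF assms(2)] assms(3)]
    powint_AE_cong[OF H01_measurable[OF assms(1)] H01_measurable[OF assms(2)] assms(3)]
    sqint_AE_cong[OF H01_measurable[OF assms(1)] H01_measurable[OF assms(2)] assms(3)]
    H01_H1[OF assms(1)] H01_H1[OF assms(2)] assms(4) by (simp_all add: Jfun_eq Ifun_eq)

lemma H01_zero_values:
  assumes "f \<in> H01_zero \<Omega>" "p > 1"
  shows "gradsq f = 0" "Jfun \<Omega> a b lam p f = 0" "Ifun \<Omega> a b lam p f = 0"
proof -
  have f: "f \<in> H01 \<Omega>" "AE x in M. f x = 0" using assms by (auto simp: H01_zero_def)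
  then have fH: "f \<in> H1 \<Omega>" by (simp add: H01_H1)
  have z: "(\<lambda>x. 0) \<in> H01 \<Omega>" using H01_diff[OF f(1) f(1)] by simp
  have s0: "sqint (\<lambda>x. 0) = 0" "powint p (\<lambda>x. 0) = 0" by (simp_all add: sqint_def powint_def)
  have "sqint (wpd \<Omega> i (\<lambda>x. 0)) = 0" for i using sqint_wpd_diff[OF fH fH, of i] by (simp add: s0)
  then have g0: "gradsq (\<lambda>x. 0) = 0" by (simp add: gradsq_def)
  show "gradsq f = 0" using gradsq_AE_cong[OF fH H01_H1[OF z] f(2)] g0 by simp
  show "Jfun \<Omega> a b lam p f = 0" "Ifun \<Omega> a b lam p f = 0"
    using functionals_AE_cong[OF f(1) z f(2) assms(2)] Jfun_eq[OF H01_H1[OF z] assms(2)]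
      Ifun_eq[OF H01_H1[OF z] assms(2)] g0 s0 by simp_all
qed

text \<open>The Sobolev inequality does here the work of Poincare's inequality.\<close>

lemma gradsq_zero:
  assumes "f \<in> H01 \<Omega>" "gradsq f = 0" shows "f \<in> H01_zero \<Omega>"
proof -
  have "(LINT x|M. f x ^ 6) \<le> 0" using sobolev_6(2)[OF assms(1)] assms(2) by simp
  moreover have "(LINT x|M. f x ^ 6) \<ge> 0" by (intro Bochner_Integration.integral_nonneg) auto
  ultimately have "(LINT x|M. f x ^ 6) = 0" by simp
  then have "AE x in M. f x ^ 6 = 0"
    using integral_nonneg_eq_0_iff_AE[OF sobolev_6(1)[OF assms(1)]] by simp
  then have "AE x in M. f x = 0" by eventually_elim simp
  with assms(1) show ?thesis by (simp add: H01_zero_def)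
qed

lemma sqint_zero_AE: "f \<in> L2 \<Omega> \<Longrightarrow> sqint f = 0 \<Longrightarrow> AE x in M. f x = 0"
  unfolding sqint_def using integral_nonneg_eq_0_iff_AE[of M "\<lambda>x. (f x)\<^sup>2"] L2D(2)[of f] by simp

lemma powint_le:
  assumes "f \<in> H01 \<Omega>" "1 < p" "p \<le> 5" "gradsq f > 0"
  shows "powint p f \<le> sobconst * sqrt (gradsq f) powr (p + 1)"
  unfolding powint_def using assms by (intro sobolev_powr(2)) auto

section \<open>Conservation of energy\<close>

text \<open>H1 convergence of the difference quotients is split into convergence of functions and of
  gradients. The derivative v takes values in \<open>H01\<close>, which makes it admissible in
  \<open>green_formula\<close>.\<close>

lemma Hspace_curve:
  assumes "u \<in> Hspace \<Omega> T"
  shows "\<exists>v. \<forall>t\<in>time_dom T. u t \<in> H01 \<Omega> \<and> u t \<in> H2 \<Omega> \<and> v t \<in> H01 \<Omega> \<and>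
      ((\<lambda>s. sqint (\<lambda>x. (u s x - u t x) / (s - t) - v t x)) \<longlongrightarrow> 0) (at t within time_dom T) \<and>
      ((\<lambda>s. gradsq (\<lambda>x. (u s x - u t x) / (s - t) - v t x)) \<longlongrightarrow> 0) (at t within time_dom T)"
proof -
  from assms have u0: "\<And>t. t \<in> time_dom T \<Longrightarrow> u t \<in> H01 \<Omega>" "\<And>t. t \<in> time_dom T \<Longrightarrow> u t \<in> H2 \<Omega>"
    and "\<exists>v. has_time_deriv (H01 \<Omega>) (H1norm \<Omega>) T u v"
    by (auto simp: Hspace_def)
  then obtain v where v: "has_time_deriv (H01 \<Omega>) (H1norm \<Omega>) T u v" by blast
  have vH: "v t \<in> H01 \<Omega>" if "t \<in> time_dom T" for t using v that by (simp add: has_time_deriv_def)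
  have "((\<lambda>s. sqint (\<lambda>x. (u s x - u t x) / (s - t) - v t x)) \<longlongrightarrow> 0) (at t within time_dom T) \<and>
      ((\<lambda>s. gradsq (\<lambda>x. (u s x - u t x) / (s - t) - v t x)) \<longlongrightarrow> 0) (at t within time_dom T)"
    if t: "t \<in> time_dom T" for t
  proof -
    let ?z = "\<lambda>s x. (u s x - u t x) / (s - t) - v t x"
    have "((\<lambda>s. H1norm \<Omega> (?z s)) \<longlongrightarrow> 0) (at t within time_dom T)"
      using v t by (simp add: has_time_deriv_def)
    from tendsto_power[OF this, of 2] have l: "((\<lambda>s. (H1norm \<Omega> (?z s))\<^sup>2) \<longlongrightarrow> 0) (at t within time_dom T)" by simp
    have eq: "(H1norm \<Omega> (?z s))\<^sup>2 = sqint (?z s) + gradsq (?z s)" if "s \<in> time_dom T" for s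
      by (intro H1norm_sq H01_H1 H01_quot u0 vH t that)
    show ?thesis
    proof
      show "((\<lambda>s. sqint (?z s)) \<longlongrightarrow> 0) (at t within time_dom T)"
        by (rule Lim_null_comparison[OF _ l]) (use eventually_time_dom[of T t] eq in \<open>auto elim!: eventually_mono\<close>)
      show "((\<lambda>s. gradsq (?z s)) \<longlongrightarrow> 0) (at t within time_dom T)"
        by (rule Lim_null_comparison[OF _ l]) (use eventually_time_dom[of T t] eq in \<open>auto elim!: eventually_mono\<close>)
    qed
  qed
  with u0 vH show ?thesis by blast
qed

lemma has_time_deriv_L2:
  assumes "has_time_deriv (L2 \<Omega>) (Lnorm \<Omega> 2) T u v" "t \<in> time_dom T"
  shows "u t \<in> L2 \<Omega>" "v t \<in> L2 \<Omega>"
    "((\<lambda>s. sqint (\<lambda>x. (u s x - u t x) / (s - t) - v t x)) \<longlongrightarrow> 0) (at t within time_dom T)"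
proof -
  show "u t \<in> L2 \<Omega>" "v t \<in> L2 \<Omega>" using assms by (auto simp: has_time_deriv_def)
  have "((\<lambda>s. Lnorm \<Omega> 2 (\<lambda>x. (u s x - u t x) / (s - t) - v t x)) \<longlongrightarrow> 0) (at t within time_dom T)"
    using assms by (simp add: has_time_deriv_def)
  from tendsto_power[OF this, of 2]
  show "((\<lambda>s. sqint (\<lambda>x. (u s x - u t x) / (s - t) - v t x)) \<longlongrightarrow> 0) (at t within time_dom T)"
    by (simp add: Lnorm_2_sqint)
qed

text \<open>Serves to identify the L2 derivative of a solution with the H01-valued one of
  \<open>Hspace_curve\<close>.\<close>

lemma L2_limit_unique:
  assumes "\<forall>\<^sub>F s in F. f s \<in> L2 \<Omega>" "g \<in> L2 \<Omega>" "h \<in> L2 \<Omega>" "F \<noteq> bot"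
    and "((\<lambda>s. sqint (\<lambda>x. f s x - g x)) \<longlongrightarrow> 0) F" "((\<lambda>s. sqint (\<lambda>x. f s x - h x)) \<longlongrightarrow> 0) F"
  shows "AE x in M. g x = h x"
proof -
  have "((\<lambda>s. 2 * sqint (\<lambda>x. f s x - h x) + 2 * sqint (\<lambda>x. f s x - g x)) \<longlongrightarrow> 2 * 0 + 2 * 0) F"
    by (intro tendsto_intros assms)
  moreover have "\<forall>\<^sub>F s in F. sqint (\<lambda>x. g x - h x) \<le> 2 * sqint (\<lambda>x. f s x - h x) + 2 * sqint (\<lambda>x. f s x - g x)"
    using assms(1)
  proof eventually_elim
    case (elim s)
    show ?case
      using sqint_lincomb_le[OF L2_diff[OF elim assms(3)] L2_diff[OF elim assms(2)], of 1 "-1"] by simp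
  qed
  ultimately have "sqint (\<lambda>x. g x - h x) \<le> 2 * 0 + 2 * 0"
    using assms(4) by (intro tendsto_lowerbound) auto
  then have "sqint (\<lambda>x. g x - h x) = 0" using sqint_nonneg[of "\<lambda>x. g x - h x"] by linarith
  from sqint_zero_AE[OF L2_diff[OF assms(2,3)] this] show ?thesis by eventually_elim simp
qed

text \<open>Since G has derivative 2 g', the summands a/4 G^2 + b/2 G of the energy produce exactly
  the Kirchhoff coefficient a G + b in front of g'.\<close>

lemma energy_has_derivative:
  fixes K G S P :: "real \<Rightarrow> real"
  assumes "(K has_real_derivative 2 * k') F" "(G has_real_derivative 2 * g') F"
    "(S has_real_derivative 2 * s') F" "(P has_real_derivative (p + 1) * p') F" "p + 1 \<noteq> 0"
    and F: "F = at t within D"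
  shows "((\<lambda>t. 1 / 2 * K t + (a / 4 * (G t)\<^sup>2 + b / 2 * G t - lam / 2 * S t - 1 / (p + 1) * P t))
    has_real_derivative k' + (a * G t + b) * g' - lam * s' - p') F"
proof -
  have "((\<lambda>t. 1 / 2 * K t + (a / 4 * (G t * G t) + b / 2 * G t - lam / 2 * S t - 1 / (p + 1) * P t))
    has_real_derivative 1 / 2 * (2 * k') + (a / 4 * (2 * g' * G t + 2 * g' * G t) + b / 2 * (2 * g')
      - lam / 2 * (2 * s') - 1 / (p + 1) * ((p + 1) * p'))) F"
    using assms(1-4) unfolding F by (intro DERIV_add DERIV_diff DERIV_cmult DERIV_mult)
  moreover have "1 / 2 * (2 * k') + (a / 4 * (2 * g' * G t + 2 * g' * G t) + b / 2 * (2 * g')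
      - lam / 2 * (2 * s') - 1 / (p + 1) * ((p + 1) * p')) = k' + (a * G t + b) * g' - lam * s' - p'"
  proof -
    have "1 / (p + 1) * ((p + 1) * p') = p'" using assms(5) by simp
    then show ?thesis by (simp only:) (simp add: algebra_simps)
  qed
  ultimately show ?thesis by (simp only: power2_eq_square)
qed

text \<open>The derivative of the energy is the integral of the equation multiplied by the time
  derivative, hence 0. Dropping the nonnegative kinetic term from the constant energy leaves the
  bound for J.\<close>

theorem kirchhoff_energy:
  assumes sol: "kirchhoff_solution \<Omega> a b lam p u0 u1 T u" and p: "1 < p" "p \<le> 5"
    and u0: "u0 \<in> H01 \<Omega>" and u1: "u1 \<in> H01 \<Omega>"
  shows "0 \<in> time_dom T"
    and "\<And>t. t \<in> time_dom T \<Longrightarrow> u t \<in> H01 \<Omega>"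
    and "AE x in M. u 0 x = u0 x"
    and "continuous_on (time_dom T) (\<lambda>t. gradsq (u t))"
    and "continuous_on (time_dom T) (\<lambda>t. Ifun \<Omega> a b lam p (u t))"
    and "\<And>t. t \<in> time_dom T \<Longrightarrow> Jfun \<Omega> a b lam p (u t) \<le> E0 \<Omega> a b lam p u0 u1"
proof -
  let ?D = "time_dom T"
  from sol have T: "0 < T" and H: "u \<in> Hspace \<Omega> T" by (auto simp: kirchhoff_solution_def)
  from sol obtain ut utt where
    ut: "has_time_deriv (L2 \<Omega>) (Lnorm \<Omega> 2) T u ut" and utt: "has_time_deriv (L2 \<Omega>) (Lnorm \<Omega> 2) T ut utt"
    and pde: "\<And>t. t \<in> ?D \<Longrightarrow> t > 0 \<Longrightarrow> AE x in M.
           utt t x - (a * (LINT y|M. (norm (wgrad \<Omega> (u t) y))\<^sup>2) + b) * wlaplacian \<Omega> (u t) x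
             = lam * u t x + \<bar>u t x\<bar> powr (p - 1) * u t x"
    and i0: "AE x in M. u 0 x = u0 x" and i1: "AE x in M. ut 0 x = u1 x"
    unfolding kirchhoff_solution_def by blast
  show D0: "0 \<in> ?D" using T by (auto simp: time_dom_def zero_ereal_def)
  show "AE x in M. u 0 x = u0 x" by (rule i0)
  obtain v where V: "\<forall>t\<in>?D. u t \<in> H01 \<Omega> \<and> u t \<in> H2 \<Omega> \<and> v t \<in> H01 \<Omega> \<and>
      ((\<lambda>s. sqint (\<lambda>x. (u s x - u t x) / (s - t) - v t x)) \<longlongrightarrow> 0) (at t within ?D) \<and>
      ((\<lambda>s. gradsq (\<lambda>x. (u s x - u t x) / (s - t) - v t x)) \<longlongrightarrow> 0) (at t within ?D)"
    using Hspace_curve[OF H] by blast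
  then have uH: "u t \<in> H01 \<Omega>" and uH2: "u t \<in> H2 \<Omega>" and vH: "v t \<in> H01 \<Omega>"
    and vS: "((\<lambda>s. sqint (\<lambda>x. (u s x - u t x) / (s - t) - v t x)) \<longlongrightarrow> 0) (at t within ?D)"
    and vG: "((\<lambda>s. gradsq (\<lambda>x. (u s x - u t x) / (s - t) - v t x)) \<longlongrightarrow> 0) (at t within ?D)"
    if "t \<in> ?D" for t
    using that by auto
  show "\<And>t. t \<in> ?D \<Longrightarrow> u t \<in> H01 \<Omega>" by (rule uH)
  have uH1: "u t \<in> H1 \<Omega>" if "t \<in> ?D" for t using uH[OF that] by (rule H01_H1)
  have vL: "v t \<in> L2 \<Omega>" if "t \<in> ?D" for t using vH[OF that] by (intro H1D H01_H1)
  \<comment> \<open>The kinetic term is differentiated through \<open>ut\<close>, all other terms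
    through \<open>v\<close>; only after this identification do they combine to the equation tested
    with \<open>v\<close>.\<close>
  have utv: "AE x in M. ut t x = v t x" if t: "t \<in> ?D" for t
  proof (rule L2_limit_unique[where F = "at t within ?D" and f = "\<lambda>s x. (u s x - u t x) / (s - t)"])
    show "\<forall>\<^sub>F s in at t within ?D. (\<lambda>x. (u s x - u t x) / (s - t)) \<in> L2 \<Omega>"
      using eventually_time_dom[of T t]
      by eventually_elim (use L2_quot(2)[OF H1D(1)[OF uH1] H1D(1)[OF uH1[OF t]] vL[OF t]] in auto)
  qed (use t has_time_deriv_L2[OF ut t] vL vS time_dom_at_nontrivial[OF t] in auto)
  have dS: "((\<lambda>s. sqint (u s)) has_real_derivative 2 * (LINT x|M. u t x * v t x)) (at t within ?D)" if "t \<in> ?D" for t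
    using that by (intro sqint_has_derivative H1D(1) uH1 vL vS)
  have dG: "((\<lambda>s. gradsq (u s)) has_real_derivative 2 * (\<Sum>i\<in>UNIV. LINT x|M. wpd \<Omega> i (u t) x * wpd \<Omega> i (v t) x)) (at t within ?D)" if "t \<in> ?D" for t
    using that by (intro gradsq_has_derivative uH1 H01_H1[OF vH] vG)
  have dP: "((\<lambda>s. powint p (u s)) has_real_derivative (p + 1) * (LINT x|M. \<bar>u t x\<bar> powr (p - 1) * u t x * v t x)) (at t within ?D)" if "t \<in> ?D" for t
    unfolding powint_def using that by (intro powr_integral_has_derivative uH vH p vG)
  have dK: "((\<lambda>s. sqint (ut s)) has_real_derivative 2 * (LINT x|M. ut t x * utt t x)) (at t within ?D)" if "t \<in> ?D" for t
    using that by (intro sqint_has_derivative has_time_deriv_L2[OF utt])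
  show cG: "continuous_on ?D (\<lambda>t. gradsq (u t))"
    using dG by (intro DERIV_continuous_on)
  have cS: "continuous_on ?D (\<lambda>t. sqint (u t))" using dS by (intro DERIV_continuous_on)
  have cP: "continuous_on ?D (\<lambda>t. powint p (u t))" using dP by (intro DERIV_continuous_on)
  have "continuous_on ?D (\<lambda>t. a * (gradsq (u t))\<^sup>2 + b * gradsq (u t) - lam * sqint (u t) - powint p (u t))"
    by (intro continuous_intros cG cS cP)
  then show "continuous_on ?D (\<lambda>t. Ifun \<Omega> a b lam p (u t))"
    by (rule continuous_on_eq) (use Ifun_eq[OF uH1 p(1)] in simp)
  define E where "E t = 1 / 2 * sqint (ut t) + (a / 4 * (gradsq (u t))\<^sup>2 + b / 2 * gradsq (u t)
      - lam / 2 * sqint (u t) - 1 / (p + 1) * powint p (u t))" for t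
  have EJ: "E t = 1 / 2 * sqint (ut t) + Jfun \<Omega> a b lam p (u t)" if "t \<in> ?D" for t
    unfolding E_def Jfun_eq[OF uH1[OF that] p(1)] ..
  define E' where "E' t = (LINT x|M. ut t x * utt t x)
      + (a * gradsq (u t) + b) * (\<Sum>i\<in>UNIV. LINT x|M. wpd \<Omega> i (u t) x * wpd \<Omega> i (v t) x)
      - lam * (LINT x|M. u t x * v t x) - (LINT x|M. \<bar>u t x\<bar> powr (p - 1) * u t x * v t x)" for t
  have dE: "(E has_real_derivative E' t) (at t within ?D)" if t: "t \<in> ?D" for t
    unfolding E_def[abs_def] E'_def using p
    by (intro energy_has_derivative dS dG dP dK t) auto
  have E'0: "E' t = 0" if t: "t \<in> ?D" "t > 0" for t
  proof -
    let ?g = "\<lambda>x. \<bar>u t x\<bar> powr (p - 1) * u t x"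
    let ?k = "a * gradsq (u t) + b"
    have g1: "wlaplacian \<Omega> (u t) \<in> L2 \<Omega>"
      "(\<Sum>i\<in>UNIV. LINT x|M. wpd \<Omega> i (u t) x * wpd \<Omega> i (v t) x) = - (LINT x|M. wlaplacian \<Omega> (u t) x * v t x)"
      using green_formula[OF uH2 vH] t by auto
    have L: "utt t \<in> L2 \<Omega>" "ut t \<in> L2 \<Omega>" "u t \<in> L2 \<Omega>" "v t \<in> L2 \<Omega>"
      using has_time_deriv_L2[OF utt] has_time_deriv_L2[OF ut] vL t by auto
    have "(LINT x|M. ut t x * utt t x) = (LINT x|M. utt t x * v t x)"
    proof (rule integral_cong_AE)
      show "AE x in M. ut t x * utt t x = utt t x * v t x" using utv[OF t(1)] by eventually_elim simp
    qed (intro borel_measurable_times L2D(1) L)+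
    then have "E' t = (LINT x|M. utt t x * v t x) - ?k * (LINT x|M. wlaplacian \<Omega> (u t) x * v t x)
        - lam * (LINT x|M. u t x * v t x) - (LINT x|M. ?g x * v t x)"
      unfolding E'_def g1(2) by simp
    also have "\<dots> = (LINT x|M. utt t x * v t x - ?k * (wlaplacian \<Omega> (u t) x * v t x) - lam * (u t x * v t x) - ?g x * v t x)"
      using nonlinearity_bound(1)[OF uH[OF t(1)] vH[OF t(1)] p] L2_integrable_mult[OF L(1) L(4)]
        L2_integrable_mult[OF L(3) L(4)] L2_integrable_mult[OF g1(1) L(4)] by simp
    also have "\<dots> = 0"
    proof (rule integral_eq_zero_AE)
      show "AE x in M. utt t x * v t x - ?k * (wlaplacian \<Omega> (u t) x * v t x) - lam * (u t x * v t x) - ?g x * v t x = 0"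
        using pde[OF t] unfolding integral_norm_wgrad_sq[OF uH1[OF t(1)]]
      proof eventually_elim
        case (elim x)
        have "utt t x * v t x - ?k * (wlaplacian \<Omega> (u t) x * v t x) - lam * (u t x * v t x) - ?g x * v t x
          = (utt t x - ?k * wlaplacian \<Omega> (u t) x - (lam * u t x + ?g x)) * v t x" by (simp add: algebra_simps)
        with elim show ?case by simp
      qed
    qed
    finally show ?thesis .
  qed
  \<comment> \<open>The equation is given for t > 0 only; continuity of E at 0 extends the constancy
    to the initial time.\<close>
  have Econst: "E t = E 0" if t: "t \<in> ?D" for t
  proof (cases "t > 0")
    case True
    have sub: "{0..t} \<subseteq> ?D" by (rule time_dom_interval[OF t])
    have "continuous_on ?D E" using dE by (intro DERIV_continuous_on)
    then have "continuous_on {0..t} E" using sub by (rule continuous_on_subset)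
    moreover have "(E has_real_derivative 0) (at s)" if "0 < s" "s < t" for s
    proof -
      have s: "s \<in> ?D" using sub that by auto
      show ?thesis using dE[OF s] E'0[OF s that(1)] time_dom_at_interior[OF s that(1)] by simp
    qed
    ultimately show ?thesis using DERIV_isconst_end[OF True] by blast
  next
    case False
    then show ?thesis using t by (auto simp: time_dom_def)
  qed
  have E0: "E 0 = E0 \<Omega> a b lam p u0 u1"
  proof -
    have "sqint (ut 0) = sqint u1"
      by (rule sqint_AE_cong[OF L2D(1)[OF has_time_deriv_L2(2)[OF ut D0]] H01_measurable[OF u1] i1])
    with functionals_AE_cong(1)[OF uH[OF D0] u0 i0 p(1)] show ?thesis
      by (simp add: EJ[OF D0] E0_def Lnorm_2_sqint)
  qed
  show "Jfun \<Omega> a b lam p (u t) \<le> E0 \<Omega> a b lam p u0 u1" if "t \<in> ?D" for t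
    using Econst[OF that] E0 EJ[OF that] sqint_nonneg[of "ut t"] by linarith
qed

text \<open>The bound \<open>away\<close> makes \<open>{t. I(u(t)) < 0}\<close> equal to the closed set
  \<open>{t. I(u(t)) \<le> 0 \<and> \<rho> \<le> gradsq (u t)}\<close>.\<close>

lemma kirchhoff_sign_invariant:
  assumes sol: "kirchhoff_solution \<Omega> a b lam p u0 u1 T u" and p: "1 < p" "p \<le> 5"
    and u0: "u0 \<in> H01 \<Omega>" and u1: "u1 \<in> H01 \<Omega>" and E: "ereal (E0 \<Omega> a b lam p u0 u1) < d"
    and away: "\<forall>f\<in>H01 \<Omega>. Ifun \<Omega> a b lam p f < 0 \<longrightarrow> \<rho> \<le> gradsq f"
    and barrier: "\<forall>f\<in>H01 \<Omega>. Ifun \<Omega> a b lam p f = 0 \<longrightarrow> \<rho> \<le> gradsq f \<longrightarrow> d \<le> ereal (Jfun \<Omega> a b lam p f)"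
    and t: "t \<in> time_dom T"
  shows "u t \<in> Jsub \<Omega> a b lam p d"
    and "Ifun \<Omega> a b lam p (u t) < 0 \<longleftrightarrow> Ifun \<Omega> a b lam p u0 < 0"
proof -
  let ?D = "time_dom T" and ?I = "\<lambda>t. Ifun \<Omega> a b lam p (u t)"
  note K = kirchhoff_energy[OF sol p u0 u1]
  have Jd: "ereal (Jfun \<Omega> a b lam p (u s)) < d" if "s \<in> ?D" for s
    using K(6)[OF that] E by (metis ereal_less_eq(3) le_less_trans)
  show "u t \<in> Jsub \<Omega> a b lam p d" using Jd[OF t] K(2)[OF t] by (simp add: Jsub_def)
  let ?A = "?D \<inter> ?I -` {..<0}"
  have A: "?A = ?D \<inter> (\<lambda>t. (?I t, gradsq (u t))) -` ({..0} \<times> {\<rho>..})"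
  proof (intro equalityI subsetI)
    fix s assume "s \<in> ?A"
    then show "s \<in> ?D \<inter> (\<lambda>t. (?I t, gradsq (u t))) -` ({..0} \<times> {\<rho>..})" using away K(2)[of s] by auto
  next
    fix s assume s: "s \<in> ?D \<inter> (\<lambda>t. (?I t, gradsq (u t))) -` ({..0} \<times> {\<rho>..})"
    \<comment> \<open>If I vanished here, \<open>barrier\<close> would put J at or above d, against
      the energy bound.\<close>
    then have "?I s \<noteq> 0" using barrier K(2)[of s] Jd[of s] by (auto simp: not_le[symmetric])
    with s show "s \<in> ?A" by auto
  qed
  have "openin (top_of_set ?D) ?A" by (rule continuous_openin_preimage_gen[OF K(5)]) simp
  moreover have "closedin (top_of_set ?D) ?A"
    unfolding A by (intro continuous_closedin_preimage continuous_on_Pair K closed_Times) auto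
  moreover have "connected ?D"
    by (rule is_interval_connected)
      (auto simp: is_interval_1 time_dom_def, meson ereal_less_eq(3) le_less_trans)
  ultimately have "?A = {} \<or> ?A = ?D" by (metis connected_clopen)
  moreover have "?I 0 = Ifun \<Omega> a b lam p u0"
    by (rule functionals_AE_cong(2)[OF K(2)[OF K(1)] u0 K(3) p(1)])
  ultimately show "Ifun \<Omega> a b lam p (u t) < 0 \<longleftrightarrow> Ifun \<Omega> a b lam p u0 < 0"
    using t K(1) by force
qed

section \<open>Invariance of the potential wells\<close>

lemma Nset_depth: "f \<in> Nset \<Omega> a b lam p \<Longrightarrow> depth \<Omega> a b lam p \<le> ereal (Jfun \<Omega> a b lam p f)"
  unfolding depth_def by (rule INF_lower)

text \<open>For the plus set, invariance of the sign leaves I \<ge> 0 along the solution. A point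
  with I = 0 and J below the depth is not in the Nehari set, so it is the zero element, which
  belongs to N_p^+.\<close>

lemma Wplus_Wminus_invariant:
  assumes sol: "kirchhoff_solution \<Omega> a b lam p u0 u1 T u" and p: "1 < p" "p \<le> 5"
    and u0: "u0 \<in> H01 \<Omega>" and u1: "u1 \<in> H01 \<Omega>" and E: "ereal (E0 \<Omega> a b lam p u0 u1) < depth \<Omega> a b lam p"
    and rho: "\<rho> > 0" and away: "\<forall>f\<in>H01 \<Omega>. Ifun \<Omega> a b lam p f < 0 \<longrightarrow> \<rho> \<le> gradsq f"
    and t: "t \<in> time_dom T"
  shows "u0 \<in> Wplus \<Omega> a b lam p \<Longrightarrow> u t \<in> Wplus \<Omega> a b lam p"
    and "u0 \<in> Wminus \<Omega> a b lam p \<Longrightarrow> u t \<in> Wminus \<Omega> a b lam p"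
proof -
  let ?I = "Ifun \<Omega> a b lam p"
  have barrier: "\<forall>f\<in>H01 \<Omega>. ?I f = 0 \<longrightarrow> \<rho> \<le> gradsq f \<longrightarrow> depth \<Omega> a b lam p \<le> ereal (Jfun \<Omega> a b lam p f)"
  proof (intro ballI impI)
    fix f assume "f \<in> H01 \<Omega>" "?I f = 0" "\<rho> \<le> gradsq f"
    then show "depth \<Omega> a b lam p \<le> ereal (Jfun \<Omega> a b lam p f)"
      using H01_zero_values(1)[of f p] p rho by (intro Nset_depth) (auto simp: Nset_def)
  qed
  note S = kirchhoff_sign_invariant[OF sol p u0 u1 E away barrier t]
  from S(1) have ut: "u t \<in> H01 \<Omega>" "ereal (Jfun \<Omega> a b lam p (u t)) < depth \<Omega> a b lam p"
    by (auto simp: Jsub_def)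
  show "u t \<in> Wminus \<Omega> a b lam p" if "u0 \<in> Wminus \<Omega> a b lam p"
    using that S ut by (auto simp: Wminus_def Nminus_def)
  show "u t \<in> Wplus \<Omega> a b lam p" if "u0 \<in> Wplus \<Omega> a b lam p"
  proof -
    have "\<not> ?I u0 < 0"
      using that H01_zero_values(3)[OF _ p(1), of u0] by (auto simp: Wplus_def Nplus_def)
    with S(2) have "\<not> ?I (u t) < 0" by simp
    moreover have "u t \<in> H01_zero \<Omega>" if "?I (u t) = 0"
      using Nset_depth[of "u t" a b lam p] ut that by (auto simp: Nset_def not_le[symmetric])
    ultimately show ?thesis using S(1) ut(1) by (force simp: Wplus_def Nplus_def)
  qed
qed

section \<open>Lower bounds for the gradient where I is negative\<close>

lemma quadratic_bound:
  assumes ev: "principal_eigenpair \<Omega> lam1 \<psi>" and f: "f \<in> H01 \<Omega>" and "b \<ge> 0"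
  shows "lam \<le> b * lam1 \<Longrightarrow> lam * sqint f \<le> b * gradsq f"
    and "lam > 0 \<Longrightarrow> lam1 > 0 \<Longrightarrow> lam * sqint f \<le> lam / lam1 * gradsq f"
proof -
  note R = rayleigh[OF ev f]
  show "lam * sqint f \<le> b * gradsq f" if "lam \<le> b * lam1"
  proof -
    have "lam * sqint f \<le> b * lam1 * sqint f" using that by (intro mult_right_mono) auto
    also have "\<dots> \<le> b * gradsq f" using mult_left_mono[OF R \<open>b \<ge> 0\<close>] by (simp add: mult.assoc)
    finally show ?thesis .
  qed
  show "lam * sqint f \<le> lam / lam1 * gradsq f" if "lam > 0" "lam1 > 0"
    using mult_left_mono[OF R, of "lam / lam1"] that by simp
qed

text \<open>Let k be \<open>gradsq f\<close>. Where I < 0, the nonlinear integral exceeds (b -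
  \<kappa>) k, while the Sobolev inequality bounds it by a multiple of k^2. Dividing by k, which is
  nonzero since I vanishes at the zero element, bounds k from below.\<close>

lemma away_cubic:
  assumes ev: "principal_eigenpair \<Omega> lam1 \<psi>" and ab: "a > 0" "b > 0" and lam: "lam < b * lam1"
  shows "\<exists>\<rho>>0. \<forall>f\<in>H01 \<Omega>. Ifun \<Omega> a b lam 3 f < 0 \<longrightarrow> \<rho> \<le> gradsq f"
proof -
  \<comment> \<open>For \<open>lam > 0\<close> the Rayleigh inequality gives \<kappa> = lam / lam1,
    below b because lam1 is then positive; otherwise the term with \<open>lam\<close> has a
    favourable sign.\<close>
  obtain \<kappa> where k: "\<kappa> < b" "\<And>f. f \<in> H01 \<Omega> \<Longrightarrow> lam * sqint f \<le> \<kappa> * gradsq f"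
  proof (cases "lam > 0")
    case True
    then have "b * lam1 > 0" using lam by linarith
    then have "lam1 > 0" using ab by (simp add: zero_less_mult_iff)
    show ?thesis
      by (rule that[of "lam / lam1"])
        (use quadratic_bound(2)[OF ev] True \<open>lam1 > 0\<close> lam ab in \<open>auto simp: field_simps\<close>)
  next
    case False
    show ?thesis
      by (rule that[of 0]) (use False ab in \<open>auto intro: mult_nonpos_nonneg\<close>)
  qed
  define \<rho> where "\<rho> = (b - \<kappa>) / sobconst"
  show ?thesis
  proof (intro exI[of _ \<rho>] conjI ballI impI)
    show "\<rho> > 0" using k(1) sobconst_pos by (simp add: \<rho>_def)
    fix f assume f: "f \<in> H01 \<Omega>" and I: "Ifun \<Omega> a b lam 3 f < 0"
    let ?k = "gradsq f"
    have "?k \<noteq> 0" using gradsq_zero[OF f] H01_zero_values(3)[of f 3] I by auto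
    then have k0: "?k > 0" using gradsq_nonneg[of f] by linarith
    have "sqrt ?k powr (3 + 1) = ?k\<^sup>2"
      using k0 power4_sq[of "sqrt ?k"] by (simp add: powr_numeral)
    then have "powint 3 f \<le> sobconst * ?k\<^sup>2" using powint_le[OF f _ _ k0, of 3] by simp
    moreover have "a * ?k\<^sup>2 \<ge> 0" using ab by simp
    ultimately have "(b - \<kappa>) * ?k < sobconst * ?k * ?k"
      using I k(2)[OF f] Ifun_eq[OF H01_H1[OF f], of 3 a b lam] by (simp add: algebra_simps power2_eq_square)
    then have "b - \<kappa> < sobconst * ?k" using k0 by (simp add: mult_less_cancel_right)
    then show "\<rho> \<le> ?k" using sobconst_pos by (simp add: \<rho>_def field_simps)
  qed
qed

text \<open>At lam = b lam1 the quadratic part of I is only known to be nonnegative, so the quartic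
  Kirchhoff term has to supply the bound; it dominates near 0 because p + 1 > 4.\<close>

lemma away_superquartic:
  assumes ev: "principal_eigenpair \<Omega> lam1 \<psi>" and ab: "a > 0" "b > 0" and lam: "lam \<le> b * lam1"
    and p: "3 < p" "p < 5"
  shows "\<exists>\<rho>>0. \<forall>f\<in>H01 \<Omega>. Ifun \<Omega> a b lam p f < 0 \<longrightarrow> \<rho> \<le> gradsq f"
proof -
  \<comment> \<open>The gradient norm at which a \<sigma>^4 balances the Sobolev bound
    \<open>sobconst\<close> \<sigma>^(p+1) of the nonlinear term.\<close>
  define \<sigma> where "\<sigma> = (a / sobconst) powr (1 / (p - 3))"
  have s0: "\<sigma> > 0" using ab sobconst_pos by (simp add: \<sigma>_def)
  show ?thesis
  proof (intro exI[of _ "\<sigma>\<^sup>2"] conjI ballI impI)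
    show "\<sigma>\<^sup>2 > 0" using s0 by simp
    fix f assume f: "f \<in> H01 \<Omega>" and I: "Ifun \<Omega> a b lam p f < 0"
    let ?k = "gradsq f"
    let ?s = "sqrt ?k"
    have "?k \<noteq> 0" using gradsq_zero[OF f] H01_zero_values(3)[of f p] I p by auto
    then have k0: "?k > 0" using gradsq_nonneg[of f] by linarith
    have "a * ?k\<^sup>2 < powint p f"
      using I quadratic_bound(1)[OF ev f _ lam] Ifun_eq[OF H01_H1[OF f], of p a b lam] p ab by simp
    also have "\<dots> \<le> sobconst * ?s powr (p + 1)" using powint_le[OF f _ _ k0, of p] p by simp
    also have "?s powr (p + 1) = ?s powr (p - 3) * ?s powr 4"
      using powr_add[of ?s "p - 3" 4] by (simp add: add.commute)
    also have "?s powr 4 = ?k\<^sup>2" using k0 power4_sq[of "sqrt ?k"] by (simp add: powr_numeral)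
    finally have "a < sobconst * ?s powr (p - 3)" using k0 by simp
    then have "a / sobconst < ?s powr (p - 3)" using sobconst_pos by (simp add: field_simps)
    then have "\<sigma> \<le> (?s powr (p - 3)) powr (1 / (p - 3))"
      unfolding \<sigma>_def using ab sobconst_pos p by (intro powr_mono2) auto
    also have "\<dots> = ?s" using k0 p by (simp add: powr_powr)
    finally have "\<sigma>\<^sup>2 \<le> ?s\<^sup>2" using s0 by (intro power_mono) auto
    then show "\<sigma>\<^sup>2 \<le> ?k" by simp
  qed
qed

section \<open>The depth in Case B\<close>

lemma gradsq_scale: "f \<in> H1 \<Omega> \<Longrightarrow> gradsq (\<lambda>x. c * f x) = c\<^sup>2 * gradsq f"
proof -
  assume f: "f \<in> H1 \<Omega>"
  have "sqint (wpd \<Omega> i (\<lambda>x. c * f x)) = c\<^sup>2 * sqint (wpd \<Omega> i f)" for i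
    using sqint_wpd_lincomb[OF f f, of i c 0] by (simp add: sqint_def power_mult_distrib)
  then show ?thesis by (simp add: gradsq_def sum_distrib_left)
qed

text \<open>Along the ray through \<psi>, I(c \<psi>) = c^2 q + c^4 r. The eigenvalue equation gives
  q = (b lam1 - lam) times the square integral of \<psi>, which is negative, and \<open>R\<close>
  says r > 0. So the ray meets the Nehari set, where J is a quarter of the quadratic part c^2
  q.\<close>

lemma depth_minus_neg:
  assumes ev: "dirichlet_eigenpair \<Omega> lam1 \<psi>" and lam: "b * lam1 < lam"
    and R: "(Lnorm \<Omega> 4 \<psi>) ^ 4 - a * (Lnorm \<Omega> 2 (wgrad \<Omega> \<psi>)) ^ 4 < 0"
  shows "depth_minus \<Omega> a b lam < 0"
proof -
  have psi: "\<psi> \<in> H01 \<Omega>" "\<psi> \<notin> H01_zero \<Omega>" using ev by (auto simp: dirichlet_eigenpair_def)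
  then have psiH: "\<psi> \<in> H1 \<Omega>" by (simp add: H01_H1)
  have "(LINT x|M. wgrad \<Omega> \<psi> x \<bullet> wgrad \<Omega> \<psi> x) = lam1 * (LINT x|M. \<psi> x * \<psi> x)"
    using ev psi(1) by (auto simp: dirichlet_eigenpair_def)
  then have "gradsq \<psi> = lam1 * sqint \<psi>"
    using integral_norm_wgrad_sq[OF psiH] by (simp add: sqint_def power2_eq_square dot_square_norm)
  moreover have s0: "sqint \<psi> > 0"
  proof -
    have "sqint \<psi> \<noteq> 0"
      using sqint_zero_AE[OF H1D(1)[OF psiH]] psi unfolding H01_zero_def by blast
    then show ?thesis using sqint_nonneg[of \<psi>] by linarith
  qed
  ultimately have Q: "b * gradsq \<psi> - lam * sqint \<psi> < 0"
    using lam mult_strict_right_mono[OF lam s0] by simp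
  have "(Lnorm \<Omega> 4 \<psi>) ^ 4 = Lnorm \<Omega> 4 \<psi> powr 4"
    by (cases "Lnorm \<Omega> 4 \<psi> = 0") (simp_all add: powr_numeral)
  also have "\<dots> = powint 3 \<psi>"
  proof -
    have "powint 3 \<psi> = (LINT x|M. \<bar>\<psi> x\<bar> powr 4)" by (simp add: powint_def)
    then show ?thesis using Lnorm_powr[of 4 \<psi>] by (simp only: real_norm_def zero_less_numeral)
  qed
  finally have R': "a * (gradsq \<psi>)\<^sup>2 - powint 3 \<psi> > 0"
    using R power4_sq[of "Lnorm \<Omega> 2 (wgrad \<Omega> \<psi>)"] Lnorm_wgrad[OF psiH] by simp
  define q where "q = b * gradsq \<psi> - lam * sqint \<psi>"
  define r where "r = a * (gradsq \<psi>)\<^sup>2 - powint 3 \<psi>"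
  \<comment> \<open>The positive zero of c^2 (q + c^2 r).\<close>
  define c where "c = sqrt (- q / r)"
  have qr: "q < 0" "r > 0" using Q R' by (auto simp: q_def r_def)
  then have "- q / r > 0" by (intro divide_pos_pos) auto
  then have c2: "c\<^sup>2 = - q / r" "c > 0" unfolding c_def by (auto simp only: real_sqrt_pow2 less_imp_le real_sqrt_gt_zero)
  let ?f = "\<lambda>x. c * \<psi> x"
  have f: "?f \<in> H01 \<Omega>" using H01_lincomb[OF psi(1) psi(1), of c 0] by simp
  have g: "gradsq ?f = c\<^sup>2 * gradsq \<psi>" by (rule gradsq_scale[OF psiH])
  have s: "sqint ?f = c\<^sup>2 * sqint \<psi>" by (simp add: sqint_def power_mult_distrib)
  have pw: "powint 3 ?f = (c\<^sup>2)\<^sup>2 * powint 3 \<psi>"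
  proof -
    have "\<bar>c * y\<bar> powr (3 + 1) = (c\<^sup>2)\<^sup>2 * \<bar>y\<bar> powr (3 + 1)" for y
      using c2(2) by (simp add: abs_mult powr_mult powr_numeral)
    then show ?thesis by (simp add: powint_def)
  qed
  have qf: "b * gradsq ?f - lam * sqint ?f = c\<^sup>2 * q" by (simp add: g s q_def algebra_simps)
  have "Ifun \<Omega> a b lam 3 ?f = (c\<^sup>2)\<^sup>2 * r + c\<^sup>2 * q"
    using Ifun_eq[OF H01_H1[OF f], of 3 a b lam] by (simp add: g s pw q_def r_def algebra_simps power2_eq_square)
  also have "\<dots> = c\<^sup>2 * (c\<^sup>2 * r + q)" by (simp add: algebra_simps power2_eq_square)
  also have "\<dots> = 0" using qr by (simp add: c2)
  finally have I0: "Ifun \<Omega> a b lam 3 ?f = 0" .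
  have J: "Jfun \<Omega> a b lam 3 ?f = c\<^sup>2 * q / 4"
    using I0 Ifun_eq[OF H01_H1[OF f], of 3 a b lam] Jfun_eq[OF H01_H1[OF f], of 3 a b lam] qf by simp
  have cq: "c\<^sup>2 * q < 0" using qr c2(2) by (simp add: mult_pos_neg)
  have "?f \<notin> H01_zero \<Omega>" using H01_zero_values(2)[of ?f 3 a b lam] J cq by auto
  with f I0 have "?f \<in> Nset \<Omega> a b lam 3" by (simp add: Nset_def)
  moreover have "?f \<in> Lminus \<Omega> b lam"
    using f qf cq by (simp add: Lminus_def Lnorm_wgrad[OF H01_H1[OF f]] Lnorm_2_sqint)
  ultimately have "depth_minus \<Omega> a b lam \<le> ereal (Jfun \<Omega> a b lam 3 ?f)"
    unfolding depth_minus_def by (intro INF_lower) auto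
  also have "\<dots> < 0" using cq by (simp add: J)
  finally show ?thesis .
qed

text \<open>For p = 3 the quartic terms of J are a quarter of those of I. On I = 0 the value of J is
  therefore a quarter of the quadratic form that defines \<open>Lminus\<close>, and a negative value
  puts f into \<open>Lminus\<close>.\<close>

lemma depth_minus_barrier:
  assumes d: "depth_minus \<Omega> a b lam < 0" and f: "f \<in> H01 \<Omega>" and I: "Ifun \<Omega> a b lam 3 f = 0"
  shows "depth_minus \<Omega> a b lam \<le> ereal (Jfun \<Omega> a b lam 3 f)"
proof (rule ccontr)
  assume "\<not> ?thesis"
  then have lt: "ereal (Jfun \<Omega> a b lam 3 f) < depth_minus \<Omega> a b lam" by simp
  also note d
  finally have J: "Jfun \<Omega> a b lam 3 f < 0" by simp
  then have "f \<notin> H01_zero \<Omega>" using H01_zero_values(2)[of f 3 a b lam] by auto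
  moreover have "b * gradsq f - lam * sqint f < 0"
    using J I Ifun_eq[OF H01_H1[OF f], of 3 a b lam] Jfun_eq[OF H01_H1[OF f], of 3 a b lam] by simp
  ultimately have "f \<in> Nset \<Omega> a b lam 3 \<inter> Lminus \<Omega> b lam"
    using f I by (simp add: Nset_def Lminus_def Lnorm_wgrad[OF H01_H1[OF f]] Lnorm_2_sqint)
  then have "depth_minus \<Omega> a b lam \<le> ereal (Jfun \<Omega> a b lam 3 f)"
    unfolding depth_minus_def by (rule INF_lower)
  with lt show False by simp
qed

end

theorem theorem2p1:
  fixes \<Omega> :: "(real ^ 3) set"
    and a b lam p lam1 \<delta> :: real
    and \<psi>1 u0 u1 :: "real ^ 3 \<Rightarrow> real"
    and u :: "real \<Rightarrow> real ^ 3 \<Rightarrow> real"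
    and Tmax :: ereal
  assumes "open \<Omega>" and "bounded \<Omega>" and "smooth_boundary \<Omega>"
    and "a > 0" and "b > 0" and "p > 1"
    and "principal_eigenpair \<Omega> lam1 \<psi>1"
    and "u0 \<in> H2 \<Omega> \<inter> H01 \<Omega>" and "u1 \<in> H01 \<Omega>"
    and "Tmax = max_time \<Omega> a b lam p u0 u1"
    and "kirchhoff_solution \<Omega> a b lam p u0 u1 Tmax u"
  shows
    "(p = 3 \<and> a < 1 / Lam \<Omega> \<and> lam < b * lam1 \<and>
        ereal (E0 \<Omega> a b lam p u0 u1) < depth \<Omega> a b lam p \<longrightarrow>
        (u0 \<in> Wplus \<Omega> a b lam p \<longrightarrow> (\<forall>t\<in>time_dom Tmax. u t \<in> Wplus \<Omega> a b lam p)) \<and>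
        (u0 \<in> Wminus \<Omega> a b lam p \<longrightarrow> (\<forall>t\<in>time_dom Tmax. u t \<in> Wminus \<Omega> a b lam p))) \<and>
     (p = 3 \<and> a < 1 / Lam \<Omega> \<and>
        (Lnorm \<Omega> 4 \<psi>1) ^ 4 - a * (Lnorm \<Omega> 2 (wgrad \<Omega> \<psi>1)) ^ 4 < 0 \<and>
        \<delta> > 0 \<and>
        (\<forall>\<mu>. b * lam1 < \<mu> \<and> \<mu> < b * lam1 + \<delta> \<longrightarrow>
           H01_closure \<Omega> (Lminus \<Omega> b \<mu>) \<inter> H01_closure \<Omega> (Sset \<Omega> a) = H01_zero \<Omega>) \<and>
        b * lam1 < lam \<and> lam < b * lam1 + \<delta> \<longrightarrow>
        u0 \<in> Nminus \<Omega> a b lam p \<inter> Jsub \<Omega> a b lam p (depth_minus \<Omega> a b lam) \<and>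
        ereal (E0 \<Omega> a b lam p u0 u1) < depth_minus \<Omega> a b lam \<longrightarrow>
        (\<forall>t\<in>time_dom Tmax.
           u t \<in> Nminus \<Omega> a b lam p \<inter> Jsub \<Omega> a b lam p (depth_minus \<Omega> a b lam))) \<and>
     (3 < p \<and> p < 5 \<and> lam \<le> b * lam1 \<and>
        ereal (E0 \<Omega> a b lam p u0 u1) < depth \<Omega> a b lam p \<longrightarrow>
        (u0 \<in> Wplus \<Omega> a b lam p \<longrightarrow> (\<forall>t\<in>time_dom Tmax. u t \<in> Wplus \<Omega> a b lam p)) \<and>
        (u0 \<in> Wminus \<Omega> a b lam p \<longrightarrow> (\<forall>t\<in>time_dom Tmax. u t \<in> Wminus \<Omega> a b lam p)))"
proof (intro conjI impI; (elim conjE)?)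
  interpret bounded_domain \<Omega> by unfold_locales fact+
  note sol = assms(11)
  have u0: "u0 \<in> H01 \<Omega>" using assms(8) by simp
  note u1 = assms(9) and ev = assms(7) and ab = assms(4,5)
  {
    assume A: "p = 3" "lam < b * lam1" "ereal (E0 \<Omega> a b lam p u0 u1) < depth \<Omega> a b lam p"
    obtain \<rho> where r: "\<rho> > 0" "\<forall>f\<in>H01 \<Omega>. Ifun \<Omega> a b lam p f < 0 \<longrightarrow> \<rho> \<le> gradsq f"
      using away_cubic[OF ev ab A(2)] A(1) by blast
    note W = Wplus_Wminus_invariant[OF sol _ _ u0 u1 A(3) r]
    show "\<forall>t\<in>time_dom Tmax. u t \<in> Wplus \<Omega> a b lam p" if "u0 \<in> Wplus \<Omega> a b lam p"
      using W(1) that A(1) by simp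
    show "\<forall>t\<in>time_dom Tmax. u t \<in> Wminus \<Omega> a b lam p" if "u0 \<in> Wminus \<Omega> a b lam p"
      using W(2) that A(1) by simp
  }
  {
    assume C: "3 < p" "p < 5" "lam \<le> b * lam1" "ereal (E0 \<Omega> a b lam p u0 u1) < depth \<Omega> a b lam p"
    obtain \<rho> where r: "\<rho> > 0" "\<forall>f\<in>H01 \<Omega>. Ifun \<Omega> a b lam p f < 0 \<longrightarrow> \<rho> \<le> gradsq f"
      using away_superquartic[OF ev ab C(3,1,2)] by blast
    note W = Wplus_Wminus_invariant[OF sol _ _ u0 u1 C(4) r]
    show "\<forall>t\<in>time_dom Tmax. u t \<in> Wplus \<Omega> a b lam p" if "u0 \<in> Wplus \<Omega> a b lam p"
      using W(1) that C(1,2) by simp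
    show "\<forall>t\<in>time_dom Tmax. u t \<in> Wminus \<Omega> a b lam p" if "u0 \<in> Wminus \<Omega> a b lam p"
      using W(2) that C(1,2) by simp
  }
  {
    assume B: "p = 3" "(Lnorm \<Omega> 4 \<psi>1) ^ 4 - a * (Lnorm \<Omega> 2 (wgrad \<Omega> \<psi>1)) ^ 4 < 0" "b * lam1 < lam"
      and i: "u0 \<in> Nminus \<Omega> a b lam p \<inter> Jsub \<Omega> a b lam p (depth_minus \<Omega> a b lam)"
      and E: "ereal (E0 \<Omega> a b lam p u0 u1) < depth_minus \<Omega> a b lam"
    have d: "depth_minus \<Omega> a b lam < 0"
      using ev by (intro depth_minus_neg[OF _ B(3,2)]) (simp add: principal_eigenpair_def)
    show "\<forall>t\<in>time_dom Tmax. u t \<in> Nminus \<Omega> a b lam p \<inter> Jsub \<Omega> a b lam p (depth_minus \<Omega> a b lam)"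
    proof
      fix t assume t: "t \<in> time_dom Tmax"
      have S: "u t \<in> Jsub \<Omega> a b lam p (depth_minus \<Omega> a b lam)"
        "Ifun \<Omega> a b lam p (u t) < 0 \<longleftrightarrow> Ifun \<Omega> a b lam p u0 < 0"
        \<comment> \<open>The threshold \<rho> can be 0 because \<open>depth_minus_barrier\<close>
          covers every zero of I, the zero element included.\<close>
        using kirchhoff_sign_invariant[OF sol _ _ u0 u1 E _ _ t, of 0] depth_minus_barrier[OF d] B(1) by simp_all
      with i show "u t \<in> Nminus \<Omega> a b lam p \<inter> Jsub \<Omega> a b lam p (depth_minus \<Omega> a b lam)"
        by (simp add: Nminus_def Jsub_def)
    qed
  }
qed

end
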